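(* Let $f,g\in C^1(\mathbb{R}^2)$ be real-valued functions such that, for almost all $\eta\in\mathbb{R}$, $f(\xi,\eta)$ and $g(\xi,\eta)$ are strictly monotone in $\xi$ on the support of a measurable function $\chi$ on $\mathbb{R}^2$. Let $\sigma,\tau\in C^0(\mathbb{R}^2)$ be such that, for some $A>0$, we have $$\frac{|\sigma(\xi,\eta)|}{|\partial f/\partial\xi(\xi,\eta)|^{1/2}}\leq A\,\frac{|\tau(\xi,\eta)|}{|\partial g/\partial\xi(\xi,\eta)|^{1/2}}\qquad(\mathrm{I})$$ for all $(\xi,\eta)\in\operatorname{supp}\chi$ satisfying $\partial f/\partial\xi(\xi,\eta)\neq0$ and $\partial g/\partial\xi(\xi,\eta)\neq0$. Then (in dimension $n=2$) we have $$\left\|\chi(D_x,D_y)\sigma(D_x,D_y)e^{itf(D_x,D_y)}\varphi(x,y)\right\|_{L^2(\mathbb{R}_t\times\mathbb{R}_y)}\leq A\left\|\chi(D_x,D_y)\tau(D_x,D_y)e^{itg(D_x,D_y)}\varphi(\widetilde x,y)\right\|_{L^2(\mathbb{R}_t\times\mathbb{R}_y)}\qquad(\mathrm{II})$$ for all $x,\widetilde x\in\mathbb{R}$. Consequently, for general $n\geq2$ and for any measurable function $w$ on $\mathbb{R}^{n-1}$ we have $$\left\|w(\check x_k)\chi(D_j,D_k)\sigma(D_j,D_k)e^{itf(D_j,D_k)}\varphi(x)\right\|_{L^2(\mathbb{R}_t\times\mathbb{R}^n_x)}\leq A\left\|w(\check x_k)\chi(D_j,D_k)\tau(D_j,D_k)e^{itg(D_j,D_k)}\varphi(x)\right\|_{L^2(\mathbb{R}_t\times\mathbb{R}^n_x)},\qquad(\mathrm{III})$$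 where $j\neq k$ and $\check x_k=(x_1,\ldots,x_{k-1},x_{k+1},\ldots,x_n)$. Moreover, if $\chi\in C^0(\mathbb{R}^2)$ and $w\neq0$ on a set of $\mathbb{R}^{n-1}$ with positive measure, the converse is true, namely, if we have estimate (II) for all $\varphi$, for some $x,\widetilde x\in\mathbb{R}$, or if we have estimate (III) for all $\varphi$, and the norms are finite, then we also have inequality (I) (for all $(\xi,\eta)\in\operatorname{supp}\chi$ satisfying $\partial f/\partial\xi(\xi,\eta)\neq0$ and $\partial g/\partial\xi(\xi,\eta)\neq0$).
   Context: Notation: $D_j=\frac1i\frac{\partial}{\partial x_j}$ on $\mathbb{R}^n$; when $n=2$ we write $(x,y)=(x_1,x_2)$, $(\xi,\eta)=(\xi_1,\xi_2)$, $(D_x,D_y)=(D_1,D_2)$. For a function $a$ on $\mathbb{R}^2$ and indices $j\neq k$ in $\{1,\ldots,n\}$, $a(D_j,D_k)$ denotes the Fourier multiplier on $\mathbb{R}^n$ with symbol $a(\xi_j,\xi_k)$, i.e. $a(D_j,D_k)\varphi(x)=(2\pi)^{-n}\int_{\mathbb{R}^n}e^{ix\cdot\xi}a(\xi_j,\xi_k)\widehat\varphi(\xi)\,d\xi$ with $\widehat\varphi(\xi)=\int_{\mathbb{R}^n}e^{-ix\cdot\xi}\varphi(x)\,dx$. The function $\varphi$ is an arbitrary initial datum, on $\mathbb{R}^2$ in (II) and on $\mathbb{R}^n$ in (III) (the paper does not specify its class). In (II) the points $x,\widetilde x$ are fixed and the norms are taken in $(t,y)$.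
   Formalization: The estimates (II), (III) fail if critical points have positive measure; here φ is in L¹∩L² with absolutely convergent multiplier integrals, and for a.e. frequency with χφ̂≠0 both ∂f/∂ξ and ∂g/∂ξ are nonzero (automatic if the critical set in {χ≠0} is null). *)

theory Defs
  imports "HOL-Analysis.Analysis"
begin

definition C1_on_plane :: "(real \<times> real \<Rightarrow> real) \<Rightarrow> bool" where
  "C1_on_plane f \<longleftrightarrow>
     (\<exists>f' :: real \<times> real \<Rightarrow> (real \<times> real) \<Rightarrow>\<^sub>L real.
        (\<forall>z. (f has_derivative blinfun_apply (f' z)) (at z)) \<and> continuous_on UNIV f')"

definition d_xi :: "(real \<times> real \<Rightarrow> real) \<Rightarrow> real \<times> real \<Rightarrow> real" where
  "d_xi f z = deriv (\<lambda>s. f (s, snd z)) (fst z)"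

definition supp :: "('a::topological_space \<Rightarrow> complex) \<Rightarrow> 'a set" where
  "supp chi = closure {z. chi z \<noteq> 0}"

definition strictly_monotone_on :: "real set \<Rightarrow> (real \<Rightarrow> real) \<Rightarrow> bool" where
  "strictly_monotone_on S h \<longleftrightarrow> strict_mono_on S h \<or> strict_antimono_on S h"

text \<open>
  The Fourier transform and Fourier multipliers are given by their defining integrals. They are used
  only for data for which these converge absolutely (see \<open>admissible_datum\<close>). The measure is
  Lebesgue measure rather than \<open>lborel\<close>, so that symbols need not be Borel measurable.
\<close>

definition fourier :: "('a::euclidean_space \<Rightarrow> complex) \<Rightarrow> 'a \<Rightarrow> complex" where
  "fourier \<phi> \<xi> = (LINT x|lebesgue. exp (- \<i> * of_real (x \<bullet> \<xi>)) * \<phi> x)"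

definition fourier_multiplier ::
    "('a::euclidean_space \<Rightarrow> complex) \<Rightarrow> ('a \<Rightarrow> complex) \<Rightarrow> 'a \<Rightarrow> complex" where
  "fourier_multiplier a \<phi> x =
     of_real (1 / (2 * pi) ^ DIM('a)) *
     (LINT \<xi>|lebesgue. exp (\<i> * of_real (x \<bullet> \<xi>)) * a \<xi> * fourier \<phi> \<xi>)"

text \<open>
  \<open>propagator chi \<sigma> f p t\<close> is \<open>chi(D) \<sigma>(D) exp(i t f(D))\<close>, where \<open>p\<close> selects the two frequency
  variables on which the symbols depend.
\<close>

definition propagator ::
    "(real \<times> real \<Rightarrow> complex) \<Rightarrow> (real \<times> real \<Rightarrow> complex) \<Rightarrow> (real \<times> real \<Rightarrow> real) \<Rightarrow>
     ('a::euclidean_space \<Rightarrow> real \<times> real) \<Rightarrow> real \<Rightarrow> ('a \<Rightarrow> complex) \<Rightarrow> 'a \<Rightarrow> complex" where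
  "propagator chi \<sigma> f p t =
     fourier_multiplier (\<lambda>\<xi>. chi (p \<xi>) * \<sigma> (p \<xi>) * exp (\<i> * of_real (t * f (p \<xi>))))"

definition freq_pair :: "'n \<Rightarrow> 'n \<Rightarrow> real ^ 'n \<Rightarrow> real \<times> real" where
  "freq_pair j k \<xi> = (\<xi> $ j, \<xi> $ k)"

text \<open>
  \<open>\<real>\<^sup>n\<^sup>-\<^sup>1\<close>, the range of the variable \<open>x\<close> with its \<open>k\<close>-th coordinate omitted, is the space of
  families indexed by the indices other than \<open>k\<close>.
\<close>

definition omit_coord :: "'n \<Rightarrow> real ^ 'n \<Rightarrow> 'n \<Rightarrow> real" where
  "omit_coord k x = restrict (\<lambda>i. x $ i) (- {k})"

definition lebesgue_omit :: "'n::finite \<Rightarrow> ('n \<Rightarrow> real) measure" where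
  "lebesgue_omit k = completion (Pi\<^sub>M (- {k}) (\<lambda>_. lborel))"

definition L2_norm :: "('a::euclidean_space \<Rightarrow> complex) \<Rightarrow> ennreal" where
  "L2_norm u =
     (let I = (\<integral>\<^sup>+ z. ennreal ((norm (u z))\<^sup>2) \<partial>lebesgue)
      in if I = \<infinity> then \<infinity> else ennreal (sqrt (enn2real I)))"

definition trace_norm ::
    "(real \<times> real \<Rightarrow> complex) \<Rightarrow> (real \<times> real \<Rightarrow> complex) \<Rightarrow> (real \<times> real \<Rightarrow> real) \<Rightarrow>
     (real \<times> real \<Rightarrow> complex) \<Rightarrow> real \<Rightarrow> ennreal" where
  "trace_norm chi \<sigma> f \<phi> x =
     L2_norm (\<lambda>(t, y). propagator chi \<sigma> f (\<lambda>\<xi>. \<xi>) t \<phi> (x, y))"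

definition weighted_norm ::
    "'n::finite \<Rightarrow> 'n \<Rightarrow> (('n \<Rightarrow> real) \<Rightarrow> complex) \<Rightarrow>
     (real \<times> real \<Rightarrow> complex) \<Rightarrow> (real \<times> real \<Rightarrow> complex) \<Rightarrow> (real \<times> real \<Rightarrow> real) \<Rightarrow>
     (real ^ 'n \<Rightarrow> complex) \<Rightarrow> ennreal" where
  "weighted_norm j k w chi \<sigma> f \<phi> =
     L2_norm (\<lambda>(t :: real, x). w (omit_coord k x) * propagator chi \<sigma> f (freq_pair j k) t \<phi> x)"

text \<open>
  The class of initial data: \<open>\<phi>\<close> in the intersection of \<open>L\<^sup>1\<close> and \<open>L\<^sup>2\<close> such that the integrals
  defining the two multipliers converge absolutely, and such that \<open>chi(D) \<phi>\<close> has no frequencies in a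
  non-null set of critical points. The last condition is vacuous if the critical points of \<open>f\<close> and
  \<open>g\<close> in the set where \<open>chi\<close> is nonzero form a null set. It cannot be dropped in general: the
  comparison of the symbols says nothing at critical points, and a strictly increasing \<open>C\<^sup>1\<close>
  function may have a set of critical points of positive measure.
\<close>

definition admissible_datum ::
    "(real \<times> real \<Rightarrow> complex) \<Rightarrow> (real \<times> real \<Rightarrow> complex) \<Rightarrow> (real \<times> real \<Rightarrow> complex) \<Rightarrow>
     (real \<times> real \<Rightarrow> real) \<Rightarrow> (real \<times> real \<Rightarrow> real) \<Rightarrow>
     ('a::euclidean_space \<Rightarrow> real \<times> real) \<Rightarrow> ('a \<Rightarrow> complex) \<Rightarrow> bool" where
  "admissible_datum chi \<sigma> \<tau> f g p \<phi> \<longleftrightarrow>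
     integrable lebesgue \<phi> \<and>
     integrable lebesgue (\<lambda>x. (norm (\<phi> x))\<^sup>2) \<and>
     integrable lebesgue (\<lambda>\<xi>. chi (p \<xi>) * \<sigma> (p \<xi>) * fourier \<phi> \<xi>) \<and>
     integrable lebesgue (\<lambda>\<xi>. chi (p \<xi>) * \<tau> (p \<xi>) * fourier \<phi> \<xi>) \<and>
     (AE \<xi> in lebesgue.
        chi (p \<xi>) * fourier \<phi> \<xi> \<noteq> 0 \<longrightarrow> d_xi f (p \<xi>) \<noteq> 0 \<and> d_xi g (p \<xi>) \<noteq> 0)"

definition symbol_comparison ::
    "(real \<times> real \<Rightarrow> complex) \<Rightarrow> (real \<times> real \<Rightarrow> complex) \<Rightarrow> (real \<times> real \<Rightarrow> complex) \<Rightarrow>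
     (real \<times> real \<Rightarrow> real) \<Rightarrow> (real \<times> real \<Rightarrow> real) \<Rightarrow> real \<Rightarrow> bool" where
  "symbol_comparison chi \<sigma> \<tau> f g A \<longleftrightarrow>
     (\<forall>z \<in> supp chi. d_xi f z \<noteq> 0 \<and> d_xi g z \<noteq> 0 \<longrightarrow>
        norm (\<sigma> z) / sqrt \<bar>d_xi f z\<bar> \<le> A * (norm (\<tau> z) / sqrt \<bar>d_xi g z\<bar>))"

end

theory Submission
  imports Defs "HOL-Probability.Probability"
begin

text \<open>
  Fix all space variables except \<open>x\<^sub>k\<close>. As a function of \<open>t\<close> and \<open>y = x\<^sub>k\<close> the wave is then
  \<open>\<integral> exp(i (t f(\<xi>,\<eta>) + y \<eta>)) H(\<xi>,\<eta>) d\<xi> d\<eta>\<close>, the Fourier transform of the image of \<open>H d\<xi> d\<eta>\<close> under the map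
  \<open>(\<xi>,\<eta>) \<mapsto> (f(\<xi>,\<eta>), \<eta>)\<close>. Strict monotonicity makes this map injective where \<open>H\<close> lives, its Jacobian is
  \<open>\<partial>f/\<partial>\<xi>\<close>, and so the change of variables and Plancherel give the identity
  \<open>\<integral>\<integral> |u|\<^sup>2 dt dy = 4\<pi>\<^sup>2 \<integral>\<integral> |H|\<^sup>2 / |\<partial>f/\<partial>\<xi>| d\<xi> d\<eta>\<close> (theorem \<open>plancherel_plane_wave\<close>). It is obtained with
  one-dimensional tools alone: Plancherel in \<open>\<eta>\<close> for each fixed \<open>t\<close>, then for each fixed \<open>\<eta>\<close> the
  substitution \<open>\<lambda> = f(\<xi>,\<eta>)\<close> and Plancherel in \<open>\<lambda>\<close>.

  The remaining space variables enter \<open>H\<close> in two ways. The variable \<open>x\<^sub>j\<close> contributes a phase, which does not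
  change \<open>|H|\<close>; therefore a wave has the same energy on all traces \<open>x = const\<close>. The others
  contribute a partial Fourier transform of the datum, which commutes with multiplication by the
  symbols. So the amplitudes of the two waves satisfy \<open>\<tau> H\<^sub>\<sigma> = \<sigma> H\<^sub>\<tau>\<close> almost everywhere, and the
  comparison of the symbols is a pointwise comparison of the integrands of the two energies
  (theorem \<open>fibre_energy_le\<close>). Integrating the result against \<open>|w|\<^sup>2\<close> gives the weighted estimate.

  Conversely, suppose that the comparison fails at a point. By continuity it fails by a factor
  \<open>\<rho> > 1\<close> on an open set \<open>W\<close> where \<open>chi\<close> and \<open>\<sigma>\<close> do not vanish and there are no critical points. For a datum with
  frequencies in \<open>W\<close> the same energy estimate, with the two waves interchanged, contradicts the assumed
  inequality as soon as the energy is finite and positive. Such data are built from \<open>|v|\<^sup>2\<close>, with \<open>v\<close>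
  the Fourier transform of the indicator of an interval, in the two distinguished variables
  (\<open>exists_bandlimited_function\<close>), and from Gaussians in the others.
\<close>

section \<open>Continuity of translation in the mean\<close>

text \<open>
  Approximation in the mean starts from the Lusin-type description of measurable functions as
  almost everywhere limits of continuous ones.
\<close>

lemma ae_limit_of_continuous:
  fixes G :: "real \<Rightarrow> complex"
  assumes "G \<in> borel_measurable borel"
  shows "\<exists>g. (\<forall>n. continuous_on UNIV (g n)) \<and> (AE x in lborel. (\<lambda>n. g n x) \<longlonglongrightarrow> G x)"
proof -
  have "G \<in> borel_measurable lebesgue"
    using assms by (intro measurable_completion) simp
  then have "G \<in> borel_measurable (lebesgue_on UNIV)"
    by (rule measurable_restrict_space1)
  then have "G measurable_on UNIV"
    by (simp add: measurable_on_iff_borel_measurable)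
  then obtain N g where N: "negligible N" and g: "\<forall>n. continuous_on UNIV (g n)"
    and lim: "\<forall>x. x \<notin> N \<longrightarrow> (\<lambda>n. g n x) \<longlonglongrightarrow> G x"
    unfolding measurable_on_def by auto
  have "AE x in lebesgue. x \<notin> N"
    using N by (simp add: negligible_iff_null_sets AE_not_in)
  then have "AE x in lborel. x \<notin> N"
    by (simp add: AE_completion_iff)
  with lim have "AE x in lborel. (\<lambda>n. g n x) \<longlonglongrightarrow> G x"
    by (auto elim!: eventually_mono)
  with g show ?thesis by blast
qed

text \<open>
  The approximating continuous functions carry no domination, so the values are clipped and the
  argument is cut off, both continuously. For a fixed truncation level the convergence is then
  dominated by a constant on a bounded interval; the truncations of \<open>G\<close> itself
  converge to \<open>G\<close> dominated by \<open>|G|\<close>.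
\<close>

lemma integrable_approx_continuous_compact_support:
  fixes G :: "real \<Rightarrow> complex"
  assumes G: "integrable lborel G" and e: "e > 0"
  shows "\<exists>g R. continuous_on UNIV g \<and> (\<forall>x. \<bar>x\<bar> \<ge> R \<longrightarrow> g x = 0) \<and> integrable lborel g \<and>
           (LINT x|lborel. norm (G x - g x)) < e"
proof -
  \<comment> \<open>Both truncations are the identity as soon as \<open>n\<close> exceeds \<open>|x|\<close> and
    \<open>|G x|\<close>.\<close>
  define cutoff :: "nat \<Rightarrow> real \<Rightarrow> real" where "cutoff n x = max 0 (min 1 (n + 1 - \<bar>x\<bar>))" for n x
  define clip :: "nat \<Rightarrow> complex \<Rightarrow> complex" where
    "clip n z = of_real (Suc n / max (Suc n) (norm z)) * z" for n z
  define trunc where "trunc n h x = of_real (cutoff n x) * clip n (h x)" for n and h :: "real \<Rightarrow> complex" and x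
  have norm_clip: "norm (clip n z) = Suc n / max (Suc n) (norm z) * norm z" for n z
    unfolding clip_def norm_mult norm_of_real by simp
  have clip_norm: "norm (clip n z) \<le> Suc n" for n z
    unfolding norm_clip by (auto simp: max_def divide_simps mult_left_mono)
  have clip_norm': "norm (clip n z) \<le> norm z" for n z
    unfolding norm_clip by (auto simp: max_def divide_simps mult_right_mono)
  have cutoff01: "0 \<le> cutoff n x" "cutoff n x \<le> 1" for n x
    by (auto simp: cutoff_def)
  have cont_clip: "continuous_on UNIV (clip n)" for n
    unfolding clip_def by (intro continuous_intros) (auto simp: max_def)
  have cont_cutoff: "continuous_on UNIV (cutoff n)" for n
    unfolding cutoff_def by (intro continuous_intros)
  note [measurable] = borel_measurable_continuous_onI[OF cont_clip] borel_measurable_continuous_onI[OF cont_cutoff]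
  have [measurable]: "G \<in> borel_measurable borel" using G by (simp add: borel_measurable_integrable)
  have norm_trunc1: "norm (trunc n h x) \<le> norm (h x)" for n h x
  proof -
    have "norm (trunc n h x) = cutoff n x * norm (clip n (h x))"
      using cutoff01 by (simp add: trunc_def norm_mult)
    also have "\<dots> \<le> 1 * norm (h x)"
      using cutoff01 clip_norm' by (intro mult_mono) auto
    finally show ?thesis by simp
  qed
  have trunc_meas[measurable]: "trunc n h \<in> borel_measurable borel" if "h \<in> borel_measurable borel" for n h
    using that unfolding trunc_def[abs_def] by measurable
  have trunc_G: "(\<lambda>n. trunc n G x) \<longlonglongrightarrow> G x" for x
  proof -
    obtain N :: nat where N: "norm (G x) \<le> N" "\<bar>x\<bar> \<le> N"
      using real_arch_simple[of "max (norm (G x)) \<bar>x\<bar>"] by auto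
    have "eventually (\<lambda>n. trunc n G x = G x) sequentially"
      using eventually_ge_at_top[of N]
    proof eventually_elim
      case (elim n)
      have "norm (G x) \<le> 1 + real n" "\<bar>x\<bar> \<le> real n" using N elim by auto
      then show ?case by (simp add: trunc_def cutoff_def clip_def max_def)
    qed
    then show ?thesis by (rule tendsto_eventually)
  qed
  have "(\<lambda>n. LINT x|lborel. norm (G x - trunc n G x)) \<longlonglongrightarrow> (LINT x|lborel. norm (G x - G x))"
  proof (rule integral_dominated_convergence[where w="\<lambda>x. 2 * norm (G x)"])
    show "integrable lborel (\<lambda>x. 2 * norm (G x))" using G by auto
    show "AE x in lborel. norm (norm (G x - trunc n G x)) \<le> 2 * norm (G x)" for n
      using norm_triangle_ineq4[of "G x" "trunc n G x" for x] norm_trunc1[of n G]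
      by (intro AE_I2) (smt (verit) norm_ge_zero norm_trunc1 real_norm_def)
    show "AE x in lborel. (\<lambda>n. norm (G x - trunc n G x)) \<longlonglongrightarrow> norm (G x - G x)"
      by (intro AE_I2 tendsto_intros trunc_G)
  qed auto
  then have "eventually (\<lambda>n. (LINT x|lborel. norm (G x - trunc n G x)) < e / 2) sequentially"
    using e by (intro order_tendstoD) auto
  then obtain n where n: "(LINT x|lborel. norm (G x - trunc n G x)) < e / 2"
    by (auto simp: eventually_sequentially)
  obtain g where g: "\<And>k. continuous_on UNIV (g k)" and lim: "AE x in lborel. (\<lambda>k. g k x) \<longlonglongrightarrow> G x"
    using ae_limit_of_continuous[of G] by auto
  have [measurable]: "g k \<in> borel_measurable borel" for k
    using g by (rule borel_measurable_continuous_onI)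
  have supp: "trunc n h x = 0" if "\<bar>x\<bar> \<ge> real (n + 1)" for h and x :: real
    using that by (simp add: trunc_def cutoff_def)
  have bound: "norm (trunc n h x) \<le> real (Suc n) * indicator {- real (n + 1)..real (n + 1)} x" for h x
  proof (cases "\<bar>x\<bar> \<ge> real (n + 1)")
    case False
    have "norm (trunc n h x) = cutoff n x * norm (clip n (h x))"
      using cutoff01 by (simp add: trunc_def norm_mult)
    also have "\<dots> \<le> 1 * real (Suc n)"
      using cutoff01 clip_norm by (intro mult_mono) auto
    finally show ?thesis using False by (auto simp: indicator_def)
  next
    case True
    then show ?thesis using supp[OF True, of h] by simp
  qed
  have int_bound: "integrable lborel (\<lambda>x. real (Suc n) * indicator {- real (n + 1)..real (n + 1)} x)"
    by (intro integrable_mult_right integrable_real_indicator) (auto simp: emeasure_lborel_Icc_eq)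
  have int_trunc: "integrable lborel (trunc n h)" if "h \<in> borel_measurable borel" for h
    using that by (intro Bochner_Integration.integrable_bound[OF int_bound] AE_I2)
      (use bound in auto)
  have "(\<lambda>k. LINT x|lborel. norm (trunc n G x - trunc n (g k) x)) \<longlonglongrightarrow> (LINT x|lborel. norm (trunc n G x - trunc n G x))"
  proof (rule integral_dominated_convergence[where w="\<lambda>x. 2 * (real (Suc n) * indicator {- real (n + 1)..real (n + 1)} x)"])
    show "integrable lborel (\<lambda>x. 2 * (real (Suc n) * indicator {- real (n + 1)..real (n + 1)} x))"
      by (intro integrable_mult_right int_bound)
    show "AE x in lborel. norm (norm (trunc n G x - trunc n (g k) x)) \<le> 2 * (real (Suc n) * indicator {- real (n + 1)..real (n + 1)} x)" for k
    proof (intro AE_I2)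
      fix x
      show "norm (norm (trunc n G x - trunc n (g k) x)) \<le> 2 * (real (Suc n) * indicator {- real (n + 1)..real (n + 1)} x)"
        using norm_triangle_ineq4[of "trunc n G x" "trunc n (g k) x"] bound[of G x] bound[of "g k" x] by simp
    qed
    show "AE x in lborel. (\<lambda>k. norm (trunc n G x - trunc n (g k) x)) \<longlonglongrightarrow> norm (trunc n G x - trunc n G x)"
      using lim
    proof eventually_elim
      case (elim x)
      have "(\<lambda>k. clip n (g k x)) \<longlonglongrightarrow> clip n (G x)"
        using cont_clip[of n] elim by (intro isCont_tendsto_compose[of _ "clip n"]) (auto simp: continuous_on_eq_continuous_at)
      then show ?case unfolding trunc_def by (intro tendsto_intros)
    qed
  qed auto
  then have "eventually (\<lambda>k. (LINT x|lborel. norm (trunc n G x - trunc n (g k) x)) < e / 2) sequentially"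
    using e by (intro order_tendstoD) auto
  then obtain k where k: "(LINT x|lborel. norm (trunc n G x - trunc n (g k) x)) < e / 2"
    by (auto simp: eventually_sequentially)
  have cont: "continuous_on UNIV (trunc n (g k))"
    unfolding trunc_def[abs_def] using cont_cutoff[of n] g[of k]
    by (intro continuous_intros) (auto intro: continuous_on_compose2[OF cont_clip])
  have "(LINT x|lborel. norm (G x - trunc n (g k) x)) \<le>
     (LINT x|lborel. norm (G x - trunc n G x) + norm (trunc n G x - trunc n (g k) x))"
    using G int_trunc
    by (intro integral_mono) (auto intro: norm_diff_triangle_le)
  also have "\<dots> = (LINT x|lborel. norm (G x - trunc n G x)) + (LINT x|lborel. norm (trunc n G x - trunc n (g k) x))"
    using G int_trunc by (intro Bochner_Integration.integral_add) auto
  also have "\<dots> < e" using n k by simp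
  finally show ?thesis
    using cont int_trunc[of "g k"] supp
    by (intro exI[of _ "trunc n (g k)"] exI[of _ "real (n + 1)"] conjI allI impI) auto
qed

text \<open>
  For continuous functions of compact support this is dominated convergence, and translation is an
  isometry, so the approximation error is the same before and after the shift.
\<close>

lemma L1_translation_tendsto_0:
  fixes G :: "real \<Rightarrow> complex"
  assumes G: "integrable lborel G" and h: "h \<longlonglongrightarrow> (0::real)"
  shows "(\<lambda>n. LINT x|lborel. norm (G (x + h n) - G x)) \<longlonglongrightarrow> 0"
proof (rule LIMSEQ_I)
  fix e :: real assume e: "0 < e"
  then obtain g R where g: "continuous_on UNIV g" and R: "\<And>x. \<bar>x\<bar> \<ge> R \<Longrightarrow> g x = 0" 
    and gi: "integrable lborel g" and d: "(LINT x|lborel. norm (G x - g x)) < e / 3"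
    using integrable_approx_continuous_compact_support[OF G, of "e / 3"] by auto
  note [measurable] = borel_measurable_continuous_onI[OF g]
  have shift: "integrable lborel (\<lambda>x. f (x + a))" "(LINT x|lborel. f (x + a)) = (LINT x|lborel. f x)"
    if "integrable lborel f" for f :: "real \<Rightarrow> 'b::{banach, second_countable_topology}" and a
    using lborel_integrable_real_affine[OF that, of 1 a] lborel_integral_real_affine[of 1 f a]
    by (auto simp: add.commute)
  obtain B where B: "\<And>x. norm (g x) \<le> B"
  proof -
    have "compact (g ` {-R..R})" using g by (intro compact_continuous_image) (auto intro: continuous_on_subset)
    then obtain B where B: "\<forall>y\<in>g ` {-R..R}. norm y \<le> B" using compact_imp_bounded bounded_iff by blast
    have "norm (g x) \<le> max B 0" for x
    proof (cases "\<bar>x\<bar> \<ge> R")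
      case False
      then have "x \<in> {-R..R}" by auto
      then show ?thesis using B by (auto simp: le_max_iff_disj)
    qed (use R[of x] in auto)
    then show ?thesis using that by blast
  qed
  have B0: "0 \<le> B" using B[of 0] norm_ge_zero order_trans by blast
  obtain M where M: "\<And>n. \<bar>h n\<bar> \<le> M"
    using convergent_imp_Bseq[of h] h by (auto simp: convergent_def Bseq_def)
  have M0: "0 \<le> M" using M[of 0] by linarith
  have "(\<lambda>n. LINT x|lborel. norm (g (x + h n) - g x)) \<longlonglongrightarrow> (LINT x|lborel. norm (g (x + 0) - g x))"
  proof (rule integral_dominated_convergence[where w="\<lambda>x. 2 * B * indicator {-(\<bar>R\<bar> + M)..\<bar>R\<bar> + M} x"])
    show "integrable lborel (\<lambda>x. 2 * B * indicator {-(\<bar>R\<bar> + M)..\<bar>R\<bar> + M} x)"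
      by (intro integrable_mult_right integrable_real_indicator) (auto simp: emeasure_lborel_Icc_eq)
    show "AE x in lborel. norm (norm (g (x + h n) - g x)) \<le> 2 * B * indicator {-(\<bar>R\<bar> + M)..\<bar>R\<bar> + M} x" for n
    proof (intro AE_I2)
      fix x
      show "norm (norm (g (x + h n) - g x)) \<le> 2 * B * indicator {-(\<bar>R\<bar> + M)..\<bar>R\<bar> + M} x"
      proof (cases "\<bar>x\<bar> \<le> \<bar>R\<bar> + M")
        case True then show ?thesis
          using norm_triangle_ineq4[of "g (x + h n)" "g x"] B[of x] B[of "x + h n"] by (auto simp: indicator_def abs_le_iff)
      next
        case False
        then have "g x = 0" "g (x + h n) = 0" using R[of x] R[of "x + h n"] M[of n] M0 by linarith+
        then show ?thesis using B0 by (auto simp: indicator_def)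
      qed
    qed
    show "AE x in lborel. (\<lambda>n. norm (g (x + h n) - g x)) \<longlonglongrightarrow> norm (g (x + 0) - g x)"
    proof (intro AE_I2 tendsto_intros)
      fix x
      have "isCont g (x + 0)" using g by (simp add: continuous_on_eq_continuous_at)
      then show "(\<lambda>n. g (x + h n)) \<longlonglongrightarrow> g (x + 0)"
        by (rule isCont_tendsto_compose) (intro tendsto_intros h)
    qed
  qed auto
  then have "eventually (\<lambda>n. (LINT x|lborel. norm (g (x + h n) - g x)) < e / 3) sequentially"
    using e by (intro order_tendstoD) auto
  then have "eventually (\<lambda>n. norm ((LINT x|lborel. norm (G (x + h n) - G x)) - 0) < e) sequentially"
  proof eventually_elim
    case (elim n)
    note int = G gi shift(1)[OF G, of "h n"] shift(1)[OF gi, of "h n"]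
    have "(LINT x|lborel. norm (G (x + h n) - G x)) \<le>
       (LINT x|lborel. (norm (G (x + h n) - g (x + h n)) + norm (g (x + h n) - g x)) + norm (G x - g x))"
    proof (intro integral_mono)
      fix x
      show "norm (G (x + h n) - G x) \<le> (norm (G (x + h n) - g (x + h n)) + norm (g (x + h n) - g x)) + norm (G x - g x)"
        by norm
    qed (intro int integrable_norm Bochner_Integration.integrable_diff Bochner_Integration.integrable_add)+
    also have "\<dots> = (LINT x|lborel. norm (G (x + h n) - g (x + h n))) + (LINT x|lborel. norm (g (x + h n) - g x))
       + (LINT x|lborel. norm (G x - g x))"
      using int by simp
    also have "(LINT x|lborel. norm (G (x + h n) - g (x + h n))) = (LINT x|lborel. norm (G x - g x))"
      using shift(2)[of "\<lambda>x. norm (G x - g x)" "h n"] G gi by simp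
    finally have "(LINT x|lborel. norm (G (x + h n) - G x)) < e" using elim d by linarith
    moreover have "0 \<le> (LINT x|lborel. norm (G (x + h n) - G x))" by simp
    ultimately show ?case by simp
  qed
  then show "\<exists>no. \<forall>n\<ge>no. norm ((LINT x|lborel. norm (G (x + h n) - G x)) - 0) < e"
    by (simp add: eventually_sequentially)
qed

section \<open>Plancherel's identity on the line\<close>

lemma std_normal_density_le_1: "std_normal_density x \<le> 1"
proof -
  have "1 \<le> sqrt (2 * pi)" using pi_ge_two by simp
  then have "1 / sqrt (2 * pi) * exp (- x\<^sup>2 / 2) \<le> 1 * 1"
    by (intro mult_mono) auto
  then show ?thesis by (simp add: std_normal_density_def)
qed

lemma norm_integral_le_nn_integral:
  fixes f :: "'a \<Rightarrow> 'b::{banach, second_countable_topology}"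
  shows "ennreal (norm (integral\<^sup>L M f)) \<le> (\<integral>\<^sup>+x. ennreal (norm (f x)) \<partial>M)"
  by (cases "integrable M f") (auto simp: integral_norm_bound_ennreal not_integrable_integral_eq)

lemma fourier_std_normal:
  "(LINT x|lborel. iexp (t * x) * of_real (std_normal_density x)) = of_real (exp (- t\<^sup>2 / 2))"
proof -
  have "(LINT x|lborel. iexp (t * x) * of_real (std_normal_density x)) = char std_normal_distribution t"
    unfolding char_def
    by (subst integral_density) (auto simp: scaleR_conv_of_real mult.commute)
  then show ?thesis by (simp add: char_std_normal_distribution)
qed

text \<open>
  The transform of a Gaussian is a multiple of a probability density. The constants are arranged
  so that the density has variance \<open>2 e\<^sup>2\<close>, which makes it the self-convolution
  of the density of variance \<open>e\<^sup>2\<close>.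
\<close>

lemma fourier_gaussian:
  assumes e: "e > 0"
  shows "(LINT t|lborel. iexp (t * s) * of_real (exp (- (e * t)\<^sup>2)))
     = of_real (2 * pi * normal_density 0 (sqrt 2 * e) s)"
proof -
  let ?c = "1 / (sqrt 2 * e)"
  have c: "?c > 0" using e by simp
  have "(LINT t|lborel. iexp (t * s) * of_real (exp (- (e * t)\<^sup>2))) =
     \<bar>?c\<bar> *\<^sub>R (LINT x|lborel. iexp ((0 + ?c * x) * s) * of_real (exp (- (e * (0 + ?c * x))\<^sup>2)))"
    using c by (intro lborel_integral_real_affine) auto
  also have "(\<lambda>x. iexp ((0 + ?c * x) * s) * of_real (exp (- (e * (0 + ?c * x))\<^sup>2))) =
     (\<lambda>x. of_real (sqrt (2 * pi)) * (iexp ((?c * s) * x) * of_real (std_normal_density x)))"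
  proof
    fix x :: real
    have "(e * (0 + ?c * x))\<^sup>2 = x\<^sup>2 / 2"
      using e by (simp add: power2_eq_square field_simps)
    moreover have "(0 + ?c * x) * s = (?c * s) * x" by simp
    ultimately show "iexp ((0 + ?c * x) * s) * of_real (exp (- (e * (0 + ?c * x))\<^sup>2)) =
     of_real (sqrt (2 * pi)) * (iexp ((?c * s) * x) * of_real (std_normal_density x))"
      unfolding std_normal_density_def by (simp add: field_simps flip: of_real_mult)
  qed
  also have "(LINT x|lborel. of_real (sqrt (2 * pi)) * (iexp ((?c * s) * x) * of_real (std_normal_density x)))
      = of_real (sqrt (2 * pi)) * of_real (exp (- (?c * s)\<^sup>2 / 2))"
    by (subst integral_mult_right_zero, subst fourier_std_normal) simp
  also have "\<bar>?c\<bar> *\<^sub>R (complex_of_real (sqrt (2 * pi)) * of_real (exp (- (?c * s)\<^sup>2 / 2))) =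
      of_real (?c * sqrt (2 * pi) * exp (- (?c * s)\<^sup>2 / 2))"
    using c by (simp add: scaleR_conv_of_real)
  also have "?c * sqrt (2 * pi) * exp (- (?c * s)\<^sup>2 / 2) = 2 * pi * normal_density 0 (sqrt 2 * e) s"
  proof -
    have "(?c * s)\<^sup>2 / 2 = s\<^sup>2 / (2 * (sqrt 2 * e)\<^sup>2)"
      by (simp add: power_mult_distrib power_divide)
    moreover have "sqrt (2 * pi * (sqrt 2 * e)\<^sup>2) = sqrt (2 * pi) * (sqrt 2 * e)"
      using e by (simp add: real_sqrt_mult)
    moreover have "sqrt (2 * pi) / (sqrt 2 * e) = 2 * pi / (sqrt (2 * pi) * (sqrt 2 * e))"
      using e by (simp add: field_simps)
    ultimately show ?thesis unfolding normal_density_def by simp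
  qed
  finally show ?thesis .
qed

lemma normal_density_autoconvolution:
  assumes e: "e > 0"
  shows "(\<integral>\<^sup>+x. ennreal (normal_density 0 e (x - a) * normal_density 0 e (x - b)) \<partial>lborel)
     = ennreal (normal_density 0 (sqrt 2 * e) (a - b))"
proof -
  have "ennreal (normal_density 0 (sqrt 2 * e) (a - b)) =
     (\<integral>\<^sup>+y. ennreal (normal_density 0 e (a - b - y) * normal_density 0 e y) \<partial>lborel)"
    using fun_cong[OF conv_normal_density_zero_mean[OF e e], of "a - b"] e
    by (simp add: real_sqrt_mult flip: mult_2)
  also have "\<dots> = (\<integral>\<^sup>+x. ennreal (normal_density 0 e (a - b - (- b + 1 * x)) * normal_density 0 e (- b + 1 * x)) \<partial>lborel)"
    by (subst nn_integral_real_affine[where c=1 and t="-b"]) auto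
  also have "\<dots> = (\<integral>\<^sup>+x. ennreal (normal_density 0 e (x - a) * normal_density 0 e (x - b)) \<partial>lborel)"
    by (intro nn_integral_cong) (simp add: normal_density_def power2_commute)
  finally show ?thesis ..
qed

lemma
  fixes f :: "'a \<Rightarrow> 'c::{real_normed_field,banach,second_countable_topology}"
  assumes "sigma_finite_measure M1" "sigma_finite_measure M2" and f: "integrable M1 f" and g: "integrable M2 g"
  shows integrable_pair_mult: "integrable (M1 \<Otimes>\<^sub>M M2) (\<lambda>p. f (fst p) * g (snd p))"
    and integral_pair_mult: "(LINT p|(M1 \<Otimes>\<^sub>M M2). f (fst p) * g (snd p)) = (LINT x|M1. f x) * (LINT x|M2. g x)"
proof -
  interpret pair_sigma_finite M1 M2 using assms by (simp add: pair_sigma_finite_def)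
  have [measurable]: "f \<in> borel_measurable M1" "g \<in> borel_measurable M2" using f g by auto
  show I: "integrable (M1 \<Otimes>\<^sub>M M2) (\<lambda>p. f (fst p) * g (snd p))"
    using f g by (intro Fubini_integrable) (auto simp: norm_mult)
  show "(LINT p|(M1 \<Otimes>\<^sub>M M2). f (fst p) * g (snd p)) = (LINT x|M1. f x) * (LINT x|M2. g x)"
    using integral_fst'[OF I] f g by simp
qed

lemma integrable_exp_neg_square:
  assumes "e > 0"
  shows "integrable lborel (\<lambda>t::real. exp (- (e * t)\<^sup>2))"
proof -
  have "integrable lborel (\<lambda>t. sqrt pi / e * normal_density 0 (1 / (sqrt 2 * e)) t)"
    using assms by (intro integrable_mult_right integrable_normal_density) auto
  also have "(\<lambda>t. sqrt pi / e * normal_density 0 (1 / (sqrt 2 * e)) t) = (\<lambda>t. exp (- (e * t)\<^sup>2))"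
    using assms by (simp add: normal_density_def fun_eq_iff power_mult_distrib power_divide real_sqrt_divide real_sqrt_mult field_simps)
  finally show ?thesis .
qed

text \<open>
  With a Gaussian weight all integrals converge absolutely and Fubini applies: the square of the
  transform is a double integral over \<open>G(a) cnj(G(b))\<close>, and integrating
  \<open>t\<close> out leaves a normal density in \<open>a - b\<close>. Writing this density as a
  self-convolution turns the double integral back into the square of the mollification of
  \<open>G\<close>.
\<close>

lemma plancherel_gaussian_regularized:
  fixes G :: "real \<Rightarrow> complex"
  assumes G: "integrable lborel G" and e: "e > 0"
  shows "(\<integral>\<^sup>+t. ennreal (exp (- (e * t)\<^sup>2) * (norm (LINT l|lborel. iexp (t * l) * G l))\<^sup>2) \<partial>lborel) =
     ennreal (2 * pi) * (\<integral>\<^sup>+x. ennreal ((norm (LINT l|lborel. of_real (normal_density 0 e (x - l)) * G l))\<^sup>2) \<partial>lborel)"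
proof -
  have [measurable]: "G \<in> borel_measurable borel" using G by simp
  let ?P = "lborel \<Otimes>\<^sub>M lborel :: (real \<times> real) measure"
  let ?n = "normal_density 0 e"
  define J where "J p = G (fst p) * cnj (G (snd p))" for p
  have J: "integrable ?P J"
    unfolding J_def using G by (intro integrable_pair_mult) (auto intro: sigma_finite_lborel)
  have [measurable]: "J \<in> borel_measurable ?P" using J by simp
  define u where "u t = (LINT l|lborel. iexp (t * l) * G l)" for t
  define v where "v x = (LINT l|lborel. of_real (?n (x - l)) * G l)" for x
  have [measurable]: "u \<in> borel_measurable borel" unfolding u_def[abs_def] by measurable
  have [measurable]: "v \<in> borel_measurable borel" unfolding v_def[abs_def] by measurable
  have P: "sigma_finite_measure ?P"
    using lborel_prod sigma_finite_lborel by metis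
  interpret Q: pair_sigma_finite ?P "lborel :: real measure"
    using P sigma_finite_lborel by (simp add: pair_sigma_finite_def)
  have n_bound: "?n y \<le> 1 / sqrt (2 * pi * e\<^sup>2)" for y
    using e by (simp add: normal_density_def divide_simps)
  have n2_bound: "normal_density 0 (sqrt 2 * e) y \<le> 1 / sqrt (2 * pi * (sqrt 2 * e)\<^sup>2)" for y
    using e by (simp add: normal_density_def divide_simps)
  have int_nG: "integrable lborel (\<lambda>l. of_real (?n (x - l)) * G l)" for x
  proof (rule Bochner_Integration.integrable_bound[of _ "\<lambda>l. (1 / sqrt (2 * pi * e\<^sup>2)) * norm (G l)"])
    show "AE l in lborel. norm (of_real (?n (x - l)) * G l) \<le> norm (1 / sqrt (2 * pi * e\<^sup>2) * norm (G l))"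
      using mult_right_mono[OF n_bound norm_ge_zero] by (auto simp: norm_mult)
  qed (use G in auto)
  have int_eG: "integrable lborel (\<lambda>l. iexp (t * l) * G l)" for t
    by (rule Bochner_Integration.integrable_bound[OF G]) (auto simp: norm_mult)
  have u2: "of_real ((norm (u t))\<^sup>2) = (LINT p|?P. iexp (t * (fst p - snd p)) * J p)" for t
  proof -
    have "of_real ((norm (u t))\<^sup>2) = u t * cnj (u t)"
      by (rule complex_norm_square)
    also have "cnj (u t) = (LINT l|lborel. cnj (iexp (t * l) * G l))"
      unfolding u_def by (rule Bochner_Integration.integral_cnj[symmetric])
    also have "u t * \<dots> = (LINT p|?P. (iexp (t * fst p) * G (fst p)) * cnj (iexp (t * snd p) * G (snd p)))"
      unfolding u_def using int_eG
      by (intro integral_pair_mult[symmetric]) (auto intro: sigma_finite_lborel simp del: complex_cnj_mult)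
    also have "\<dots> = (LINT p|?P. iexp (t * (fst p - snd p)) * J p)"
      by (intro Bochner_Integration.integral_cong)
         (auto simp: J_def exp_cnj exp_add exp_diff right_diff_distrib exp_minus field_simps)
    finally show ?thesis .
  qed
  have v2: "of_real ((norm (v x))\<^sup>2) = (LINT p|?P. of_real (?n (x - fst p) * ?n (x - snd p)) * J p)" for x
  proof -
    have "of_real ((norm (v x))\<^sup>2) = v x * cnj (v x)"
      by (rule complex_norm_square)
    also have "cnj (v x) = (LINT l|lborel. cnj (of_real (?n (x - l)) * G l))"
      unfolding v_def by (rule Bochner_Integration.integral_cnj[symmetric])
    also have "v x * \<dots> = (LINT p|?P. (of_real (?n (x - fst p)) * G (fst p)) * cnj (of_real (?n (x - snd p)) * G (snd p)))"
      unfolding v_def using int_nG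
      by (intro integral_pair_mult[symmetric]) (auto intro: sigma_finite_lborel simp del: complex_cnj_mult)
    also have "\<dots> = (LINT p|?P. of_real (?n (x - fst p) * ?n (x - snd p)) * J p)"
      by (intro Bochner_Integration.integral_cong) (auto simp: J_def)
    finally show ?thesis .
  qed
  have I1: "integrable (?P \<Otimes>\<^sub>M lborel) (\<lambda>q. J (fst q) * of_real (exp (- (e * snd q)\<^sup>2)))"
    using J integrable_exp_neg_square[OF e]
    by (intro integrable_pair_mult) (auto intro: sigma_finite_lborel P)
  have I1': "integrable (?P \<Otimes>\<^sub>M lborel)
      (\<lambda>(p,t). of_real (exp (- (e * t)\<^sup>2)) * (iexp (t * (fst p - snd p)) * J p))"
    by (rule Bochner_Integration.integrable_bound[OF I1]) (auto simp: norm_mult)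
  have I2: "integrable (?P \<Otimes>\<^sub>M lborel)
      (\<lambda>(p,x). of_real (?n (x - fst p) * ?n (x - snd p)) * J p)"
  proof (rule integrableI_bounded)
    have "(\<integral>\<^sup>+ q. ennreal (norm (case q of (p,x) \<Rightarrow> of_real (?n (x - fst p) * ?n (x - snd p)) * J p)) \<partial>(?P \<Otimes>\<^sub>M lborel))
       = (\<integral>\<^sup>+p. \<integral>\<^sup>+x. ennreal (norm (J p)) * ennreal (?n (x - fst p) * ?n (x - snd p)) \<partial>lborel \<partial>?P)"
      by (subst sigma_finite_measure.nn_integral_fst[OF sigma_finite_lborel, symmetric])
         (auto simp: norm_mult ennreal_mult' mult.commute intro!: nn_integral_cong)
    also have "\<dots> = (\<integral>\<^sup>+p. ennreal (norm (J p)) * ennreal (normal_density 0 (sqrt 2 * e) (fst p - snd p)) \<partial>?P)"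
      by (intro nn_integral_cong) (simp add: nn_integral_cmult normal_density_autoconvolution[OF e])
    also have "\<dots> \<le> (\<integral>\<^sup>+p. ennreal (norm (J p)) * ennreal (1 / sqrt (2 * pi * (sqrt 2 * e)\<^sup>2)) \<partial>?P)"
      by (intro nn_integral_mono mult_left_mono ennreal_leI n2_bound) auto
    also have "\<dots> = (\<integral>\<^sup>+p. ennreal (norm (J p)) \<partial>?P) * ennreal (1 / sqrt (2 * pi * (sqrt 2 * e)\<^sup>2))"
      by (intro nn_integral_multc) auto
    also have "\<dots> < \<infinity>"
      using J by (auto simp: integrable_iff_bounded ennreal_mult_less_top)
    finally show "(\<integral>\<^sup>+ q. ennreal (norm (case q of (p,x) \<Rightarrow> of_real (?n (x - fst p) * ?n (x - snd p)) * J p)) \<partial>(?P \<Otimes>\<^sub>M lborel)) < \<infinity>" .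
  qed measurable
  \<comment> \<open>The two Fubini exchanges meet in the middle at the density of variance \<open>2
    e\<^sup>2\<close> in \<open>fst p - snd p\<close>.\<close>
  have conv: "(LINT x|lborel. complex_of_real (?n (x - fst p) * ?n (x - snd p))) = of_real (normal_density 0 (sqrt 2 * e) (fst p - snd p))" for p
  proof -
    have "(LINT x|lborel. ?n (x - fst p) * ?n (x - snd p)) = normal_density 0 (sqrt 2 * e) (fst p - snd p)"
      by (subst integral_eq_nn_integral) (auto simp: normal_density_autoconvolution[OF e])
    then show ?thesis by (simp only: integral_complex_of_real)
  qed
  have eq: "(LINT t|lborel. of_real (exp (- (e * t)\<^sup>2) * (norm (u t))\<^sup>2)) = 
     of_real (2 * pi) * (LINT x|lborel. complex_of_real ((norm (v x))\<^sup>2))"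
  proof -
    have "(LINT t|lborel. of_real (exp (- (e * t)\<^sup>2) * (norm (u t))\<^sup>2)) =
       (LINT t|lborel. LINT p|?P. of_real (exp (- (e * t)\<^sup>2)) * (iexp (t * (fst p - snd p)) * J p))"
      by (simp only: of_real_mult u2 integral_mult_right_zero)
    also have "\<dots> = (LINT p|?P. LINT t|lborel. of_real (exp (- (e * t)\<^sup>2)) * (iexp (t * (fst p - snd p)) * J p))"
      by (rule Q.Fubini_integral[OF I1'])
    also have "\<dots> = (LINT p|?P. of_real (2 * pi) * (of_real (normal_density 0 (sqrt 2 * e) (fst p - snd p)) * J p))"
    proof (intro Bochner_Integration.integral_cong refl)
      fix p
      have "(LINT t|lborel. of_real (exp (- (e * t)\<^sup>2)) * (iexp (t * (fst p - snd p)) * J p)) =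
         (LINT t|lborel. (iexp (t * (fst p - snd p)) * of_real (exp (- (e * t)\<^sup>2))) * J p)"
        by (simp add: mult_ac)
      also have "\<dots> = (LINT t|lborel. (iexp (t * (fst p - snd p)) * of_real (exp (- (e * t)\<^sup>2)))) * J p"
        by (rule integral_mult_left_zero)
      finally show "(LINT t|lborel. of_real (exp (- (e * t)\<^sup>2)) * (iexp (t * (fst p - snd p)) * J p)) =
         of_real (2 * pi) * (of_real (normal_density 0 (sqrt 2 * e) (fst p - snd p)) * J p)"
        unfolding fourier_gaussian[OF e] by (simp only: of_real_mult mult.assoc)
    qed
    also have "\<dots> = of_real (2 * pi) * (LINT p|?P. of_real (normal_density 0 (sqrt 2 * e) (fst p - snd p)) * J p)"
      by (rule integral_mult_right_zero)
    also have "(LINT p|?P. of_real (normal_density 0 (sqrt 2 * e) (fst p - snd p)) * J p) = 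
      (LINT p|?P. LINT x|lborel. of_real (?n (x - fst p) * ?n (x - snd p)) * J p)"
      by (intro Bochner_Integration.integral_cong refl) (simp only: integral_mult_left_zero conv)
    also have "\<dots> = (LINT x|lborel. LINT p|?P. of_real (?n (x - fst p) * ?n (x - snd p)) * J p)"
      by (rule Q.Fubini_integral[symmetric, OF I2])
    also have "\<dots> = (LINT x|lborel. complex_of_real ((norm (v x))\<^sup>2))"
      by (simp only: v2)
    finally show ?thesis .
  qed
  have "integrable lborel (\<lambda>t. of_real (exp (- (e * t)\<^sup>2) * (norm (u t))\<^sup>2) :: complex)"
    using Q.integrable_snd[OF I1'] by (simp only: of_real_mult u2 integral_mult_right_zero)
  then have i1: "integrable lborel (\<lambda>t. exp (- (e * t)\<^sup>2) * (norm (u t))\<^sup>2)"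
    by (simp only: complex_of_real_integrable_eq)
  have "integrable lborel (\<lambda>x. of_real ((norm (v x))\<^sup>2) :: complex)"
    using Q.integrable_snd[OF I2] by (simp only: v2)
  then have i2: "integrable lborel (\<lambda>x. (norm (v x))\<^sup>2)"
    by (simp only: complex_of_real_integrable_eq)
  have real_eq: "(LINT t|lborel. exp (- (e * t)\<^sup>2) * (norm (u t))\<^sup>2) = 2 * pi * (LINT x|lborel. (norm (v x))\<^sup>2)"
    using eq unfolding integral_complex_of_real by (simp flip: of_real_mult)
  have L: "(\<integral>\<^sup>+t. ennreal (exp (- (e * t)\<^sup>2) * (norm (u t))\<^sup>2) \<partial>lborel) = ennreal (LINT t|lborel. exp (- (e * t)\<^sup>2) * (norm (u t))\<^sup>2)"
    using i1 by (intro nn_integral_eq_integral) auto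
  have R: "(\<integral>\<^sup>+x. ennreal ((norm (v x))\<^sup>2) \<partial>lborel) = ennreal (LINT x|lborel. (norm (v x))\<^sup>2)"
    using i2 by (intro nn_integral_eq_integral) auto
  show ?thesis
    unfolding u_def[symmetric] v_def[symmetric] L R real_eq by (rule ennreal_mult') simp
qed

text \<open>
  Cauchy-Schwarz with respect to the probability density, followed by Tonelli.
\<close>

lemma norm_gaussian_mollification_le:
  fixes G :: "real \<Rightarrow> complex"
  assumes G: "integrable lborel G" and e: "e > 0"
  shows "(\<integral>\<^sup>+x. ennreal ((norm (LINT l|lborel. of_real (normal_density 0 e (x - l)) * G l))\<^sup>2) \<partial>lborel)
     \<le> (\<integral>\<^sup>+l. ennreal ((norm (G l))\<^sup>2) \<partial>lborel)"
proof -
  have [measurable]: "G \<in> borel_measurable borel" using G by simp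
  let ?n = "normal_density 0 e"
  have n1: "(\<integral>\<^sup>+l. ennreal (?n (x - l)) \<partial>lborel) = 1" for x
  proof -
    have "(\<integral>\<^sup>+l. ennreal (?n (x - l)) \<partial>lborel) = (\<integral>\<^sup>+l. ennreal (normal_density x e l) \<partial>lborel)"
      by (intro nn_integral_cong) (simp add: normal_density_def power2_commute)
    also have "\<dots> = 1"
      using e by (subst nn_integral_eq_integral) (auto simp: integral_normal_density integrable_normal_density)
    finally show ?thesis .
  qed
  have n1': "(\<integral>\<^sup>+x. ennreal (?n (x - l)) \<partial>lborel) = 1" for l
    using n1[of l] by (simp add: normal_density_def power2_commute)
  have "ennreal ((norm (LINT l|lborel. of_real (?n (x - l)) * G l))\<^sup>2)
      \<le> (\<integral>\<^sup>+l. ennreal (?n (x - l)) * ennreal ((norm (G l))\<^sup>2) \<partial>lborel)" for x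
  proof -
    have "ennreal (norm (LINT l|lborel. of_real (?n (x - l)) * G l))
        \<le> (\<integral>\<^sup>+l. ennreal (norm (of_real (?n (x - l)) * G l)) \<partial>lborel)"
      by (rule norm_integral_le_nn_integral)
    also have "\<dots> = (\<integral>\<^sup>+l. ennreal (sqrt (?n (x - l))) * ennreal (sqrt (?n (x - l)) * norm (G l)) \<partial>lborel)"
      by (intro nn_integral_cong) (simp add: norm_mult flip: ennreal_mult mult.assoc)
    finally have "(ennreal (norm (LINT l|lborel. of_real (?n (x - l)) * G l)))\<^sup>2
        \<le> (\<integral>\<^sup>+l. ennreal (sqrt (?n (x - l))) * ennreal (sqrt (?n (x - l)) * norm (G l)) \<partial>lborel)\<^sup>2"
      by (intro power_mono) auto
    also have "\<dots> \<le> (\<integral>\<^sup>+l. (ennreal (sqrt (?n (x - l))))\<^sup>2 \<partial>lborel) *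
        (\<integral>\<^sup>+l. (ennreal (sqrt (?n (x - l)) * norm (G l)))\<^sup>2 \<partial>lborel)"
      by (intro Cauchy_Schwarz_nn_integral) auto
    also have "(\<integral>\<^sup>+l. (ennreal (sqrt (?n (x - l))))\<^sup>2 \<partial>lborel) = 1"
      using n1[of x] by (simp add: ennreal_power)
    also have "(\<integral>\<^sup>+l. (ennreal (sqrt (?n (x - l)) * norm (G l)))\<^sup>2 \<partial>lborel) =
        (\<integral>\<^sup>+l. ennreal (?n (x - l)) * ennreal ((norm (G l))\<^sup>2) \<partial>lborel)"
      by (intro nn_integral_cong) (simp add: ennreal_power power_mult_distrib ennreal_mult)
    finally show ?thesis by (simp add: ennreal_power)
  qed
  then have "(\<integral>\<^sup>+x. ennreal ((norm (LINT l|lborel. of_real (?n (x - l)) * G l))\<^sup>2) \<partial>lborel) \<le>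
     (\<integral>\<^sup>+x. \<integral>\<^sup>+l. ennreal (?n (x - l)) * ennreal ((norm (G l))\<^sup>2) \<partial>lborel \<partial>lborel)"
    by (intro nn_integral_mono)
  also have "\<dots> = (\<integral>\<^sup>+l. \<integral>\<^sup>+x. ennreal (?n (x - l)) * ennreal ((norm (G l))\<^sup>2) \<partial>lborel \<partial>lborel)"
    by (intro lborel_pair.Fubini') auto
  also have "\<dots> = (\<integral>\<^sup>+l. ennreal ((norm (G l))\<^sup>2) \<partial>lborel)"
    by (intro nn_integral_cong) (simp add: nn_integral_multc n1')
  finally show ?thesis .
qed

text \<open>
  After rescaling, the mollification is an average of translates of \<open>G\<close> by
  \<open>e\<^sub>n y\<close> over the standard normal distribution of \<open>y\<close>, so the
  claim follows from the continuity of translation.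
\<close>

lemma gaussian_mollification_tendsto_L1:
  fixes G :: "real \<Rightarrow> complex"
  assumes G: "integrable lborel G" and e: "\<And>n. e n > 0" and lim: "e \<longlonglongrightarrow> (0::real)"
  shows "\<And>n. integrable lborel (\<lambda>x. (LINT l|lborel. of_real (normal_density 0 (e n) (x - l)) * G l) - G x)"
    and "(\<lambda>n. LINT x|lborel. norm ((LINT l|lborel. of_real (normal_density 0 (e n) (x - l)) * G l) - G x)) \<longlonglongrightarrow> 0"
proof -
  have [measurable]: "G \<in> borel_measurable borel" using G by simp
  have shift: "integrable lborel (\<lambda>x. G (x + a))" for a
    using lborel_integrable_real_affine[OF G, of 1 a] by (simp add: add.commute)
  define \<omega> where "\<omega> h = (LINT x|lborel. norm (G (x + h) - G x))" for h
  have [measurable]: "\<omega> \<in> borel_measurable borel" unfolding \<omega>_def[abs_def] by measurable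
  have \<omega>0: "0 \<le> \<omega> h" for h by (simp add: \<omega>_def)
  have \<omega>_bound: "\<omega> h \<le> 2 * (LINT x|lborel. norm (G x))" for h
  proof -
    have "\<omega> h \<le> (LINT x|lborel. norm (G (x + h)) + norm (G x))"
      unfolding \<omega>_def using shift G by (intro integral_mono) (auto intro: norm_triangle_ineq4)
    also have "\<dots> = (LINT x|lborel. norm (G (x + h))) + (LINT x|lborel. norm (G x))"
      using shift G by (intro Bochner_Integration.integral_add) auto
    also have "(LINT x|lborel. norm (G (x + h))) = (LINT x|lborel. norm (G x))"
      using lborel_integral_real_affine[of 1 "\<lambda>x. norm (G x)" h] by (simp add: add.commute)
    finally show ?thesis by simp
  qed
  have \<omega>_nn: "ennreal (\<omega> h) = (\<integral>\<^sup>+x. ennreal (norm (G (x + h) - G x)) \<partial>lborel)" for h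
    unfolding \<omega>_def using shift G by (subst nn_integral_eq_integral) auto
  let ?v = "\<lambda>n x. LINT l|lborel. of_real (normal_density 0 (e n) (x - l)) * G l"
  have int_nG: "integrable lborel (\<lambda>y. of_real (std_normal_density y) * G (x + e n * y))" for n x
  proof (rule Bochner_Integration.integrable_bound[of _ "\<lambda>y. norm (G (x + e n * y))"])
    show "integrable lborel (\<lambda>y. norm (G (x + e n * y)))"
      using lborel_integrable_real_affine[OF G, of "e n" x] e[of n] by auto
    from mult_right_mono[OF std_normal_density_le_1 norm_ge_zero]
    show "AE y in lborel. norm (of_real (std_normal_density y) * G (x + e n * y)) \<le> norm (norm (G (x + e n * y)))"
      by (auto simp: norm_mult)
  qed auto
  have v_eq: "?v n x - G x = (LINT y|lborel. of_real (std_normal_density y) * (G (x + e n * y) - G x))" for n x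
  proof -
    have "?v n x = \<bar>e n\<bar> *\<^sub>R (LINT y|lborel. of_real (normal_density 0 (e n) (x - (x + e n * y))) * G (x + e n * y))"
      using e[of n] by (intro lborel_integral_real_affine) auto
    also have "\<dots> = (LINT y|lborel. \<bar>e n\<bar> *\<^sub>R (of_real (normal_density 0 (e n) (x - (x + e n * y))) * G (x + e n * y)))"
      by simp
    also have "\<dots> = (LINT y|lborel. of_real (std_normal_density y) * G (x + e n * y))"
      using e[of n] by (intro Bochner_Integration.integral_cong)
        (auto simp: scaleR_conv_of_real normal_density_def real_sqrt_mult power_mult_distrib)
    finally have "?v n x = (LINT y|lborel. of_real (std_normal_density y) * G (x + e n * y))" .
    moreover have "(LINT y|lborel. complex_of_real (std_normal_density y) * G x) = G x"
      using integral_normal_density[of 1 0] by (simp add: integral_complex_of_real)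
    moreover have "integrable lborel (\<lambda>y. complex_of_real (std_normal_density y) * G x)"
      using integrable_normal_density[of 1 0] by (intro integrable_mult_left) (simp add: complex_of_real_integrable_eq)
    ultimately show ?thesis
      using int_nG by (simp add: right_diff_distrib)
  qed
  have bound: "(\<integral>\<^sup>+x. ennreal (norm (?v n x - G x)) \<partial>lborel) \<le> ennreal (LINT y|lborel. std_normal_density y * \<omega> (e n * y))" for n
  proof -
    have "(\<integral>\<^sup>+x. ennreal (norm (?v n x - G x)) \<partial>lborel) \<le>
      (\<integral>\<^sup>+x. \<integral>\<^sup>+y. ennreal (norm (of_real (std_normal_density y) * (G (x + e n * y) - G x))) \<partial>lborel \<partial>lborel)"
      unfolding v_eq by (intro nn_integral_mono norm_integral_le_nn_integral)
    also have "\<dots> = (\<integral>\<^sup>+y. \<integral>\<^sup>+x. ennreal (norm (of_real (std_normal_density y) * (G (x + e n * y) - G x))) \<partial>lborel \<partial>lborel)"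
      by (intro lborel_pair.Fubini') auto
    also have "\<dots> = (\<integral>\<^sup>+y. ennreal (std_normal_density y * \<omega> (e n * y)) \<partial>lborel)"
      by (intro nn_integral_cong) (simp add: norm_mult ennreal_mult' nn_integral_cmult \<omega>_nn)
    also have "\<dots> = ennreal (LINT y|lborel. std_normal_density y * \<omega> (e n * y))"
    proof (intro nn_integral_eq_integral)
      show "integrable lborel (\<lambda>y. std_normal_density y * \<omega> (e n * y))"
        by (rule Bochner_Integration.integrable_bound[of _ "\<lambda>y. std_normal_density y * (2 * (LINT x|lborel. norm (G x)))"])
          (auto intro!: AE_I2 mult_left_mono \<omega>_bound integrable_normal_density simp: \<omega>0)
    qed (auto simp: \<omega>0)
    finally show ?thesis .
  qed
  have "(\<lambda>n. LINT y|lborel. std_normal_density y * \<omega> (e n * y)) \<longlonglongrightarrow> (LINT y|lborel. std_normal_density y * 0)"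
  proof (rule integral_dominated_convergence[where w="\<lambda>y. std_normal_density y * (2 * (LINT x|lborel. norm (G x)))"])
    show "AE y in lborel. norm (std_normal_density y * \<omega> (e n * y)) \<le> std_normal_density y * (2 * (LINT x|lborel. norm (G x)))" for n
      by (auto intro!: AE_I2 mult_left_mono \<omega>_bound simp: \<omega>0)
    show "AE y in lborel. (\<lambda>n. std_normal_density y * \<omega> (e n * y)) \<longlonglongrightarrow> std_normal_density y * 0"
    proof (intro AE_I2 tendsto_mult tendsto_const)
      fix y
      have "(\<lambda>n. e n * y) \<longlonglongrightarrow> 0" using tendsto_mult_right[OF lim, of y] by simp
      from L1_translation_tendsto_0[OF G this] show "(\<lambda>n. \<omega> (e n * y)) \<longlonglongrightarrow> 0" by (simp add: \<omega>_def)
    qed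
  qed (auto intro!: integrable_normal_density)
  then have lim0: "(\<lambda>n. LINT y|lborel. std_normal_density y * \<omega> (e n * y)) \<longlonglongrightarrow> 0" by simp
  show int: "integrable lborel (\<lambda>x. ?v n x - G x)" for n
    using bound[of n] by (intro integrableI_bounded) (auto intro: le_less_trans)
  have "(LINT x|lborel. norm (?v n x - G x)) \<le> (LINT y|lborel. std_normal_density y * \<omega> (e n * y))" for n
  proof -
    have "ennreal (LINT x|lborel. norm (?v n x - G x)) \<le> ennreal (LINT y|lborel. std_normal_density y * \<omega> (e n * y))"
      using bound[of n] int[of n] by (subst nn_integral_eq_integral[symmetric]) auto
    then show ?thesis
      by (subst (asm) ennreal_le_iff) (auto intro!: Bochner_Integration.integral_nonneg simp: \<omega>0)
  qed
  then show "(\<lambda>n. LINT x|lborel. norm (?v n x - G x)) \<longlonglongrightarrow> 0"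
    by (intro tendsto_sandwich[OF _ _ tendsto_const lim0]) (auto intro!: always_eventually)
qed

text \<open>
  Both sides may be infinite; this is what allows the identity to be used before any finiteness is
  known. Removing the Gaussian weight, the bound from above is the contraction property of the
  mollification, and the bound from below is Fatou's lemma along a subsequence on which the
  mollifications converge almost everywhere.
\<close>

theorem plancherel:
  fixes G :: "real \<Rightarrow> complex"
  assumes G: "integrable lborel G"
  shows "(\<integral>\<^sup>+t. ennreal ((norm (LINT l|lborel. iexp (t * l) * G l))\<^sup>2) \<partial>lborel) =
     ennreal (2 * pi) * (\<integral>\<^sup>+l. ennreal ((norm (G l))\<^sup>2) \<partial>lborel)"
proof (rule antisym)
  have [measurable]: "G \<in> borel_measurable borel" using G by simp
  define u where "u t = (LINT l|lborel. iexp (t * l) * G l)" for t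
  have [measurable]: "u \<in> borel_measurable borel" unfolding u_def[abs_def] by measurable
  define e where "e n = 1 / real (Suc n)" for n
  have e0: "e n > 0" for n by (simp add: e_def)
  have e_lim: "e \<longlonglongrightarrow> 0" unfolding e_def[abs_def] by (rule LIMSEQ_Suc[OF lim_1_over_n])
  define v where "v n x = (LINT l|lborel. of_real (normal_density 0 (e n) (x - l)) * G l)" for n x
  have [measurable]: "v n \<in> borel_measurable borel" for n unfolding v_def[abs_def] by measurable
  have reg: "(\<integral>\<^sup>+t. ennreal (exp (- (e n * t)\<^sup>2) * (norm (u t))\<^sup>2) \<partial>lborel) =
     ennreal (2 * pi) * (\<integral>\<^sup>+x. ennreal ((norm (v n x))\<^sup>2) \<partial>lborel)" for n
    unfolding u_def v_def by (rule plancherel_gaussian_regularized[OF G e0])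
  have "(\<lambda>n. exp (- (e n * t)\<^sup>2) * (norm (u t))\<^sup>2) \<longlonglongrightarrow> exp (- (0 * t)\<^sup>2) * (norm (u t))\<^sup>2" for t
    by (intro tendsto_intros e_lim)
  then have lim_t: "(\<lambda>n. ennreal (exp (- (e n * t)\<^sup>2) * (norm (u t))\<^sup>2)) \<longlonglongrightarrow> ennreal ((norm (u t))\<^sup>2)" for t
    by (intro tendsto_ennrealI) simp
  have "(\<integral>\<^sup>+t. ennreal ((norm (u t))\<^sup>2) \<partial>lborel) = (\<integral>\<^sup>+t. liminf (\<lambda>n. ennreal (exp (- (e n * t)\<^sup>2) * (norm (u t))\<^sup>2)) \<partial>lborel)"
    by (intro nn_integral_cong lim_imp_Liminf[symmetric] lim_t) simp
  also have "\<dots> \<le> liminf (\<lambda>n. \<integral>\<^sup>+t. ennreal (exp (- (e n * t)\<^sup>2) * (norm (u t))\<^sup>2) \<partial>lborel)"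
    by (intro nn_integral_liminf) auto
  also have "\<dots> \<le> ennreal (2 * pi) * (\<integral>\<^sup>+l. ennreal ((norm (G l))\<^sup>2) \<partial>lborel)"
  proof (rule Liminf_le)
    show "\<forall>\<^sub>F n in sequentially. (\<integral>\<^sup>+t. ennreal (exp (- (e n * t)\<^sup>2) * (norm (u t))\<^sup>2) \<partial>lborel)
        \<le> ennreal (2 * pi) * (\<integral>\<^sup>+l. ennreal ((norm (G l))\<^sup>2) \<partial>lborel)"
      unfolding reg v_def by (intro always_eventually allI mult_left_mono norm_gaussian_mollification_le[OF G e0]) auto
  qed simp
  finally show "(\<integral>\<^sup>+t. ennreal ((norm (LINT l|lborel. iexp (t * l) * G l))\<^sup>2) \<partial>lborel) \<le>
     ennreal (2 * pi) * (\<integral>\<^sup>+l. ennreal ((norm (G l))\<^sup>2) \<partial>lborel)"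
    unfolding u_def .
  obtain r :: "nat \<Rightarrow> nat" where r: "strict_mono r" and ae: "AE x in lborel. (\<lambda>n. v (r n) x - G x) \<longlonglongrightarrow> 0"
    using tendsto_L1_AE_subseq[of lborel "\<lambda>n x. v n x - G x"]
      gaussian_mollification_tendsto_L1[OF G e0 e_lim] unfolding v_def by auto
  have "ennreal (2 * pi) * (\<integral>\<^sup>+l. ennreal ((norm (G l))\<^sup>2) \<partial>lborel)
      = (\<integral>\<^sup>+l. ennreal (2 * pi) * ennreal ((norm (G l))\<^sup>2) \<partial>lborel)"
    by (simp add: nn_integral_cmult)
  also have "\<dots> = (\<integral>\<^sup>+x. liminf (\<lambda>n. ennreal (2 * pi) * ennreal ((norm (v (r n) x))\<^sup>2)) \<partial>lborel)"
  proof (intro nn_integral_cong_AE, use ae in eventually_elim)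
    case (elim x)
    then have "(\<lambda>n. v (r n) x) \<longlonglongrightarrow> G x" by (rule LIM_zero_cancel)
    then have "(\<lambda>n. ennreal (2 * pi * (norm (v (r n) x))\<^sup>2)) \<longlonglongrightarrow> ennreal (2 * pi * (norm (G x))\<^sup>2)"
      by (intro tendsto_ennrealI tendsto_intros)
    then have "(\<lambda>n. ennreal (2 * pi) * ennreal ((norm (v (r n) x))\<^sup>2)) \<longlonglongrightarrow> ennreal (2 * pi) * ennreal ((norm (G x))\<^sup>2)"
      by (simp add: ennreal_mult)
    then show ?case by (intro lim_imp_Liminf[symmetric]) simp_all
  qed
  also have "\<dots> \<le> liminf (\<lambda>n. \<integral>\<^sup>+x. ennreal (2 * pi) * ennreal ((norm (v (r n) x))\<^sup>2) \<partial>lborel)"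
    by (intro nn_integral_liminf) auto
  also have "\<dots> = liminf (\<lambda>n. \<integral>\<^sup>+t. ennreal (exp (- (e (r n) * t)\<^sup>2) * (norm (u t))\<^sup>2) \<partial>lborel)"
    by (simp add: nn_integral_cmult reg)
  also have "\<dots> \<le> (\<integral>\<^sup>+t. ennreal ((norm (u t))\<^sup>2) \<partial>lborel)"
    by (intro Liminf_le always_eventually allI nn_integral_mono ennreal_leI mult_left_le_one_le) auto
  finally show "ennreal (2 * pi) * (\<integral>\<^sup>+l. ennreal ((norm (G l))\<^sup>2) \<partial>lborel) \<le>
      (\<integral>\<^sup>+t. ennreal ((norm (LINT l|lborel. iexp (t * l) * G l))\<^sup>2) \<partial>lborel)"
    unfolding u_def .
qed

section \<open>Plancherel for oscillatory integrals\<close>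

lemma borel_version_complex:
  fixes G :: "'a \<Rightarrow> complex"
  assumes G: "G \<in> borel_measurable (completion M)"
  shows "\<exists>G'\<in>borel_measurable M. AE x in M. G x = G' x"
proof -
  have "(\<lambda>x. Re (G x)) \<in> borel_measurable (completion M)" "(\<lambda>x. Im (G x)) \<in> borel_measurable (completion M)"
    using G by measurable
  from this[THEN completion_ex_borel_measurable_real]
  obtain a b where [measurable]: "a \<in> borel_measurable M" "b \<in> borel_measurable M"
    and ae: "AE x in M. Re (G x) = a x" "AE x in M. Im (G x) = b x"
    by blast
  show ?thesis
  proof (intro bexI[of _ "\<lambda>x. Complex (a x) (b x)"])
    show "AE x in M. G x = Complex (a x) (b x)"
      using ae by eventually_elim (simp add: complex_eq_iff)
    show "(\<lambda>x. Complex (a x) (b x)) \<in> borel_measurable M"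
      unfolding Complex_eq by measurable
  qed
qed

text \<open>
  Fubini is applied on products of Borel measures, whereas symbols and densities after a change of
  variables are merely Lebesgue measurable. Passing to an almost everywhere equal Borel function
  bridges the two.
\<close>

lemma lebesgue_integrable_borel_version:
  fixes F :: "'a::euclidean_space \<Rightarrow> complex"
  assumes F: "integrable lebesgue F"
  obtains F' where "integrable lborel F'" "AE x in lborel. F x = F' x"
proof -
  obtain F' where [measurable]: "F' \<in> borel_measurable lborel" and ae: "AE x in lborel. F x = F' x"
    using borel_version_complex[of F lborel] F by auto
  have "F' \<in> borel_measurable lebesgue" by (rule measurable_completion) simp
  then have "integrable lebesgue F'"
    using F AE_completion[OF ae] by (subst integrable_cong_AE[of F' _ F]) auto
  then have "integrable lborel F'"
    by (simp add: integrable_completion)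
  with ae show ?thesis using that by blast
qed

lemma integral_lebesgue_borel_version:
  fixes F F' e :: "'a::euclidean_space \<Rightarrow> complex"
  assumes F: "F \<in> borel_measurable lebesgue" and F': "F' \<in> borel_measurable borel"
    and e: "e \<in> borel_measurable borel" and ae: "AE x in lborel. F x = F' x"
  shows "(LINT x|lebesgue. e x * F x) = (LINT x|lborel. e x * F' x)"
proof -
  have [measurable]: "e \<in> borel_measurable lebesgue" "F' \<in> borel_measurable lebesgue"
    using e F' by (auto intro!: measurable_completion)
  note F[measurable]
  have "(LINT x|lebesgue. e x * F x) = (LINT x|lebesgue. e x * F' x)"
    using AE_completion[OF ae] by (intro integral_cong_AE) (auto elim!: eventually_mono)
  also have "\<dots> = (LINT x|lborel. e x * F' x)"
    using e F' by (intro integral_completion) simp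
  finally show ?thesis .
qed

lemma plancherel_lebesgue:
  fixes G :: "real \<Rightarrow> complex"
  assumes G: "integrable lebesgue G"
  shows "(\<integral>\<^sup>+t. ennreal ((norm (LINT l|lebesgue. iexp (t * l) * G l))\<^sup>2) \<partial>lborel) =
     ennreal (2 * pi) * (\<integral>\<^sup>+l. ennreal ((norm (G l))\<^sup>2) \<partial>lborel)"
proof -
  obtain G' where G': "integrable lborel G'" and ae: "AE x in lborel. G x = G' x"
    using lebesgue_integrable_borel_version[OF G] .
  have "(LINT l|lebesgue. iexp (t * l) * G l) = (LINT l|lborel. iexp (t * l) * G' l)" for t
    using G G' ae by (intro integral_lebesgue_borel_version) auto
  moreover have "(\<integral>\<^sup>+l. ennreal ((norm (G l))\<^sup>2) \<partial>lborel) = (\<integral>\<^sup>+l. ennreal ((norm (G' l))\<^sup>2) \<partial>lborel)"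
    using ae by (intro nn_integral_cong_AE) (auto elim!: eventually_mono)
  ultimately show ?thesis using plancherel[OF G'] by simp
qed

lemma nn_integral_eq_if_integral_eq:
  fixes a :: "'a \<Rightarrow> real" and b :: "'b \<Rightarrow> real"
  assumes "a \<in> borel_measurable M" "b \<in> borel_measurable N"
    and "\<And>x. 0 \<le> a x" "\<And>x. 0 \<le> b x"
    and "integrable M a \<longleftrightarrow> integrable N b"
    and "integrable M a \<Longrightarrow> integral\<^sup>L M a = integral\<^sup>L N b"
  shows "(\<integral>\<^sup>+x. ennreal (a x) \<partial>M) = (\<integral>\<^sup>+x. ennreal (b x) \<partial>N)"
proof (cases "integrable M a")
  case True
  then show ?thesis using assms by (simp add: nn_integral_eq_integral)
next
  case False
  then have "(\<integral>\<^sup>+x. ennreal (a x) \<partial>M) = \<infinity>" "(\<integral>\<^sup>+x. ennreal (b x) \<partial>N) = \<infinity>"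
    using assms by (auto simp: integrable_iff_bounded less_top[symmetric])
  then show ?thesis by simp
qed

text \<open>
  The substitution \<open>l = f x\<close> on \<open>S\<close> turns the oscillatory integral into
  the Fourier transform of \<open>G(f x) = h(x) / |f'(x)|\<close>. In the square of
  \<open>G\<close> the Jacobian occurs twice and the substitution removes one factor.
\<close>

lemma plancherel_oscillatory:
  fixes f f' :: "real \<Rightarrow> real" and h :: "real \<Rightarrow> complex"
  assumes h: "integrable lborel h"
    and S: "S \<in> sets borel"
    and deriv: "\<And>x. (f has_real_derivative f' x) (at x)"
    and f'_meas [measurable]: "f' \<in> borel_measurable borel"
    and inj: "inj_on f S"
    and nz: "\<And>x. x \<in> S \<Longrightarrow> f' x \<noteq> 0"
    and supp: "AE x in lborel. h x \<noteq> 0 \<longrightarrow> x \<in> S"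
  shows "(\<integral>\<^sup>+t. ennreal ((norm (LINT x|lborel. iexp (t * f x) * h x))\<^sup>2) \<partial>lborel) =
     ennreal (2 * pi) * (\<integral>\<^sup>+x. ennreal ((norm (h x))\<^sup>2 / \<bar>f' x\<bar>) \<partial>lborel)"
proof -
  have [measurable]: "h \<in> borel_measurable borel" using h by simp
  have "isCont f x" for x using deriv[of x] by (rule DERIV_isCont)
  then have [measurable]: "f \<in> borel_measurable borel"
    by (intro borel_measurable_continuous_onI continuous_at_imp_continuous_on) auto
  have S_leb: "S \<in> sets lebesgue" using S by simp
  \<comment> \<open>The density of the image of \<open>h\<close> under \<open>f\<close>.\<close>
  define G where "G l = (if l \<in> f ` S then h (the_inv_into S f l) / of_real \<bar>f' (the_inv_into S f l)\<bar> else 0)" for l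
  have G_f: "G (f x) = h x / of_real \<bar>f' x\<bar>" if "x \<in> S" for x
    using that by (auto simp: G_def the_inv_into_f_f[OF inj])
  have ae': "AE x in lebesgue. h x \<noteq> 0 \<longrightarrow> x \<in> S" using supp by (rule AE_completion)
  note cov = has_absolute_integral_change_of_variables_real[of S f f', OF S_leb has_field_derivative_at_within[OF deriv] inj]
  have set_eq: "(\<lambda>x. indicator (f ` S) x *\<^sub>R F x) = F" if "\<And>l. l \<notin> f ` S \<Longrightarrow> F l = 0" for F :: "real \<Rightarrow> 'z::real_vector"
    using that by (auto simp: indicator_def fun_eq_iff)
  have transfer: "integrable lebesgue (\<lambda>l. iexp (t * l) * G l)"
     "(LINT l|lebesgue. iexp (t * l) * G l) = (LINT x|lborel. iexp (t * f x) * h x)" for t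
  proof -
    let ?F = "\<lambda>l. iexp (t * l) * G l"
    let ?H = "\<lambda>x. iexp (t * f x) * h x"
    have H: "integrable lborel ?H"
      by (rule Bochner_Integration.integrable_bound[OF h]) (auto simp: norm_mult)
    have eqS: "\<bar>f' x\<bar> *\<^sub>R ?F (f x) = ?H x" if "x \<in> S" for x
      using nz[OF that] by (simp add: G_f[OF that] scaleR_conv_of_real)
    have "integrable lebesgue ?H" using H by (simp add: integrable_completion)
    then have "integrable lebesgue (\<lambda>x. indicator S x *\<^sub>R ?H x)"
      using S_leb by (rule integrable_mult_indicator[rotated])
    then have 1: "(\<lambda>x. \<bar>f' x\<bar> *\<^sub>R ?F (f x)) absolutely_integrable_on S"
      unfolding set_integrable_def by (rule Bochner_Integration.integrable_cong[THEN iffD1, rotated -1]) (auto simp: indicator_def eqS simp del: of_real_mult)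
    have 2: "integral S (\<lambda>x. \<bar>f' x\<bar> *\<^sub>R ?F (f x)) = (LINT x|lborel. ?H x)"
    proof -
      have "integral S (\<lambda>x. \<bar>f' x\<bar> *\<^sub>R ?F (f x)) = (LINT x:S|lebesgue. \<bar>f' x\<bar> *\<^sub>R ?F (f x))"
        using set_lebesgue_integral_eq_integral(2)[OF 1] by simp
      also have "\<dots> = (LINT x|lebesgue. indicator S x *\<^sub>R ?H x)"
        unfolding set_lebesgue_integral_def
        by (intro Bochner_Integration.integral_cong) (auto simp: indicator_def eqS simp del: of_real_mult)
      also have "\<dots> = (LINT x|lebesgue. ?H x)"
      proof (rule integral_cong_AE)
        show "(\<lambda>x. indicator S x *\<^sub>R ?H x) \<in> borel_measurable lebesgue"
          using S by (intro measurable_completion) simp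
        show "?H \<in> borel_measurable lebesgue"
          by (intro measurable_completion) simp
        show "AE x in lebesgue. indicator S x *\<^sub>R ?H x = ?H x"
          using ae' by eventually_elim (auto simp: indicator_def)
      qed
      also have "\<dots> = (LINT x|lborel. ?H x)" by (rule integral_completion) simp
      finally show ?thesis .
    qed
    have 3: "?F absolutely_integrable_on f ` S \<and> integral (f ` S) ?F = (LINT x|lborel. ?H x)"
      using 1 2 by (subst cov[symmetric]) auto
    then show "integrable lebesgue ?F"
      unfolding set_integrable_def by (subst (asm) set_eq) (auto simp: G_def)
    have "(LINT x:f ` S|lebesgue. ?F x) = (LINT x|lborel. ?H x)"
      using 3 set_lebesgue_integral_eq_integral(2)[of "f ` S" ?F] by simp
    then show "(LINT l|lebesgue. ?F l) = (LINT x|lborel. ?H x)"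
      unfolding set_lebesgue_integral_def by (subst (asm) set_eq) (auto simp: G_def)
  qed
  have G: "integrable lebesgue G" using transfer(1)[of 0] by simp
  then have [measurable]: "G \<in> borel_measurable lebesgue" by simp
  let ?N = "\<lambda>l. (norm (G l))\<^sup>2"
  let ?M = "\<lambda>x. indicator S x *\<^sub>R ((norm (h x))\<^sup>2 / \<bar>f' x\<bar>)"
  have eqS: "\<bar>f' x\<bar> * ?N (f x) = (norm (h x))\<^sup>2 / \<bar>f' x\<bar>" if "x \<in> S" for x
    using nz[OF that] by (auto simp: G_f[OF that] norm_divide power_divide power2_eq_square abs_if divide_simps)
  have iff: "?N absolutely_integrable_on f ` S \<longleftrightarrow> integrable lebesgue ?N"
    unfolding set_integrable_def by (subst set_eq) (auto simp: G_def)
  have iff': "(\<lambda>x. \<bar>f' x\<bar> *\<^sub>R ?N (f x)) absolutely_integrable_on S \<longleftrightarrow> integrable lebesgue ?M"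
    unfolding set_integrable_def by (intro Bochner_Integration.integrable_cong) (auto simp: indicator_def eqS simp del: of_real_mult)
  have "(\<integral>\<^sup>+l. ennreal (?N l) \<partial>lebesgue) = (\<integral>\<^sup>+x. ennreal (?M x) \<partial>lebesgue)"
  proof (rule nn_integral_eq_if_integral_eq)
    show "integrable lebesgue ?N \<longleftrightarrow> integrable lebesgue ?M"
      using cov[of ?N] iff iff' by auto
    assume I: "integrable lebesgue ?N"
    then have a: "?N absolutely_integrable_on f ` S" using iff by simp
    then have b: "(\<lambda>x. \<bar>f' x\<bar> *\<^sub>R ?N (f x)) absolutely_integrable_on S"
      and eq: "integral S (\<lambda>x. \<bar>f' x\<bar> *\<^sub>R ?N (f x)) = integral (f ` S) ?N"
      using cov[of ?N "integral (f ` S) ?N"] by auto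
    have "(LINT l|lebesgue. ?N l) = (LINT l:f ` S|lebesgue. ?N l)"
      unfolding set_lebesgue_integral_def by (subst set_eq) (auto simp: G_def)
    also have "\<dots> = integral (f ` S) ?N" by (rule set_lebesgue_integral_eq_integral(2)[OF a])
    also have "\<dots> = (LINT x:S|lebesgue. \<bar>f' x\<bar> *\<^sub>R ?N (f x))"
      using eq set_lebesgue_integral_eq_integral(2)[OF b] by simp
    also have "\<dots> = (LINT x|lebesgue. ?M x)"
      unfolding set_lebesgue_integral_def
      by (intro Bochner_Integration.integral_cong) (auto simp: indicator_def eqS simp del: of_real_mult)
    finally show "(LINT l|lebesgue. ?N l) = (LINT x|lebesgue. ?M x)" .
  next
    show "?M \<in> borel_measurable lebesgue"
      using S by (intro measurable_completion) simp
  qed auto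
  then have "(\<integral>\<^sup>+l. ennreal (?N l) \<partial>lborel) = (\<integral>\<^sup>+x. ennreal (?M x) \<partial>lborel)"
    by (simp only: nn_integral_completion)
  also have "\<dots> = (\<integral>\<^sup>+x. ennreal ((norm (h x))\<^sup>2 / \<bar>f' x\<bar>) \<partial>lborel)"
    using supp by (intro nn_integral_cong_AE) (auto elim!: eventually_mono simp: indicator_def)
  finally have N: "(\<integral>\<^sup>+l. ennreal (?N l) \<partial>lborel) = (\<integral>\<^sup>+x. ennreal ((norm (h x))\<^sup>2 / \<bar>f' x\<bar>) \<partial>lborel)" .
  show ?thesis
    using plancherel_lebesgue[OF G] by (simp only: N transfer(2))
qed

lemma (in pair_sigma_finite) AE_pair_snd:
  assumes "AE z in M1 \<Otimes>\<^sub>M M2. P z"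
  shows "AE y in M2. AE x in M1. P (x, y)"
proof -
  obtain N where N: "N \<in> sets (M1 \<Otimes>\<^sub>M M2)" "emeasure (M1 \<Otimes>\<^sub>M M2) N = 0" "{z \<in> space (M1 \<Otimes>\<^sub>M M2). \<not> P z} \<subseteq> N"
    using assms unfolding eventually_ae_filter by auto
  have "AE z in M1 \<Otimes>\<^sub>M M2. z \<notin> N"
    using N by (intro AE_not_in) (auto simp: null_sets_def)
  then have "AE x in M1. AE y in M2. (x, y) \<notin> N"
    by (rule AE_pair)
  then have "AE y in M2. AE x in M1. (x, y) \<notin> N"
    using N(1) by (subst (asm) AE_commute) (auto simp: space_pair_measure Collect_neg_eq intro!: sets.sets_Collect_neg)
  then show ?thesis
  proof (rule AE_mp, intro AE_I2[of M2] impI)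
    fix y assume y: "y \<in> space M2" "AE x in M1. (x, y) \<notin> N"
    from y(2) show "AE x in M1. P (x, y)"
      by (rule AE_mp) (use y(1) N(3) in \<open>auto simp: space_pair_measure intro!: AE_I2\<close>)
  qed
qed

lemma C1_on_plane_d_xi:
  assumes "C1_on_plane f"
  shows continuous_C1: "continuous_on UNIV f"
    and continuous_d_xi: "continuous_on UNIV (d_xi f)"
    and deriv_d_xi: "((\<lambda>s. f (s, b)) has_real_derivative d_xi f (a, b)) (at a)"
proof -
  obtain f' where f': "\<And>z. (f has_derivative blinfun_apply (f' z)) (at z)" and cont: "continuous_on UNIV f'"
    using assms unfolding C1_on_plane_def by blast
  have der: "((\<lambda>s. f (s, b)) has_real_derivative blinfun_apply (f' (a, b)) (1, 0)) (at a)" for a b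
  proof -
    have "((\<lambda>s. f (s, b)) has_derivative (\<lambda>h. blinfun_apply (f' (a, b)) (h, 0))) (at a)"
      by (rule has_derivative_compose[of "\<lambda>s. (s, b)" "\<lambda>h. (h, 0)" a UNIV f, simplified, OF _ f'])
        (auto intro!: derivative_eq_intros)
    moreover have "(\<lambda>h. blinfun_apply (f' (a, b)) (h, 0)) = (\<lambda>h. h * blinfun_apply (f' (a, b)) (1, 0))"
    proof
      fix h :: real
      have "(h, 0) = h *\<^sub>R (1::real, 0::real)" by simp
      then show "blinfun_apply (f' (a, b)) (h, 0) = h * blinfun_apply (f' (a, b)) (1, 0)"
        by (metis blinfun.scaleR_right real_scaleR_def)
    qed
    ultimately show ?thesis by (simp add: has_field_derivative_def mult_commute_abs)
  qed
  have d: "d_xi f z = blinfun_apply (f' z) (1, 0)" for z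
    unfolding d_xi_def using DERIV_imp_deriv[OF der[of "snd z" "fst z"]] by simp
  show "((\<lambda>s. f (s, b)) has_real_derivative d_xi f (a, b)) (at a)" using der d by simp
  show "continuous_on UNIV f"
    using f' by (auto intro!: continuous_at_imp_continuous_on has_derivative_continuous)
  show "continuous_on UNIV (d_xi f)"
    unfolding d by (intro continuous_intros cont)
qed

abbreviation monotone_fibres :: "(real \<times> real) set \<Rightarrow> (real \<times> real \<Rightarrow> real) \<Rightarrow> bool" where
  "monotone_fibres S f \<equiv>
     AE \<eta> in lborel. strictly_monotone_on {\<xi>. (\<xi>, \<eta>) \<in> S} (\<lambda>\<xi>. f (\<xi>, \<eta>))"

lemma strictly_monotone_imp_inj_on: "strictly_monotone_on S h \<Longrightarrow> inj_on h S"
  unfolding strictly_monotone_on_def inj_on_def monotone_on_def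
  by (metis linorder_neqE_linordered_idom order_less_irrefl)

lemma closed_supp: "closed (supp chi)"
  by (simp add: supp_def)

lemma nonzero_in_supp: "chi z \<noteq> 0 \<Longrightarrow> z \<in> supp chi"
  unfolding supp_def by (rule closure_subset[THEN subsetD]) simp

text \<open>
  The energy identity on which both directions rest. On each fibre \<open>\<eta> = const\<close>
  the inner integral in \<open>t\<close> is the one-dimensional oscillatory one.
\<close>

theorem plancherel_plane_wave:
  fixes f :: "real \<times> real \<Rightarrow> real" and H :: "real \<times> real \<Rightarrow> complex"
  assumes f: "C1_on_plane f"
    and H: "integrable lborel H"
    and S: "closed S"
    and mono: "monotone_fibres S f"
    and supp: "AE z in lborel. H z \<noteq> 0 \<longrightarrow> z \<in> S \<and> d_xi f z \<noteq> 0"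
  shows "(\<integral>\<^sup>+t. \<integral>\<^sup>+y. ennreal ((norm (LINT z|lborel. iexp (t * f z + y * snd z) * H z))\<^sup>2) \<partial>lborel \<partial>lborel) =
     ennreal (4 * pi\<^sup>2) * (\<integral>\<^sup>+z. ennreal ((norm (H z))\<^sup>2 / \<bar>d_xi f z\<bar>) \<partial>lborel)"
proof -
  note [measurable] = borel_measurable_continuous_onI[OF continuous_C1[OF f]]
    borel_measurable_continuous_onI[OF continuous_d_xi[OF f]]
  have [measurable]: "H \<in> borel_measurable borel" using H by simp
  have H2: "integrable (lborel \<Otimes>\<^sub>M lborel) H" using H by (simp add: lborel_prod)
  define V where "V t \<eta> = (LINT \<xi>|lborel. iexp (t * f (\<xi>, \<eta>)) * H (\<xi>, \<eta>))" for t \<eta>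
  have [measurable]: "case_prod V \<in> borel_measurable (borel \<Otimes>\<^sub>M borel)"
    unfolding V_def by measurable
  have inner: "(\<integral>\<^sup>+y. ennreal ((norm (LINT z|lborel. iexp (t * f z + y * snd z) * H z))\<^sup>2) \<partial>lborel) =
      ennreal (2 * pi) * (\<integral>\<^sup>+\<eta>. ennreal ((norm (V t \<eta>))\<^sup>2) \<partial>lborel)" for t
  proof -
    have I: "integrable (lborel \<Otimes>\<^sub>M lborel) (\<lambda>(\<xi>,\<eta>). iexp (t * f (\<xi>, \<eta>)) * H (\<xi>, \<eta>))"
      by (rule Bochner_Integration.integrable_bound[OF H2]) (auto simp: norm_mult)
    have V_int: "integrable lborel (V t)"
      unfolding V_def[abs_def] using lborel_pair.integrable_snd[OF I] by simp
    have "(LINT z|lborel. iexp (t * f z + y * snd z) * H z) = (LINT \<eta>|lborel. iexp (y * \<eta>) * V t \<eta>)" for y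
    proof -
      have I': "integrable (lborel \<Otimes>\<^sub>M lborel) (\<lambda>(\<xi>,\<eta>). iexp (t * f (\<xi>, \<eta>) + y * \<eta>) * H (\<xi>, \<eta>))"
        by (rule Bochner_Integration.integrable_bound[OF H2]) (auto simp: norm_mult)
      have "(LINT z|lborel. iexp (t * f z + y * snd z) * H z) =
          (LINT \<eta>|lborel. LINT \<xi>|lborel. iexp (t * f (\<xi>, \<eta>) + y * \<eta>) * H (\<xi>, \<eta>))"
        unfolding lborel_pair.integral_snd[OF I'] lborel_prod
        by (intro Bochner_Integration.integral_cong) auto
      also have "\<dots> = (LINT \<eta>|lborel. LINT \<xi>|lborel. iexp (y * \<eta>) * (iexp (t * f (\<xi>, \<eta>)) * H (\<xi>, \<eta>)))"
        by (intro Bochner_Integration.integral_cong) (auto simp: exp_add distrib_left mult_ac)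
      also have "\<dots> = (LINT \<eta>|lborel. iexp (y * \<eta>) * V t \<eta>)"
        unfolding V_def by (simp only: integral_mult_right_zero)
      finally show ?thesis .
    qed
    then show ?thesis using plancherel[OF V_int] by simp
  qed
  have ae_int: "AE \<eta> in lborel. integrable lborel (\<lambda>\<xi>. H (\<xi>, \<eta>))"
    using lborel_pair.AE_integrable_snd[of "\<lambda>x y. H (x, y)"] H2 by simp
  have ae_supp: "AE \<eta> in lborel. AE \<xi> in lborel. H (\<xi>, \<eta>) \<noteq> 0 \<longrightarrow> (\<xi>, \<eta>) \<in> S \<and> d_xi f (\<xi>, \<eta>) \<noteq> 0"
    by (rule lborel_pair.AE_pair_snd[unfolded lborel_prod, OF supp])
  have fiber: "AE \<eta> in lborel. (\<integral>\<^sup>+t. ennreal ((norm (V t \<eta>))\<^sup>2) \<partial>lborel) =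
     ennreal (2 * pi) * (\<integral>\<^sup>+\<xi>. ennreal ((norm (H (\<xi>, \<eta>)))\<^sup>2 / \<bar>d_xi f (\<xi>, \<eta>)\<bar>) \<partial>lborel)"
    using mono ae_int ae_supp
  proof eventually_elim
    case (elim \<eta>)
    let ?S = "{\<xi>. (\<xi>, \<eta>) \<in> S \<and> d_xi f (\<xi>, \<eta>) \<noteq> 0}"
    have [measurable]: "S \<in> sets borel" using S by simp
    show ?case unfolding V_def
    proof (rule plancherel_oscillatory[where S="?S"])
      have "{\<xi> \<in> space borel. (\<xi>, \<eta>) \<in> S \<and> d_xi f (\<xi>, \<eta>) \<noteq> 0} \<in> sets borel" by measurable
      then show "?S \<in> sets borel" by simp
      show "inj_on (\<lambda>\<xi>. f (\<xi>, \<eta>)) ?S"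
        using strictly_monotone_imp_inj_on[OF elim(1)] by (rule inj_on_subset) auto
      show "((\<lambda>\<xi>. f (\<xi>, \<eta>)) has_real_derivative d_xi f (x, \<eta>)) (at x)" for x
        by (rule deriv_d_xi[OF f])
    qed (use elim in auto)
  qed
  have "(\<integral>\<^sup>+t. \<integral>\<^sup>+y. ennreal ((norm (LINT z|lborel. iexp (t * f z + y * snd z) * H z))\<^sup>2) \<partial>lborel \<partial>lborel)
     = (\<integral>\<^sup>+t. ennreal (2 * pi) * (\<integral>\<^sup>+\<eta>. ennreal ((norm (V t \<eta>))\<^sup>2) \<partial>lborel) \<partial>lborel)"
    by (simp only: inner)
  also have "\<dots> = ennreal (2 * pi) * (\<integral>\<^sup>+t. \<integral>\<^sup>+\<eta>. ennreal ((norm (V t \<eta>))\<^sup>2) \<partial>lborel \<partial>lborel)"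
    by (intro nn_integral_cmult) measurable
  also have "(\<integral>\<^sup>+t. \<integral>\<^sup>+\<eta>. ennreal ((norm (V t \<eta>))\<^sup>2) \<partial>lborel \<partial>lborel) = 
     (\<integral>\<^sup>+\<eta>. \<integral>\<^sup>+t. ennreal ((norm (V t \<eta>))\<^sup>2) \<partial>lborel \<partial>lborel)"
    by (intro lborel_pair.Fubini'[symmetric]) measurable
  also have "\<dots> = (\<integral>\<^sup>+\<eta>. ennreal (2 * pi) * (\<integral>\<^sup>+\<xi>. ennreal ((norm (H (\<xi>, \<eta>)))\<^sup>2 / \<bar>d_xi f (\<xi>, \<eta>)\<bar>) \<partial>lborel) \<partial>lborel)"
    by (rule nn_integral_cong_AE[OF fiber])
  also have "\<dots> = ennreal (2 * pi) * (\<integral>\<^sup>+\<eta>. \<integral>\<^sup>+\<xi>. ennreal ((norm (H (\<xi>, \<eta>)))\<^sup>2 / \<bar>d_xi f (\<xi>, \<eta>)\<bar>) \<partial>lborel \<partial>lborel)"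
    by (intro nn_integral_cmult) measurable
  also have "(\<integral>\<^sup>+\<eta>. \<integral>\<^sup>+\<xi>. ennreal ((norm (H (\<xi>, \<eta>)))\<^sup>2 / \<bar>d_xi f (\<xi>, \<eta>)\<bar>) \<partial>lborel \<partial>lborel) = 
     (\<integral>\<^sup>+z. ennreal ((norm (H z))\<^sup>2 / \<bar>d_xi f z\<bar>) \<partial>lborel)"
    by (subst lborel_pair.nn_integral_snd) (auto simp: lborel_prod)
  finally show ?thesis
    by (simp add: mult.assoc[symmetric] power2_eq_square flip: ennreal_mult)
qed

section \<open>Separating the two distinguished frequencies\<close>

text \<open>
  A measure-preserving identification of the frequency space with the product of the plane of the
  two distinguished frequencies and a space \<open>M\<close> of remaining ones. The map
  \<open>T\<close> joins the two parts, \<open>p\<close> and \<open>q\<close> extract them, and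
  \<open>\<beta>\<close> is the inner product of the remaining parts. The plane itself is the case
  of a one-point space \<open>M\<close>; this treats the traces in dimension two and the waves in
  dimension \<open>n\<close> alike.
\<close>

locale frequency_splitting = sigma_finite_measure M
  for M :: "'m measure" +
  fixes T :: "(real \<times> real) \<times> 'm \<Rightarrow> 'a::euclidean_space"
    and p :: "'a \<Rightarrow> real \<times> real" and q :: "'a \<Rightarrow> 'm" and \<beta> :: "'m \<Rightarrow> 'm \<Rightarrow> real"
  assumes T_measurable [measurable]: "T \<in> borel_measurable (lborel \<Otimes>\<^sub>M M)"
    and distr_T: "distr (lborel \<Otimes>\<^sub>M M) borel T = lborel"
    and p_measurable [measurable]: "p \<in> borel_measurable borel"
    and q_measurable [measurable]: "q \<in> measurable borel M"
    and p_T: "m \<in> space M \<Longrightarrow> p (T (z, m)) = z"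
    and q_T: "m \<in> space M \<Longrightarrow> q (T (z, m)) = m"
    and T_p_q: "T (p x, q x) = x"
    and inner_split: "x \<bullet> \<xi> = p x \<bullet> p \<xi> + \<beta> (q x) (q \<xi>)"
    and \<beta>_measurable [measurable]: "case_prod \<beta> \<in> borel_measurable (M \<Otimes>\<^sub>M M)"
begin

lemma q_space: "q x \<in> space M"
  using measurable_space[OF q_measurable] by simp

sublocale pair: pair_sigma_finite "lborel :: (real \<times> real) measure" M
  by unfold_locales

lemma T_measurable' [measurable]: "T \<in> borel_measurable (borel \<Otimes>\<^sub>M M)"
  using T_measurable by (simp cong: measurable_cong_sets)

lemma integrable_split_iff:
  fixes F :: "'a \<Rightarrow> complex"
  assumes "F \<in> borel_measurable borel"
  shows "integrable (lborel \<Otimes>\<^sub>M M) (\<lambda>w. F (T w)) \<longleftrightarrow> integrable lborel F"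
  using integrable_distr_eq[of T "lborel \<Otimes>\<^sub>M M" borel F] assms by (simp add: distr_T)

lemma integral_split:
  fixes F :: "'a \<Rightarrow> complex"
  assumes "integrable lborel F"
  shows "(LINT x|lborel. F x) = (LINT z|lborel. LINT m|M. F (T (z, m)))"
proof -
  have "(LINT x|lborel. F x) = (LINT w|(lborel \<Otimes>\<^sub>M M). F (T w))"
    using integral_distr[of T "lborel \<Otimes>\<^sub>M M" borel F] assms by (simp add: distr_T)
  also have "\<dots> = (LINT z|lborel. LINT m|M. F (T (z, m)))"
    using assms by (intro pair.integral_fst'[symmetric]) (simp add: integrable_split_iff)
  finally show ?thesis .
qed

lemma nn_integral_split:
  assumes [measurable]: "F \<in> borel_measurable borel"
  shows "(\<integral>\<^sup>+x. F x \<partial>lborel) = (\<integral>\<^sup>+m. \<integral>\<^sup>+z. F (T (z, m)) \<partial>lborel \<partial>M)"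
proof -
  have "(\<integral>\<^sup>+x. F x \<partial>lborel) = (\<integral>\<^sup>+w. F (T w) \<partial>(lborel \<Otimes>\<^sub>M M))"
    using nn_integral_distr[of T "lborel \<Otimes>\<^sub>M M" borel F] by (simp add: distr_T)
  also have "\<dots> = (\<integral>\<^sup>+m. \<integral>\<^sup>+z. F (T (z, m)) \<partial>lborel \<partial>M)"
    by (intro pair.nn_integral_snd[symmetric]) measurable
  finally show ?thesis .
qed

lemma AE_split:
  assumes "AE x in lborel. P x"
  shows "AE z in lborel. AE m in M. P (T (z, m))"
proof -
  have "AE x in distr (lborel \<Otimes>\<^sub>M M) borel T. P x"
    unfolding distr_T by (rule assms)
  then have "AE w in lborel \<Otimes>\<^sub>M M. P (T w)"
    by (rule AE_distrD[rotated]) simp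
  then show ?thesis by (rule pair.AE_pair)
qed

text \<open>
  The Fourier transform in the remaining variables only; it is the amplitude \<open>H\<close> of
  the wave, up to the phase coming from the first distinguished variable.
\<close>

definition partial_transform :: "('a \<Rightarrow> complex) \<Rightarrow> 'm \<Rightarrow> real \<times> real \<Rightarrow> complex" where
  "partial_transform F m z = (LINT m'|M. iexp (\<beta> m m') * F (T (z, m')))"

text \<open>
  In the plane this is the square of the trace norm; in \<open>\<real>\<^sup>n\<close> the square
  of the weighted norm is its integral against \<open>|w|\<^sup>2\<close>.
\<close>

definition fibre_energy ::
    "(real \<times> real \<Rightarrow> complex) \<Rightarrow> (real \<times> real \<Rightarrow> complex) \<Rightarrow> (real \<times> real \<Rightarrow> real) \<Rightarrow>
     ('a \<Rightarrow> complex) \<Rightarrow> real \<Rightarrow> 'm \<Rightarrow> ennreal" where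
  "fibre_energy chi \<sigma> f \<phi> a m =
     (\<integral>\<^sup>+t. \<integral>\<^sup>+y. ennreal ((norm (propagator chi \<sigma> f p t \<phi> (T ((a, y), m))))\<^sup>2) \<partial>lborel \<partial>lborel)"

lemma integrable_partial_transform_integrand:
  assumes F: "integrable lborel F" and m: "m \<in> space M"
  shows "integrable (lborel \<Otimes>\<^sub>M M) (\<lambda>(z, m'). iexp (\<beta> m m') * F (T (z, m')))"
proof -
  have [measurable]: "F \<in> borel_measurable borel" using F by simp
  note m [measurable]
  have "integrable (lborel \<Otimes>\<^sub>M M) (\<lambda>w. F (T w))"
    using F by (simp add: integrable_split_iff)
  then show ?thesis
    by (rule Bochner_Integration.integrable_bound) (auto simp: norm_mult)
qed

lemma integrable_partial_transform:
  assumes "integrable lborel F" and "m \<in> space M"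
  shows "integrable lborel (partial_transform F m)"
  unfolding partial_transform_def[abs_def]
  using pair.integrable_fst[OF integrable_partial_transform_integrand[OF assms]] by simp

text \<open>
  The symbol enters only through the product with the transform of the datum, which is integrable,
  so one Borel version of this product represents the wave at all times and places.
\<close>

lemma propagator_eq_borel:
  assumes f: "f \<in> borel_measurable borel"
    and F: "integrable lborel F"
    and F0: "integrable lebesgue (\<lambda>\<xi>. chi (p \<xi>) * \<sigma> (p \<xi>) * fourier \<phi> \<xi>)"
    and eq: "AE \<xi> in lborel. chi (p \<xi>) * \<sigma> (p \<xi>) * fourier \<phi> \<xi> = F \<xi>"
  shows "propagator chi \<sigma> f p t \<phi> x =
     of_real (1 / (2 * pi) ^ DIM('a)) * (LINT \<xi>|lborel. iexp (x \<bullet> \<xi> + t * f (p \<xi>)) * F \<xi>)"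
proof -
  have "(LINT \<xi>|lebesgue. exp (\<i> * of_real (x \<bullet> \<xi>)) * (chi (p \<xi>) * \<sigma> (p \<xi>) * exp (\<i> * of_real (t * f (p \<xi>)))) * fourier \<phi> \<xi>) =
     (LINT \<xi>|lebesgue. iexp (x \<bullet> \<xi> + t * f (p \<xi>)) * (chi (p \<xi>) * \<sigma> (p \<xi>) * fourier \<phi> \<xi>))"
    by (intro Bochner_Integration.integral_cong) (auto simp: exp_add distrib_left mult_ac)
  also have "\<dots> = (LINT \<xi>|lborel. iexp (x \<bullet> \<xi> + t * f (p \<xi>)) * F \<xi>)"
    using f F F0 eq by (intro integral_lebesgue_borel_version) auto
  finally show ?thesis unfolding propagator_def fourier_multiplier_def by simp
qed

lemma propagator_eq_plane_wave:
  assumes f: "f \<in> borel_measurable borel"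
    and F: "integrable lborel F"
    and F0: "integrable lebesgue (\<lambda>\<xi>. chi (p \<xi>) * \<sigma> (p \<xi>) * fourier \<phi> \<xi>)"
    and eq: "AE \<xi> in lborel. chi (p \<xi>) * \<sigma> (p \<xi>) * fourier \<phi> \<xi> = F \<xi>"
    and m: "m \<in> space M"
  shows "propagator chi \<sigma> f p t \<phi> (T ((a, y), m)) = of_real (1 / (2 * pi) ^ DIM('a)) *
     (LINT z|lborel. iexp (t * f z + y * snd z) * (iexp (a * fst z) * partial_transform F m z))"
proof -
  note f [measurable]
  have [measurable]: "F \<in> borel_measurable borel" using F by simp
  let ?x = "T ((a, y), m)"
  have I: "integrable lborel (\<lambda>\<xi>. iexp (?x \<bullet> \<xi> + t * f (p \<xi>)) * F \<xi>)"
    by (rule Bochner_Integration.integrable_bound[OF F]) (auto simp: norm_mult)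
  have "(LINT \<xi>|lborel. iexp (?x \<bullet> \<xi> + t * f (p \<xi>)) * F \<xi>) =
     (LINT z|lborel. LINT m'|M. iexp (?x \<bullet> T (z, m') + t * f (p (T (z, m')))) * F (T (z, m')))"
    by (rule integral_split[OF I])
  also have "\<dots> = (LINT z|lborel. LINT m'|M. (iexp (t * f z + y * snd z) * iexp (a * fst z)) * (iexp (\<beta> m m') * F (T (z, m'))))"
  proof (intro Bochner_Integration.integral_cong refl)
    fix z m' assume m': "m' \<in> space M"
    have "?x \<bullet> T (z, m') + t * f (p (T (z, m'))) = (t * f z + y * snd z) + a * fst z + \<beta> m m'"
      using m m' by (simp add: inner_split p_T q_T inner_prod_def)
    then show "iexp (?x \<bullet> T (z, m') + t * f (p (T (z, m')))) * F (T (z, m')) =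
        (iexp (t * f z + y * snd z) * iexp (a * fst z)) * (iexp (\<beta> m m') * F (T (z, m')))"
      by (simp add: exp_add distrib_left mult_ac)
  qed
  also have "\<dots> = (LINT z|lborel. iexp (t * f z + y * snd z) * (iexp (a * fst z) * partial_transform F m z))"
    unfolding partial_transform_def by (simp only: integral_mult_right_zero mult.assoc)
  finally show ?thesis
    by (simp only: propagator_eq_borel[OF f F F0 eq])
qed

text \<open>
  A condition on the distinguished frequencies alone is constant along the fibres over which the
  partial transform integrates.
\<close>

lemma AE_partial_transform_eq_0:
  assumes "AE \<xi> in lborel. F \<xi> \<noteq> 0 \<longrightarrow> P (p \<xi>)"
  shows "AE z in lborel. partial_transform F m z \<noteq> 0 \<longrightarrow> P z"
  using AE_split[OF assms]
proof eventually_elim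
  case (elim z)
  show ?case
  proof (rule impI, rule ccontr)
    assume nz: "partial_transform F m z \<noteq> 0" and "\<not> P z"
    with elim have "AE m' in M. iexp (\<beta> m m') * F (T (z, m')) = 0"
      by (auto simp: p_T elim!: AE_mp intro!: AE_I2)
    then have "partial_transform F m z = 0"
      unfolding partial_transform_def by (rule integral_eq_zero_AE)
    with nz show False by simp
  qed
qed

text \<open>
  The right-hand side is independent of \<open>a\<close>: the first distinguished variable
  contributes a factor of modulus one to the amplitude.
\<close>

lemma fibre_energy_eq:
  assumes f: "C1_on_plane f"
    and mono: "monotone_fibres (supp chi) f"
    and F: "integrable lborel F"
    and F0: "integrable lebesgue (\<lambda>\<xi>. chi (p \<xi>) * \<sigma> (p \<xi>) * fourier \<phi> \<xi>)"
    and eq: "AE \<xi> in lborel. chi (p \<xi>) * \<sigma> (p \<xi>) * fourier \<phi> \<xi> = F \<xi>"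
    and nc: "AE \<xi> in lborel. chi (p \<xi>) * fourier \<phi> \<xi> \<noteq> 0 \<longrightarrow> d_xi f (p \<xi>) \<noteq> 0"
    and m: "m \<in> space M"
  shows "fibre_energy chi \<sigma> f \<phi> a m = ennreal ((1 / (2 * pi) ^ DIM('a))\<^sup>2 * (4 * pi\<^sup>2)) *
     (\<integral>\<^sup>+z. ennreal ((norm (partial_transform F m z))\<^sup>2 / \<bar>d_xi f z\<bar>) \<partial>lborel)"
proof -
  note [measurable] = borel_measurable_continuous_onI[OF continuous_C1[OF f]]
  have [measurable]: "(fst :: real \<times> real \<Rightarrow> real) \<in> borel_measurable borel"
      "(snd :: real \<times> real \<Rightarrow> real) \<in> borel_measurable borel"
    by (intro borel_measurable_continuous_onI continuous_intros)+
  let ?C = "1 / (2 * pi) ^ DIM('a)"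
  let ?H = "\<lambda>z. iexp (a * fst z) * partial_transform F m z"
  have K: "integrable lborel (partial_transform F m)"
    using F m by (rule integrable_partial_transform)
  then have [measurable]: "partial_transform F m \<in> borel_measurable borel" by simp
  have H: "integrable lborel ?H"
    by (rule Bochner_Integration.integrable_bound[OF K]) (auto simp: norm_mult)
  have "AE \<xi> in lborel. F \<xi> \<noteq> 0 \<longrightarrow> p \<xi> \<in> supp chi \<and> d_xi f (p \<xi>) \<noteq> 0"
    using eq nc by eventually_elim (auto intro: nonzero_in_supp)
  then have supp: "AE z in lborel. ?H z \<noteq> 0 \<longrightarrow> z \<in> supp chi \<and> d_xi f z \<noteq> 0"
    using AE_partial_transform_eq_0[of F "\<lambda>z. z \<in> supp chi \<and> d_xi f z \<noteq> 0" m] by simp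
  have "fibre_energy chi \<sigma> f \<phi> a m =
     (\<integral>\<^sup>+t. \<integral>\<^sup>+y. ennreal (?C\<^sup>2) * ennreal ((norm (LINT z|lborel. iexp (t * f z + y * snd z) * ?H z))\<^sup>2) \<partial>lborel \<partial>lborel)"
    unfolding fibre_energy_def
    by (intro nn_integral_cong)
      (simp only: propagator_eq_plane_wave[OF _ F F0 eq m] norm_mult norm_of_real power_mult_distrib
        power2_abs ennreal_mult'[OF zero_le_power2] borel_measurable_continuous_onI[OF continuous_C1[OF f]])
  also have "\<dots> = ennreal (?C\<^sup>2) *
     (\<integral>\<^sup>+t. \<integral>\<^sup>+y. ennreal ((norm (LINT z|lborel. iexp (t * f z + y * snd z) * ?H z))\<^sup>2) \<partial>lborel \<partial>lborel)"
    by (simp add: nn_integral_cmult)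
  also have "\<dots> = ennreal (?C\<^sup>2) * (ennreal (4 * pi\<^sup>2) * (\<integral>\<^sup>+z. ennreal ((norm (?H z))\<^sup>2 / \<bar>d_xi f z\<bar>) \<partial>lborel))"
    by (subst plancherel_plane_wave[OF f H closed_supp mono supp]) simp
  also have "\<dots> = ennreal (?C\<^sup>2 * (4 * pi\<^sup>2)) * (\<integral>\<^sup>+z. ennreal ((norm (?H z))\<^sup>2 / \<bar>d_xi f z\<bar>) \<partial>lborel)"
    by (simp only: ennreal_mult'[OF zero_le_power2] mult.assoc)
  finally show ?thesis by (simp add: norm_mult)
qed

text \<open>
  The comparison of the symbols is required only at the frequencies that actually occur in the
  datum. This makes the theorem serve the sufficiency, and with the two waves interchanged and the
  constant inverted also the necessity, of the symbol comparison.
\<close>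

theorem fibre_energy_le:
  assumes f: "C1_on_plane f" and g: "C1_on_plane g"
    and mono_f: "monotone_fibres (supp chi) f"
    and mono_g: "monotone_fibres (supp chi) g"
    and F0: "integrable lebesgue (\<lambda>\<xi>. chi (p \<xi>) * \<sigma> (p \<xi>) * fourier \<phi> \<xi>)"
    and G0: "integrable lebesgue (\<lambda>\<xi>. chi (p \<xi>) * \<tau> (p \<xi>) * fourier \<phi> \<xi>)"
    and nc: "AE \<xi> in lborel. chi (p \<xi>) * fourier \<phi> \<xi> \<noteq> 0 \<longrightarrow> d_xi f (p \<xi>) \<noteq> 0 \<and> d_xi g (p \<xi>) \<noteq> 0 \<and>
        norm (\<sigma> (p \<xi>)) / sqrt \<bar>d_xi f (p \<xi>)\<bar> \<le> A * (norm (\<tau> (p \<xi>)) / sqrt \<bar>d_xi g (p \<xi>)\<bar>)"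
    and A: "0 \<le> A" and m: "m \<in> space M"
  shows "fibre_energy chi \<sigma> f \<phi> a m \<le> ennreal (A\<^sup>2) * fibre_energy chi \<tau> g \<phi> a' m"
proof -
  note [measurable] = borel_measurable_continuous_onI[OF continuous_d_xi[OF f]]
    borel_measurable_continuous_onI[OF continuous_d_xi[OF g]]
  obtain F where F: "integrable lborel F" and eqF: "AE \<xi> in lborel. chi (p \<xi>) * \<sigma> (p \<xi>) * fourier \<phi> \<xi> = F \<xi>"
    using lebesgue_integrable_borel_version[OF F0] .
  obtain G where G: "integrable lborel G" and eqG: "AE \<xi> in lborel. chi (p \<xi>) * \<tau> (p \<xi>) * fourier \<phi> \<xi> = G \<xi>"
    using lebesgue_integrable_borel_version[OF G0] .
  have [measurable]: "partial_transform F m \<in> borel_measurable borel" "partial_transform G m \<in> borel_measurable borel"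
    using integrable_partial_transform[OF F m] integrable_partial_transform[OF G m] by auto
  let ?P = "\<lambda>z. \<sigma> z \<noteq> 0 \<and> d_xi f z \<noteq> 0 \<and> d_xi g z \<noteq> 0 \<and>
        norm (\<sigma> z) / sqrt \<bar>d_xi f z\<bar> \<le> A * (norm (\<tau> z) / sqrt \<bar>d_xi g z\<bar>)"
  have "AE \<xi> in lborel. F \<xi> \<noteq> 0 \<longrightarrow> ?P (p \<xi>)"
    using eqF nc by eventually_elim auto
  then have P: "AE z in lborel. partial_transform F m z \<noteq> 0 \<longrightarrow> ?P z"
    by (rule AE_partial_transform_eq_0)
  have FG: "AE \<xi> in lborel. \<tau> (p \<xi>) * F \<xi> = \<sigma> (p \<xi>) * G \<xi>"
    using eqF eqG
  proof eventually_elim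
    case (elim \<xi>)
    show ?case unfolding elim[symmetric] by (simp only: mult_ac)
  qed
  have proportional: "AE z in lborel. \<tau> z * partial_transform F m z = \<sigma> z * partial_transform G m z"
    using AE_split[OF FG]
  proof eventually_elim
    case (elim z)
    have "\<tau> z * partial_transform F m z = (LINT m'|M. \<tau> z * (iexp (\<beta> m m') * F (T (z, m'))))"
      unfolding partial_transform_def by (simp only: integral_mult_right_zero)
    also have "\<dots> = (LINT m'|M. \<sigma> z * (iexp (\<beta> m m') * G (T (z, m'))))"
    proof (rule integral_cong_AE)
      have [measurable]: "F \<in> borel_measurable borel" "G \<in> borel_measurable borel" using F G by auto
      note m [measurable]
      show "(\<lambda>m'. \<tau> z * (iexp (\<beta> m m') * F (T (z, m')))) \<in> borel_measurable M" by measurable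
      show "(\<lambda>m'. \<sigma> z * (iexp (\<beta> m m') * G (T (z, m')))) \<in> borel_measurable M" by measurable
      show "AE m' in M. \<tau> z * (iexp (\<beta> m m') * F (T (z, m'))) = \<sigma> z * (iexp (\<beta> m m') * G (T (z, m')))"
        using elim AE_space
        by eventually_elim (simp add: p_T mult.left_commute)
    qed
    also have "\<dots> = \<sigma> z * partial_transform G m z"
      unfolding partial_transform_def by (simp only: integral_mult_right_zero)
    finally show ?case .
  qed
  have "(\<integral>\<^sup>+z. ennreal ((norm (partial_transform F m z))\<^sup>2 / \<bar>d_xi f z\<bar>) \<partial>lborel) \<le>
     (\<integral>\<^sup>+z. ennreal (A\<^sup>2) * ennreal ((norm (partial_transform G m z))\<^sup>2 / \<bar>d_xi g z\<bar>) \<partial>lborel)"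
  proof (rule nn_integral_mono_AE, use P proportional in eventually_elim)
    case (elim z)
    show ?case
    proof (cases "partial_transform F m z = 0")
      case False
      let ?s = "norm (\<sigma> z)" and ?t = "norm (\<tau> z)" and ?u = "\<bar>d_xi f z\<bar>" and ?v = "\<bar>d_xi g z\<bar>"
        and ?k = "norm (partial_transform F m z)" and ?l = "norm (partial_transform G m z)"
      have pos: "?s > 0" "?u > 0" "?v > 0" and le: "?s / sqrt ?u \<le> A * (?t / sqrt ?v)"
        using elim False by auto
      have s_pos: "0 < ?s / sqrt ?u" using pos by simp
      have t: "?t > 0"
      proof (cases "\<tau> z = 0")
        case True
        with le have "?s / sqrt ?u \<le> 0" by simp
        with s_pos show ?thesis by linarith
      qed simp
      have kl: "?t * ?k = ?s * ?l" using arg_cong[OF elim(2), of norm] by (simp add: norm_mult)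
      have "(?s / sqrt ?u)\<^sup>2 \<le> (A * (?t / sqrt ?v))\<^sup>2"
        using le pos by (intro power_mono) auto
      then have "?s\<^sup>2 / ?u \<le> A\<^sup>2 * (?t\<^sup>2 / ?v)"
        by (simp add: power_divide power_mult_distrib)
      then have "(?l\<^sup>2 / ?t\<^sup>2) * (?s\<^sup>2 / ?u) \<le> (?l\<^sup>2 / ?t\<^sup>2) * (A\<^sup>2 * (?t\<^sup>2 / ?v))"
        by (intro mult_left_mono) auto
      moreover have "?k = ?s * ?l / ?t" using kl t by (simp add: field_simps)
      then have "(?l\<^sup>2 / ?t\<^sup>2) * (?s\<^sup>2 / ?u) = ?k\<^sup>2 / ?u" by (simp add: power_divide power_mult_distrib mult.commute)
      moreover have "(?l\<^sup>2 / ?t\<^sup>2) * (A\<^sup>2 * (?t\<^sup>2 / ?v)) = A\<^sup>2 * (?l\<^sup>2 / ?v)" using t by simp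
      ultimately have "?k\<^sup>2 / ?u \<le> A\<^sup>2 * (?l\<^sup>2 / ?v)" by (simp only:)
      then show ?thesis by (simp add: ennreal_leI flip: ennreal_mult')
    qed simp
  qed
  also have "\<dots> = ennreal (A\<^sup>2) * (\<integral>\<^sup>+z. ennreal ((norm (partial_transform G m z))\<^sup>2 / \<bar>d_xi g z\<bar>) \<partial>lborel)"
    by (intro nn_integral_cmult) measurable
  finally have le: "(\<integral>\<^sup>+z. ennreal ((norm (partial_transform F m z))\<^sup>2 / \<bar>d_xi f z\<bar>) \<partial>lborel) \<le> \<dots>" .
  have ncf: "AE \<xi> in lborel. chi (p \<xi>) * fourier \<phi> \<xi> \<noteq> 0 \<longrightarrow> d_xi f (p \<xi>) \<noteq> 0"
    and ncg: "AE \<xi> in lborel. chi (p \<xi>) * fourier \<phi> \<xi> \<noteq> 0 \<longrightarrow> d_xi g (p \<xi>) \<noteq> 0"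
    using nc by (auto elim: eventually_mono)
  show ?thesis
    unfolding fibre_energy_eq[OF f mono_f F F0 eqF ncf m] fibre_energy_eq[OF g mono_g G G0 eqG ncg m]
      mult.left_commute[of "ennreal (A\<^sup>2)"]
    by (rule mult_left_mono[OF le]) simp
qed

lemma propagator_measurable:
  assumes f: "C1_on_plane f"
    and F0: "integrable lebesgue (\<lambda>\<xi>. chi (p \<xi>) * \<sigma> (p \<xi>) * fourier \<phi> \<xi>)"
    and [measurable]: "t \<in> borel_measurable N" "x \<in> borel_measurable N"
  shows "(\<lambda>w. propagator chi \<sigma> f p (t w) \<phi> (x w)) \<in> borel_measurable N"
proof -
  note f_meas [measurable] = borel_measurable_continuous_onI[OF continuous_C1[OF f]]
  obtain F where F: "integrable lborel F" and eq: "AE \<xi> in lborel. chi (p \<xi>) * \<sigma> (p \<xi>) * fourier \<phi> \<xi> = F \<xi>"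
    using lebesgue_integrable_borel_version[OF F0] .
  have [measurable]: "F \<in> borel_measurable borel" using F by simp
  show ?thesis
    unfolding propagator_eq_borel[OF f_meas F F0 eq] by measurable
qed

lemma fibre_energy_measurable:
  assumes f: "C1_on_plane f"
    and F0: "integrable lebesgue (\<lambda>\<xi>. chi (p \<xi>) * \<sigma> (p \<xi>) * fourier \<phi> \<xi>)"
  shows "(\<lambda>w. fibre_energy chi \<sigma> f \<phi> (fst w) (snd w)) \<in> borel_measurable (borel \<Otimes>\<^sub>M M)"
  using propagator_measurable[OF f F0, measurable (raw)] unfolding fibre_energy_def by measurable

lemma fibre_energy_le_if_symbol_comparison:
  assumes f: "C1_on_plane f" and g: "C1_on_plane g"
    and mono_f: "monotone_fibres (supp chi) f"
    and mono_g: "monotone_fibres (supp chi) g"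
    and adm: "admissible_datum chi \<sigma> \<tau> f g p \<phi>" and cmp: "symbol_comparison chi \<sigma> \<tau> f g A"
    and A: "0 \<le> A" and m: "m \<in> space M"
  shows "fibre_energy chi \<sigma> f \<phi> a m \<le> ennreal (A\<^sup>2) * fibre_energy chi \<tau> g \<phi> a' m"
proof (rule fibre_energy_le[OF f g mono_f mono_g _ _ _ A m])
  have "AE \<xi> in lborel. chi (p \<xi>) * fourier \<phi> \<xi> \<noteq> 0 \<longrightarrow> d_xi f (p \<xi>) \<noteq> 0 \<and> d_xi g (p \<xi>) \<noteq> 0"
    using adm unfolding admissible_datum_def by (simp add: AE_completion_iff)
  then show "AE \<xi> in lborel. chi (p \<xi>) * fourier \<phi> \<xi> \<noteq> 0 \<longrightarrow> d_xi f (p \<xi>) \<noteq> 0 \<and> d_xi g (p \<xi>) \<noteq> 0 \<and>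
        norm (\<sigma> (p \<xi>)) / sqrt \<bar>d_xi f (p \<xi>)\<bar> \<le> A * (norm (\<tau> (p \<xi>)) / sqrt \<bar>d_xi g (p \<xi>)\<bar>)"
  proof eventually_elim
    case (elim \<xi>)
    then show ?case using cmp nonzero_in_supp[of chi "p \<xi>"] unfolding symbol_comparison_def by simp
  qed
qed (use adm in \<open>auto simp: admissible_datum_def\<close>)

end

section \<open>Band-limited data\<close>

lemma plancherel_integral:
  fixes u :: "real \<Rightarrow> complex"
  assumes u: "integrable lborel u" and u2: "integrable lborel (\<lambda>l. (norm (u l))\<^sup>2)"
  shows "integrable lborel (\<lambda>t. (norm (LINT l|lborel. iexp (t * l) * u l))\<^sup>2)"
    and "(LINT t|lborel. (norm (LINT l|lborel. iexp (t * l) * u l))\<^sup>2) = 2 * pi * (LINT l|lborel. (norm (u l))\<^sup>2)"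
proof -
  have [measurable]: "u \<in> borel_measurable borel" using u by simp
  let ?I = "\<lambda>t. (norm (LINT l|lborel. iexp (t * l) * u l))\<^sup>2"
  have "(\<integral>\<^sup>+t. ennreal (?I t) \<partial>lborel) = ennreal (2 * pi) * ennreal (LINT l|lborel. (norm (u l))\<^sup>2)"
    using u2 by (subst plancherel[OF u]) (simp add: nn_integral_eq_integral)
  also have "\<dots> = ennreal (2 * pi * (LINT l|lborel. (norm (u l))\<^sup>2))"
    by (rule ennreal_mult'[symmetric]) simp
  finally have eq: "(\<integral>\<^sup>+t. ennreal (?I t) \<partial>lborel) = ennreal (2 * pi * (LINT l|lborel. (norm (u l))\<^sup>2))" .
  then show "integrable lborel ?I"
    by (intro integrableI_nonneg) auto
  show "(LINT t|lborel. ?I t) = 2 * pi * (LINT l|lborel. (norm (u l))\<^sup>2)"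
  proof -
    have "(LINT t|lborel. ?I t) = enn2real (\<integral>\<^sup>+t. ennreal (?I t) \<partial>lborel)"
      by (intro integral_eq_nn_integral) auto
    also have "\<dots> = 2 * pi * (LINT l|lborel. (norm (u l))\<^sup>2)"
      unfolding eq by (simp add: Bochner_Integration.integral_nonneg)
    finally show ?thesis .
  qed
qed

lemma borel_measurable_cnj [measurable]: "cnj \<in> borel_measurable borel"
  by (intro borel_measurable_continuous_onI continuous_intros)

lemma integrable_mult_L2:
  fixes g h :: "'a \<Rightarrow> complex"
  assumes [measurable]: "g \<in> borel_measurable M" "h \<in> borel_measurable M"
    and "integrable M (\<lambda>l. (norm (g l))\<^sup>2)" "integrable M (\<lambda>l. (norm (h l))\<^sup>2)"
  shows "integrable M (\<lambda>l. g l * cnj (h l))"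
proof (rule Bochner_Integration.integrable_bound[of _ "\<lambda>l. (norm (g l))\<^sup>2 + (norm (h l))\<^sup>2"])
  have "norm a * norm b \<le> (norm a)\<^sup>2 + (norm b)\<^sup>2" for a b :: complex
  proof -
    have "0 \<le> norm a * norm b" by simp
    then show ?thesis using sum_squares_bound[of "norm a" "norm b"] by linarith
  qed
  then show "AE l in M. norm (g l * cnj (h l)) \<le> norm ((norm (g l))\<^sup>2 + (norm (h l))\<^sup>2)"
    by (auto simp: norm_mult)
qed (use assms in auto)

lemma norm_add_squared_complex:
  "(norm (a + b))\<^sup>2 = (norm a)\<^sup>2 + (norm b)\<^sup>2 + 2 * Re (a * cnj b)" for a b :: complex
  unfolding cmod_power2 by (simp add: power2_eq_square algebra_simps)

text \<open>
  Polarization: comparing the norms of \<open>g + h\<close> gives the real part, and the same with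
  \<open>-\<i> g\<close> in place of \<open>g\<close> gives the imaginary part.
\<close>

lemma parseval:
  fixes g h :: "real \<Rightarrow> complex"
  assumes g: "integrable lborel g" "integrable lborel (\<lambda>l. (norm (g l))\<^sup>2)"
    and h: "integrable lborel h" "integrable lborel (\<lambda>l. (norm (h l))\<^sup>2)"
  shows "(LINT t|lborel. (LINT l|lborel. iexp (t * l) * g l) * cnj (LINT l|lborel. iexp (t * l) * h l))
     = 2 * pi * (LINT l|lborel. g l * cnj (h l))"
proof -
  define F where "F u t = (LINT l|lborel. iexp (t * l) * u l)" for u :: "real \<Rightarrow> complex" and t
  have F_meas [measurable]: "F u \<in> borel_measurable borel" if "integrable lborel u" for u
  proof -
    have [measurable]: "u \<in> borel_measurable borel" using that by simp
    show ?thesis unfolding F_def[abs_def] by measurable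
  qed
  have int_e: "integrable lborel (\<lambda>l. iexp (t * l) * u l)" if "integrable lborel u" for u :: "real \<Rightarrow> complex" and t
    by (rule Bochner_Integration.integrable_bound[OF that]) (use that in \<open>auto simp: norm_mult\<close>)
  have re: "Re (LINT t|lborel. F g t * cnj (F h t)) = 2 * pi * Re (LINT l|lborel. g l * cnj (h l))"
    if g: "integrable lborel g" "integrable lborel (\<lambda>l. (norm (g l))\<^sup>2)" for g
  proof -
    have [measurable]: "g \<in> borel_measurable borel" "h \<in> borel_measurable borel" using g h by auto
    note [measurable] = F_meas[OF g(1)] F_meas[OF h(1)]
    have gh: "integrable lborel (\<lambda>l. g l * cnj (h l))"
      using g h by (intro integrable_mult_L2) auto
    have Fgh: "integrable lborel (\<lambda>t. F g t * cnj (F h t))"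
      using plancherel_integral(1)[OF g] plancherel_integral(1)[OF h]
      by (intro integrable_mult_L2) (auto simp: F_def)
    have s1: "integrable lborel (\<lambda>l. g l + h l)" using g h by simp
    have s2: "integrable lborel (\<lambda>l. (norm (g l + h l))\<^sup>2)"
      unfolding norm_add_squared_complex using g h gh by (intro Bochner_Integration.integrable_add integrable_mult_right integrable_Re) auto
    have F_add: "F (\<lambda>l. g l + h l) t = F g t + F h t" for t
      unfolding F_def distrib_left using int_e[OF g(1)] int_e[OF h(1)] by (rule Bochner_Integration.integral_add)
    have sum: "(LINT t|lborel. (norm (F g t + F h t))\<^sup>2) = 2 * pi * (LINT l|lborel. (norm (g l + h l))\<^sup>2)"
      using plancherel_integral(2)[OF s1 s2] by (simp only: F_add F_def[symmetric])
    have expand: "(LINT x|lborel. (norm (a x + b x))\<^sup>2) =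
       (LINT x|lborel. (norm (a x))\<^sup>2) + (LINT x|lborel. (norm (b x))\<^sup>2) + 2 * Re (LINT x|lborel. a x * cnj (b x))"
      if "integrable lborel (\<lambda>x. (norm (a x))\<^sup>2)" "integrable lborel (\<lambda>x. (norm (b x))\<^sup>2)"
        "integrable lborel (\<lambda>x. a x * cnj (b x))" for a b :: "real \<Rightarrow> complex"
    proof -
      have "integrable lborel (\<lambda>x. 2 * Re (a x * cnj (b x)))"
        by (intro integrable_mult_right integrable_Re that)
      then have "(LINT x|lborel. (norm (a x + b x))\<^sup>2) = (LINT x|lborel. (norm (a x))\<^sup>2) +
          (LINT x|lborel. (norm (b x))\<^sup>2) + (LINT x|lborel. 2 * Re (a x * cnj (b x)))"
        unfolding norm_add_squared_complex using that(1,2)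
        by (subst Bochner_Integration.integral_add; (intro Bochner_Integration.integrable_add)?) auto
      then show ?thesis by (simp only: integral_mult_right_zero integral_Re[OF that(3)])
    qed
    have "(LINT t|lborel. (norm (F g t))\<^sup>2) = 2 * pi * (LINT l|lborel. (norm (g l))\<^sup>2)"
      "(LINT t|lborel. (norm (F h t))\<^sup>2) = 2 * pi * (LINT l|lborel. (norm (h l))\<^sup>2)"
      unfolding F_def by (rule plancherel_integral(2)[OF g] plancherel_integral(2)[OF h])+
    with sum expand[OF g(2) h(2) gh]
      expand[OF plancherel_integral(1)[OF g] plancherel_integral(1)[OF h], folded F_def, OF Fgh]
    have "2 * Re (LINT t|lborel. F g t * cnj (F h t)) = 2 * (2 * pi * Re (LINT l|lborel. g l * cnj (h l)))"
      by (simp only: distrib_left)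
    then show ?thesis by linarith
  qed
  have "Im (LINT t|lborel. F g t * cnj (F h t)) = 2 * pi * Im (LINT l|lborel. g l * cnj (h l))"
  proof -
    let ?g = "\<lambda>l. - \<i> * g l"
    have F': "F ?g t = - \<i> * F g t" for t
      unfolding F_def by (subst integral_mult_right_zero[symmetric]) (simp add: mult_ac)
    have g': "integrable lborel ?g" "integrable lborel (\<lambda>l. (norm (?g l))\<^sup>2)"
      using g by (auto simp: norm_mult)
    have "(LINT t|lborel. F ?g t * cnj (F h t)) = - \<i> * (LINT t|lborel. F g t * cnj (F h t))"
      unfolding F' mult.assoc by (rule integral_mult_right_zero)
    moreover have "(LINT l|lborel. ?g l * cnj (h l)) = - \<i> * (LINT l|lborel. g l * cnj (h l))"
      unfolding mult.assoc by (rule integral_mult_right_zero)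
    ultimately show ?thesis using re[OF g'] by simp
  qed
  with re[OF g] show ?thesis
    unfolding F_def[symmetric] by (simp add: complex_eq_iff)
qed

text \<open>
  Let \<open>u\<close> be the Fourier transform of the indicator of an interval of length
  \<open>r\<close>. Then \<open>|u|\<^sup>2\<close> is integrable by Plancherel, and by Parseval
  its transform is the self-correlation of the indicator, a tent of half-width \<open>r\<close>. A
  modulation moves the tent to \<open>c\<close>. This yields explicit transforms without an
  inversion theorem.
\<close>

lemma exists_bandlimited_function:
  assumes r: "r > 0"
  shows "\<exists>\<psi>. integrable lborel \<psi> \<and> integrable lborel (\<lambda>x. (norm (\<psi> x))\<^sup>2) \<and>
    (\<forall>\<xi>. (LINT x|lborel. iexp (- (x * \<xi>)) * \<psi> x) = complex_of_real (2 * pi * max 0 (r - \<bar>\<xi> - c\<bar>)))"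
proof -
  define h :: "real \<Rightarrow> complex" where "h l = indicator {- r / 2..r / 2} l" for l
  have h_eq: "h = (\<lambda>l. complex_of_real (indicator {- r / 2..r / 2} l))"
    by (auto simp: h_def indicator_def)
  have ind: "integrable lborel (indicator {a..b} :: real \<Rightarrow> real)" for a b :: real
    by (intro integrable_real_indicator) (auto simp: emeasure_lborel_Icc_eq)
  have h: "integrable lborel h"
    unfolding h_eq complex_of_real_integrable_eq by (rule ind)
  have "(\<lambda>l. (norm (h l))\<^sup>2) = indicator {- r / 2..r / 2}"
    by (auto simp: h_def indicator_def)
  then have h2: "integrable lborel (\<lambda>l. (norm (h l))\<^sup>2)" using ind by simp
  have [measurable]: "h \<in> borel_measurable borel" using h by simp
  have shift: "integrable lborel (\<lambda>x. f (s + x))" "(LINT x|lborel. f (s + x)) = (LINT x|lborel. f x)"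
    if "integrable lborel f" for f :: "real \<Rightarrow> 'b::{banach, second_countable_topology}" and s
    using lborel_integrable_real_affine[OF that, of 1 s] lborel_integral_real_affine[of 1 f s] by auto
  define u where "u t = (LINT l|lborel. iexp (t * l) * h l)" for t
  have [measurable]: "u \<in> borel_measurable borel" unfolding u_def[abs_def] by measurable
  have u2: "integrable lborel (\<lambda>t. (norm (u t))\<^sup>2)"
    unfolding u_def by (rule plancherel_integral(1)[OF h h2])
  define B where "B = (LINT l|lborel. norm (h l))"
  have u_bound: "norm (u t) \<le> B" for t
  proof -
    have "norm (u t) \<le> (LINT l|lborel. norm (iexp (t * l) * h l))"
      unfolding u_def by (rule integral_norm_bound)
    then show ?thesis by (simp add: norm_mult B_def)
  qed
  have corr: "(LINT t|lborel. iexp (- (t * s)) * complex_of_real ((norm (u t))\<^sup>2)) = complex_of_real (2 * pi * max 0 (r - \<bar>s\<bar>))" for s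
  proof -
    have "(LINT l|lborel. iexp (t * l) * h (s + l)) = iexp (- (t * s)) * u t" for t
    proof -
      have "(LINT l|lborel. iexp (t * l) * h (s + l)) = (LINT l|lborel. iexp (- (t * s)) * (iexp (t * (s + l)) * h (s + l)))"
        by (intro Bochner_Integration.integral_cong)
          (simp_all add: distrib_left exp_add[symmetric] mult.assoc[symmetric])
      also have "\<dots> = iexp (- (t * s)) * (LINT l|lborel. iexp (t * (s + l)) * h (s + l))"
        by (rule integral_mult_right_zero)
      also have "(LINT l|lborel. iexp (t * (s + l)) * h (s + l)) = u t"
        unfolding u_def
        by (rule shift(2)) (rule Bochner_Integration.integrable_bound[OF h], auto simp: norm_mult)
      finally show ?thesis .
    qed
    then have "(LINT t|lborel. iexp (- (t * s)) * complex_of_real ((norm (u t))\<^sup>2)) =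
        (LINT t|lborel. (LINT l|lborel. iexp (t * l) * h (s + l)) * cnj (LINT l|lborel. iexp (t * l) * h l))"
      by (simp only: complex_norm_square u_def[symmetric] mult.assoc)
    also have "\<dots> = 2 * pi * (LINT l|lborel. h (s + l) * cnj (h l))"
      by (rule parseval[OF shift(1)[OF h] shift(1)[OF h2] h h2])
    also have "(LINT l|lborel. h (s + l) * cnj (h l)) =
        (LINT l|lborel. complex_of_real (indicator {max (- r / 2) (- r / 2 - s)..min (r / 2) (r / 2 - s)} l))"
      by (intro Bochner_Integration.integral_cong) (auto simp: h_def indicator_def)
    also have "\<dots> = of_real (max 0 (r - \<bar>s\<bar>))"
      unfolding integral_complex_of_real by (simp add: max_def min_def)
    finally show ?thesis by simp
  qed
  \<comment> \<open>The modulation by \<open>c\<close> translates the transform by \<open>c\<close>.\<close>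
  define \<psi> where "\<psi> x = iexp (c * x) * complex_of_real ((norm (u x))\<^sup>2)" for x
  have [measurable]: "\<psi> \<in> borel_measurable borel" unfolding \<psi>_def[abs_def] by measurable
  have n\<psi>: "norm (\<psi> x) = (norm (u x))\<^sup>2" for x
    unfolding \<psi>_def norm_mult norm_of_real by simp
  have \<psi>: "integrable lborel \<psi>"
    by (rule Bochner_Integration.integrable_bound[OF u2]) (auto simp: n\<psi>)
  moreover have "integrable lborel (\<lambda>x. (norm (\<psi> x))\<^sup>2)"
  proof (rule Bochner_Integration.integrable_bound[of _ "\<lambda>x. B\<^sup>2 * (norm (u x))\<^sup>2"])
    have "(norm (u x))\<^sup>2 * (norm (u x))\<^sup>2 \<le> B\<^sup>2 * (norm (u x))\<^sup>2" for x
      using u_bound[of x] by (intro mult_right_mono power_mono) auto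
    then show "AE x in lborel. norm ((norm (\<psi> x))\<^sup>2) \<le> norm (B\<^sup>2 * (norm (u x))\<^sup>2)"
      by (auto simp: n\<psi> power2_eq_square[of "_\<^sup>2"])
  qed (use u2 in auto)
  moreover have "(LINT x|lborel. iexp (- (x * \<xi>)) * \<psi> x) = complex_of_real (2 * pi * max 0 (r - \<bar>\<xi> - c\<bar>))" for \<xi>
  proof -
    have "(LINT x|lborel. iexp (- (x * \<xi>)) * \<psi> x) = (LINT x|lborel. iexp (- (x * (\<xi> - c))) * complex_of_real ((norm (u x))\<^sup>2))"
    proof (intro Bochner_Integration.integral_cong refl)
      fix x
      have "iexp (- (x * (\<xi> - c))) = iexp (- (x * \<xi>)) * iexp (c * x)"
        by (simp add: exp_add[symmetric] algebra_simps)
      then show "iexp (- (x * \<xi>)) * \<psi> x = iexp (- (x * (\<xi> - c))) * complex_of_real ((norm (u x))\<^sup>2)"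
        by (simp only: \<psi>_def mult.assoc)
    qed
    then show ?thesis by (simp only: corr)
  qed
  ultimately show ?thesis by blast
qed

text \<open>
  Localization takes place in the two distinguished frequencies. The other variables only have to
  supply a factor \<open>\<Gamma>\<close> whose contribution to the amplitude vanishes nowhere in
  space; Gaussians have this property.
\<close>

locale frequency_splitting_window = frequency_splitting M T p q \<beta>
  for M :: "'m measure" and T :: "(real \<times> real) \<times> 'm \<Rightarrow> 'a::euclidean_space" and p q \<beta> +
  fixes \<Gamma> \<Gamma>h :: "'m \<Rightarrow> complex"
  assumes window: "integrable M \<Gamma>" "integrable M (\<lambda>m. (norm (\<Gamma> m))\<^sup>2)"
    and window_transform: "m \<in> space M \<Longrightarrow> (LINT m'|M. iexp (- \<beta> m' m) * \<Gamma> m') = \<Gamma>h m"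
    and window_transform_integrable: "integrable M \<Gamma>h"
    and window_nonvanishing: "m \<in> space M \<Longrightarrow> (LINT m'|M. iexp (\<beta> m m') * \<Gamma>h m') \<noteq> 0"
begin

text \<open>
  The product of two band-limited functions and the window; its transform is the product of the
  transforms because the inner product splits.
\<close>

lemma exists_datum:
  assumes r: "r > 0"
  shows "\<exists>\<phi> k. integrable lebesgue \<phi> \<and> integrable lebesgue (\<lambda>x. (norm (\<phi> x))\<^sup>2) \<and>
     continuous_on UNIV k \<and> (\<forall>z. k z \<noteq> 0 \<longleftrightarrow> \<bar>fst z - c1\<bar> < r \<and> \<bar>snd z - c2\<bar> < r) \<and>
     (\<forall>\<xi>. fourier \<phi> \<xi> = k (p \<xi>) * \<Gamma>h (q \<xi>))"
proof -
  obtain \<psi>1 where \<psi>1: "integrable lborel \<psi>1" "integrable lborel (\<lambda>x. (norm (\<psi>1 x))\<^sup>2)"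
    and F1: "\<And>\<xi>. (LINT x|lborel. iexp (- (x * \<xi>)) * \<psi>1 x) = complex_of_real (2 * pi * max 0 (r - \<bar>\<xi> - c1\<bar>))"
    using exists_bandlimited_function[OF r, of c1] by blast
  obtain \<psi>2 where \<psi>2: "integrable lborel \<psi>2" "integrable lborel (\<lambda>x. (norm (\<psi>2 x))\<^sup>2)"
    and F2: "\<And>\<xi>. (LINT x|lborel. iexp (- (x * \<xi>)) * \<psi>2 x) = complex_of_real (2 * pi * max 0 (r - \<bar>\<xi> - c2\<bar>))"
    using exists_bandlimited_function[OF r, of c2] by blast
  define k where "k z = complex_of_real (2 * pi * max 0 (r - \<bar>fst z - c1\<bar>)) * complex_of_real (2 * pi * max 0 (r - \<bar>snd z - c2\<bar>))" for z
  define \<psi> where "\<psi> z = \<psi>1 (fst z) * \<psi>2 (snd z)" for z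
  define \<phi> where "\<phi> x = \<psi> (p x) * \<Gamma> (q x)" for x
  have [measurable]: "\<psi>1 \<in> borel_measurable borel" "\<psi>2 \<in> borel_measurable borel" "\<Gamma> \<in> borel_measurable M"
    using \<psi>1 \<psi>2 window by auto
  have M_sf: "sigma_finite_measure M" by (rule sigma_finite_measure_axioms)
  have \<psi>: "integrable lborel \<psi>"
    unfolding \<psi>_def[abs_def] lborel_prod[symmetric]
    by (intro integrable_pair_mult sigma_finite_lborel \<psi>1 \<psi>2)
  then have [measurable]: "\<psi> \<in> borel_measurable borel" by simp
  have \<psi>sq: "integrable lborel (\<lambda>z. (norm (\<psi> z))\<^sup>2)"
    unfolding \<psi>_def[abs_def] lborel_prod[symmetric] norm_mult power_mult_distrib
    by (intro integrable_pair_mult[where f="\<lambda>x. (norm (\<psi>1 x))\<^sup>2" and g="\<lambda>x. (norm (\<psi>2 x))\<^sup>2"] sigma_finite_lborel \<psi>1 \<psi>2)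
  have [measurable]: "\<phi> \<in> borel_measurable borel" unfolding \<phi>_def[abs_def] by measurable
  have \<phi>_T: "\<phi> (T w) = \<psi> (fst w) * \<Gamma> (snd w)" if "w \<in> space (lborel \<Otimes>\<^sub>M M)" for w
    using that by (cases w) (auto simp: \<phi>_def p_T q_T space_pair_measure)
  have "integrable (lborel \<Otimes>\<^sub>M M) (\<lambda>w. \<psi> (fst w) * \<Gamma> (snd w))"
    by (intro integrable_pair_mult sigma_finite_lborel M_sf \<psi> window)
  then have "integrable (lborel \<Otimes>\<^sub>M M) (\<lambda>w. \<phi> (T w))"
    by (subst Bochner_Integration.integrable_cong[OF refl \<phi>_T]) auto
  then have \<phi>: "integrable lborel \<phi>" by (simp add: integrable_split_iff)
  have "integrable (lborel \<Otimes>\<^sub>M M) (\<lambda>w. (norm (\<psi> (fst w)))\<^sup>2 * (norm (\<Gamma> (snd w)))\<^sup>2)"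
    by (intro integrable_pair_mult[where f="\<lambda>x. (norm (\<psi> x))\<^sup>2" and g="\<lambda>x. (norm (\<Gamma> x))\<^sup>2"] sigma_finite_lborel M_sf \<psi>sq window)
  then have "integrable (lborel \<Otimes>\<^sub>M M) (\<lambda>w. (norm (\<phi> (T w)))\<^sup>2)"
    by (subst Bochner_Integration.integrable_cong[OF refl, of _ _ "\<lambda>w. (norm (\<psi> (fst w)))\<^sup>2 * (norm (\<Gamma> (snd w)))\<^sup>2"])
      (auto simp: \<phi>_T norm_mult power_mult_distrib)
  then have "integrable (lborel \<Otimes>\<^sub>M M) (\<lambda>w. complex_of_real ((norm (\<phi> (T w)))\<^sup>2))"
    by (simp only: complex_of_real_integrable_eq)
  then have "integrable lborel (\<lambda>x. complex_of_real ((norm (\<phi> x))\<^sup>2))"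
    by (subst (asm) integrable_split_iff) auto
  then have \<phi>sq: "integrable lborel (\<lambda>x. (norm (\<phi> x))\<^sup>2)"
    by (simp only: complex_of_real_integrable_eq)
  have F\<psi>: "(LINT z|lborel. iexp (- (z \<bullet> \<zeta>)) * \<psi> z) = k \<zeta>" for \<zeta>
  proof -
    have int: "integrable lborel (\<lambda>x. iexp (- (x * s)) * \<psi>' x)" if "integrable lborel \<psi>'" for \<psi>' :: "real \<Rightarrow> complex" and s
      by (rule Bochner_Integration.integrable_bound[OF that]) (use that in \<open>auto simp: norm_mult\<close>)
    have "(LINT z|lborel. iexp (- (z \<bullet> \<zeta>)) * \<psi> z) =
       (LINT z|(lborel \<Otimes>\<^sub>M lborel). (iexp (- (fst z * fst \<zeta>)) * \<psi>1 (fst z)) * (iexp (- (snd z * snd \<zeta>)) * \<psi>2 (snd z)))"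
      unfolding lborel_prod
      by (intro Bochner_Integration.integral_cong)
        (simp_all add: \<psi>_def inner_prod_def exp_diff exp_minus field_simps)
    also have "\<dots> = k \<zeta>"
      unfolding k_def F1[symmetric] F2[symmetric]
      by (intro integral_pair_mult sigma_finite_lborel int \<psi>1 \<psi>2)
    finally show ?thesis .
  qed
  have "fourier \<phi> \<xi> = k (p \<xi>) * \<Gamma>h (q \<xi>)" for \<xi>
  proof -
    have I: "integrable lborel (\<lambda>x. iexp (- (x \<bullet> \<xi>)) * \<phi> x)"
      by (rule Bochner_Integration.integrable_bound[OF \<phi>]) (auto simp: norm_mult)
    have "fourier \<phi> \<xi> = (LINT x|lebesgue. iexp (- (x \<bullet> \<xi>)) * \<phi> x)"
      by (simp add: fourier_def)
    also have "\<dots> = (LINT x|lborel. iexp (- (x \<bullet> \<xi>)) * \<phi> x)"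
      by (rule integral_completion) simp
    also have "\<dots> = (LINT z|lborel. LINT m|M. iexp (- (T (z, m) \<bullet> \<xi>)) * \<phi> (T (z, m)))"
      by (rule integral_split[OF I])
    also have "\<dots> = (LINT z|lborel. LINT m|M. (iexp (- (z \<bullet> p \<xi>)) * \<psi> z) * (iexp (- \<beta> m (q \<xi>)) * \<Gamma> m))"
      by (intro Bochner_Integration.integral_cong refl)
        (simp add: \<phi>_def inner_split p_T q_T exp_diff exp_minus field_simps)
    also have "\<dots> = (LINT z|lborel. (iexp (- (z \<bullet> p \<xi>)) * \<psi> z) * \<Gamma>h (q \<xi>))"
      by (simp only: integral_mult_right_zero window_transform[OF q_space])
    also have "\<dots> = k (p \<xi>) * \<Gamma>h (q \<xi>)"
      by (simp only: integral_mult_left_zero F\<psi>)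
    finally show ?thesis .
  qed
  moreover have "continuous_on UNIV k"
    unfolding k_def by (intro continuous_intros)
  moreover have "k z \<noteq> 0 \<longleftrightarrow> \<bar>fst z - c1\<bar> < r \<and> \<bar>snd z - c2\<bar> < r" for z
    unfolding k_def by (auto simp: max_def)
  moreover have "integrable lebesgue \<phi>" "integrable lebesgue (\<lambda>x. (norm (\<phi> x))\<^sup>2)"
    using \<phi> \<phi>sq by (simp_all add: integrable_completion)
  ultimately show ?thesis by blast
qed

text \<open>
  The band-limited factor is supported in a compact box \<open>B\<close> inside \<open>W\<close>.
  On \<open>B\<close> the integrand of the energy is continuous, hence the energy is finite, and
  on the interior of \<open>B\<close> the integrand is positive.
\<close>

theorem exists_localized_datum:
  assumes f: "C1_on_plane f"
    and mono: "monotone_fibres (supp chi) f"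
    and chi: "continuous_on UNIV chi" and \<sigma>: "continuous_on UNIV \<sigma>" and \<tau>: "continuous_on UNIV \<tau>"
    and W: "open W" "W \<noteq> {}"
    and nz: "\<And>z. z \<in> W \<Longrightarrow> chi z \<noteq> 0 \<and> \<sigma> z \<noteq> 0 \<and> d_xi f z \<noteq> 0 \<and> d_xi g z \<noteq> 0"
  shows "\<exists>\<phi>. admissible_datum chi \<sigma> \<tau> f g p \<phi> \<and> (\<forall>\<xi>. fourier \<phi> \<xi> \<noteq> 0 \<longrightarrow> p \<xi> \<in> W) \<and>
     (\<forall>m\<in>space M. \<forall>a. 0 < fibre_energy chi \<sigma> f \<phi> a m \<and> fibre_energy chi \<sigma> f \<phi> a m < \<infinity>)"
proof -
  obtain c where "c \<in> W" using W by blast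
  then obtain e where e: "e > 0" "ball c e \<subseteq> W" using W(1) open_contains_ball by blast
  \<comment> \<open>The corners of the box are then at distance at most \<open>2 e / 3\<close> from
    \<open>c\<close> in the sum norm.\<close>
  define r where "r = e / 3"
  define B where "B = {fst c - r..fst c + r} \<times> {snd c - r..snd c + r}"
  have r: "r > 0" using e by (simp add: r_def)
  have B: "compact B" unfolding B_def by (intro compact_Times) auto
  have BW: "B \<subseteq> W"
  proof
    fix z assume z: "z \<in> B"
    have "dist c z \<le> dist (fst c) (fst z) + dist (snd c) (snd z)"
      unfolding dist_prod_def by (rule sqrt_sum_squares_le_sum) auto
    also have "\<dots> < e" using z e unfolding B_def r_def by (auto simp: dist_real_def)
    finally show "z \<in> W" using e by auto
  qed
  obtain \<phi> k where \<phi>: "integrable lebesgue \<phi>" "integrable lebesgue (\<lambda>x. (norm (\<phi> x))\<^sup>2)"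
    and k: "continuous_on UNIV k" "\<And>z. k z \<noteq> 0 \<longleftrightarrow> \<bar>fst z - fst c\<bar> < r \<and> \<bar>snd z - snd c\<bar> < r"
    and F\<phi>: "\<And>\<xi>. fourier \<phi> \<xi> = k (p \<xi>) * \<Gamma>h (q \<xi>)"
    using exists_datum[OF r, of "fst c" "snd c"] by blast
  have kB: "z \<in> B" if "k z \<noteq> 0" for z
    using that unfolding k(2) B_def by (cases z) (auto simp: abs_less_iff)
  note [measurable] = borel_measurable_continuous_onI[OF chi] borel_measurable_continuous_onI[OF \<sigma>]
    borel_measurable_continuous_onI[OF k(1)] borel_measurable_continuous_onI[OF continuous_d_xi[OF f]]
  have [measurable]: "\<Gamma>h \<in> borel_measurable M" using window_transform_integrable by simp
  have int_B: "integrable lborel h" if "continuous_on B h" "\<And>z. z \<notin> B \<Longrightarrow> h z = 0"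
    for h :: "real \<times> real \<Rightarrow> 'b::euclidean_space"
  proof -
    have "integrable lborel (\<lambda>z. indicator B z *\<^sub>R h z)"
      by (rule borel_integrable_compact[OF B that(1)])
    also have "(\<lambda>z. indicator B z *\<^sub>R h z) = h" using that(2) by (auto simp: indicator_def fun_eq_iff)
    finally show ?thesis .
  qed
  have lift: "integrable lborel (\<lambda>\<xi>. chi (p \<xi>) * s (p \<xi>) * fourier \<phi> \<xi>)" if s: "continuous_on UNIV s" for s
  proof -
    note [measurable] = borel_measurable_continuous_onI[OF s]
    have "integrable lborel (\<lambda>z. chi z * s z * k z)"
      using kB by (intro int_B continuous_intros continuous_on_subset[OF chi] continuous_on_subset[OF s] continuous_on_subset[OF k(1)]) auto
    then have "integrable (lborel \<Otimes>\<^sub>M M) (\<lambda>w. (chi (fst w) * s (fst w) * k (fst w)) * \<Gamma>h (snd w))"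
      by (intro integrable_pair_mult[where f="\<lambda>z. chi z * s z * k z"] sigma_finite_lborel
          sigma_finite_measure_axioms window_transform_integrable)
    then have "integrable (lborel \<Otimes>\<^sub>M M) (\<lambda>w. chi (p (T w)) * s (p (T w)) * fourier \<phi> (T w))"
      by (rule Bochner_Integration.integrable_cong[THEN iffD1, OF refl, rotated])
        (auto simp: F\<phi> p_T q_T space_pair_measure)
    then show ?thesis
      unfolding F\<phi> by (subst (asm) integrable_split_iff) auto
  qed
  have lift': "integrable lebesgue (\<lambda>\<xi>. chi (p \<xi>) * s (p \<xi>) * fourier \<phi> \<xi>)" if s: "continuous_on UNIV s" for s
    using lift[OF s] by (subst integrable_completion) auto
  have loc: "p \<xi> \<in> W" if "fourier \<phi> \<xi> \<noteq> 0" for \<xi>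
    using that kB[of "p \<xi>"] BW by (auto simp: F\<phi>)
  have adm: "admissible_datum chi \<sigma> \<tau> f g p \<phi>"
    unfolding admissible_datum_def using \<phi> lift'[OF \<sigma>] lift'[OF \<tau>] loc nz by (auto intro!: AE_I2)
  let ?F = "\<lambda>\<xi>. chi (p \<xi>) * \<sigma> (p \<xi>) * fourier \<phi> \<xi>"
  have "0 < fibre_energy chi \<sigma> f \<phi> a m \<and> fibre_energy chi \<sigma> f \<phi> a m < \<infinity>" if m: "m \<in> space M" for a m
  proof -
    define \<gamma> where "\<gamma> = (LINT m'|M. iexp (\<beta> m m') * \<Gamma>h m')"
    have \<gamma>: "\<gamma> \<noteq> 0" unfolding \<gamma>_def by (rule window_nonvanishing[OF m])
    have K: "partial_transform ?F m z = chi z * \<sigma> z * k z * \<gamma>" for z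
    proof -
      have "partial_transform ?F m z = (LINT m'|M. (chi z * \<sigma> z * k z) * (iexp (\<beta> m m') * \<Gamma>h m'))"
        unfolding partial_transform_def
        by (intro Bochner_Integration.integral_cong refl) (simp add: F\<phi> p_T q_T mult_ac)
      also have "\<dots> = (chi z * \<sigma> z * k z) * \<gamma>"
        unfolding \<gamma>_def by (rule integral_mult_right_zero)
      finally show ?thesis .
    qed
    let ?J = "\<lambda>z. (norm (chi z * \<sigma> z * k z * \<gamma>))\<^sup>2 / \<bar>d_xi f z\<bar>"
    define C where "C = (1 / (2 * pi) ^ DIM('a))\<^sup>2 * (4 * pi\<^sup>2)"
    have C: "C > 0" unfolding C_def by simp
    have en: "fibre_energy chi \<sigma> f \<phi> a m = ennreal C * (\<integral>\<^sup>+z. ennreal (?J z) \<partial>lborel)"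
      unfolding C_def K[symmetric]
    proof (rule fibre_energy_eq[OF f mono lift[OF \<sigma>] lift'[OF \<sigma>] _ _ m])
      show "AE \<xi> in lborel. chi (p \<xi>) * fourier \<phi> \<xi> \<noteq> 0 \<longrightarrow> d_xi f (p \<xi>) \<noteq> 0"
        using loc nz by (auto intro!: AE_I2)
    qed simp
    have "integrable lborel ?J"
      using kB BW nz by (intro int_B continuous_intros continuous_on_subset[OF chi] continuous_on_subset[OF \<sigma>]
          continuous_on_subset[OF k(1)] continuous_on_subset[OF continuous_d_xi[OF f]]) auto
    then have "(\<integral>\<^sup>+z. ennreal (?J z) \<partial>lborel) < \<infinity>"
      by (simp add: nn_integral_eq_integral)
    moreover have "(\<integral>\<^sup>+z. ennreal (?J z) \<partial>lborel) \<noteq> 0"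
    proof
      assume "(\<integral>\<^sup>+z. ennreal (?J z) \<partial>lborel) = 0"
      then have "AE z in lborel. ennreal (?J z) = 0"
        by (subst (asm) nn_integral_0_iff_AE) auto
      then have ae: "AE z in lborel. z \<notin> {fst c - r<..<fst c + r} \<times> {snd c - r<..<snd c + r}"
      proof eventually_elim
        case (elim z)
        show ?case
        proof
          assume z: "z \<in> {fst c - r<..<fst c + r} \<times> {snd c - r<..<snd c + r}"
          then have kz: "k z \<noteq> 0" unfolding k(2) by auto
          with kB BW nz have "chi z \<noteq> 0" "\<sigma> z \<noteq> 0" "d_xi f z \<noteq> 0" by blast+
          with kz \<gamma> have "?J z > 0" by simp
          then have "ennreal (?J z) \<noteq> 0" by (metis ennreal_eq_0_iff not_le)
          with elim show False by blast
        qed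
      qed
      have op: "open ({fst c - r<..<fst c + r} \<times> {snd c - r<..<snd c + r})" by (intro open_Times) auto
      have "{fst c - r<..<fst c + r} \<times> {snd c - r<..<snd c + r} \<in> null_sets lborel"
        using ae op by (subst (asm) AE_iff_null_sets[symmetric]) auto
      then have "negligible ({fst c - r<..<fst c + r} \<times> {snd c - r<..<snd c + r})"
        by (simp add: negligible_iff_null_sets null_sets_completionI)
      then have "{fst c - r<..<fst c + r} \<times> {snd c - r<..<snd c + r} = {}"
        using op open_not_negligible by blast
      then show False using r by simp
    qed
    ultimately show ?thesis
      unfolding en using C by (auto simp: ennreal_mult_less_top ennreal_zero_less_mult_iff zero_less_iff_neq_zero)
  qed
  with adm loc show ?thesis by blast
qed

end

section \<open>Necessity of the symbol comparison\<close>

text \<open>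
  The set where the comparison fails strictly is open, and since the support of \<open>chi\<close>
  is a closure, this set meets \<open>{z. chi z \<noteq> 0}\<close>. A datum localized there
  satisfies the reverse estimate with a gain \<open>\<rho>\<close>.
\<close>

theorem (in frequency_splitting_window) exists_violating_datum:
  assumes f: "C1_on_plane f" and g: "C1_on_plane g"
    and mono_f: "monotone_fibres (supp chi) f"
    and mono_g: "monotone_fibres (supp chi) g"
    and chi: "continuous_on UNIV chi" and \<sigma>: "continuous_on UNIV \<sigma>" and \<tau>: "continuous_on UNIV \<tau>"
    and A: "A > 0" and viol: "\<not> symbol_comparison chi \<sigma> \<tau> f g A"
  shows "\<exists>\<phi> \<rho>. \<rho> > 1 \<and> admissible_datum chi \<sigma> \<tau> f g p \<phi> \<and>
     (\<forall>m\<in>space M. \<forall>a a'. 0 < fibre_energy chi \<sigma> f \<phi> a m \<and> fibre_energy chi \<sigma> f \<phi> a m < \<infinity> \<and>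
        fibre_energy chi \<tau> g \<phi> a' m \<le> ennreal ((1 / (\<rho> * A))\<^sup>2) * fibre_energy chi \<sigma> f \<phi> a m)"
proof -
  note cont = continuous_d_xi[OF f] continuous_d_xi[OF g] chi \<sigma> \<tau>
  obtain z0 where z0: "z0 \<in> supp chi" "d_xi f z0 \<noteq> 0" "d_xi g z0 \<noteq> 0"
    and lt: "A * (norm (\<tau> z0) / sqrt \<bar>d_xi g z0\<bar>) < norm (\<sigma> z0) / sqrt \<bar>d_xi f z0\<bar>"
    using viol unfolding symbol_comparison_def by (auto simp: not_le)
  obtain \<rho> where \<rho>: "\<rho> > 1" "\<rho> * (A * (norm (\<tau> z0) / sqrt \<bar>d_xi g z0\<bar>)) < norm (\<sigma> z0) / sqrt \<bar>d_xi f z0\<bar>"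
  proof -
    define t s where "t = A * (norm (\<tau> z0) / sqrt \<bar>d_xi g z0\<bar>)" and "s = norm (\<sigma> z0) / sqrt \<bar>d_xi f z0\<bar>"
    have ts: "0 \<le> t" "t < s" using A lt by (simp_all add: t_def s_def)
    have "\<exists>\<rho>>1. \<rho> * t < s"
    proof (cases "t = 0")
      case True
      then show ?thesis using ts by (intro exI[of _ 2]) simp
    next
      case False
      then show ?thesis using ts by (intro exI[of _ "(t + s) / (2 * t)"]) (simp add: field_simps)
    qed
    then show ?thesis using that unfolding t_def s_def by blast
  qed
  \<comment> \<open>The violated inequality, multiplied out so that both sides are continuous everywhere.\<close>
  define W0 where "W0 = {z. d_xi f z \<noteq> 0} \<inter> {z. d_xi g z \<noteq> 0} \<inter>
    {z. \<rho> * A * norm (\<tau> z) * sqrt \<bar>d_xi f z\<bar> < norm (\<sigma> z) * sqrt \<bar>d_xi g z\<bar>}"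
  define W where "W = W0 \<inter> {z. chi z \<noteq> 0}"
  have W0: "open W0" unfolding W0_def
    by (intro open_Int open_Collect_less open_Collect_neq continuous_intros cont)
  have W: "open W" unfolding W_def
    by (intro open_Int W0 open_Collect_neq continuous_intros cont)
  have "z0 \<in> W0" unfolding W0_def using z0 \<rho>(2) by (simp add: field_simps)
  with z0(1) W0 have "W0 \<inter> {z. chi z \<noteq> 0} \<noteq> {}"
    unfolding supp_def by (metis (no_types, lifting) IntI closure_iff_nhds_not_empty disjoint_iff order_refl Int_commute)
  then have "W \<noteq> {}" by (simp add: W_def)
  have nz: "chi z \<noteq> 0 \<and> \<sigma> z \<noteq> 0 \<and> d_xi f z \<noteq> 0 \<and> d_xi g z \<noteq> 0" if "z \<in> W" for z
  proof -
    have "0 \<le> \<rho> * A * norm (\<tau> z) * sqrt \<bar>d_xi f z\<bar>" using \<rho> A by simp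
    also have "\<dots> < norm (\<sigma> z) * sqrt \<bar>d_xi g z\<bar>" using that by (simp add: W_def W0_def)
    finally show ?thesis using that by (auto simp: W_def W0_def)
  qed
  have ratio: "norm (\<tau> z) / sqrt \<bar>d_xi g z\<bar> \<le> 1 / (\<rho> * A) * (norm (\<sigma> z) / sqrt \<bar>d_xi f z\<bar>)" if "z \<in> W" for z
  proof -
    have "\<rho> * A * norm (\<tau> z) * sqrt \<bar>d_xi f z\<bar> \<le> norm (\<sigma> z) * sqrt \<bar>d_xi g z\<bar>"
      using that by (simp add: W_def W0_def)
    then show ?thesis using nz[OF that] \<rho> A by (simp add: field_simps)
  qed
  obtain \<phi> where adm: "admissible_datum chi \<sigma> \<tau> f g p \<phi>" and loc: "\<And>\<xi>. fourier \<phi> \<xi> \<noteq> 0 \<Longrightarrow> p \<xi> \<in> W"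
    and en: "\<And>m a. m \<in> space M \<Longrightarrow> 0 < fibre_energy chi \<sigma> f \<phi> a m \<and> fibre_energy chi \<sigma> f \<phi> a m < \<infinity>"
    using exists_localized_datum[OF f mono_f chi \<sigma> \<tau> W \<open>W \<noteq> {}\<close> nz] by blast
  have "fibre_energy chi \<tau> g \<phi> a' m \<le> ennreal ((1 / (\<rho> * A))\<^sup>2) * fibre_energy chi \<sigma> f \<phi> a m"
    if m: "m \<in> space M" for a a' m
  proof (rule fibre_energy_le[OF g f mono_g mono_f _ _ _ _ m])
    show "AE \<xi> in lborel. chi (p \<xi>) * fourier \<phi> \<xi> \<noteq> 0 \<longrightarrow> d_xi g (p \<xi>) \<noteq> 0 \<and> d_xi f (p \<xi>) \<noteq> 0 \<and>
        norm (\<tau> (p \<xi>)) / sqrt \<bar>d_xi g (p \<xi>)\<bar> \<le> 1 / (\<rho> * A) * (norm (\<sigma> (p \<xi>)) / sqrt \<bar>d_xi f (p \<xi>)\<bar>)"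
      using loc nz ratio by (intro AE_I2) (simp add: )
  qed (use adm \<rho> A in \<open>auto simp: admissible_datum_def\<close>)
  with adm en \<rho>(1) show ?thesis by blast
qed

section \<open>Comparing norms\<close>

text \<open>
  The square of the norm is a plain integral. Inequalities between norms are transferred to it,
  which avoids square roots of possibly infinite quantities.
\<close>

definition L2_norm_squared :: "('a::euclidean_space \<Rightarrow> complex) \<Rightarrow> ennreal" where
  "L2_norm_squared u = (\<integral>\<^sup>+z. ennreal ((norm (u z))\<^sup>2) \<partial>lborel)"

lemma L2_norm_eq: "L2_norm u = (if L2_norm_squared u = \<infinity> then \<infinity> else ennreal (sqrt (enn2real (L2_norm_squared u))))"
  unfolding L2_norm_def L2_norm_squared_def by (simp add: nn_integral_completion)

lemma L2_norm_finite_iff: "L2_norm u < \<infinity> \<longleftrightarrow> L2_norm_squared u < \<infinity>"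
  by (simp add: L2_norm_eq less_top)

lemma L2_norm_le_iff:
  assumes A: "A > 0"
  shows "L2_norm u \<le> ennreal A * L2_norm v \<longleftrightarrow> L2_norm_squared u \<le> ennreal (A\<^sup>2) * L2_norm_squared v"
proof (cases "L2_norm_squared v = \<infinity>")
  case True
  then show ?thesis using A by (simp add: L2_norm_eq ennreal_mult_top)
next
  case v: False
  then obtain b where b: "L2_norm_squared v = ennreal b" "b \<ge> 0" by (cases "L2_norm_squared v") auto
  show ?thesis
  proof (cases "L2_norm_squared u = \<infinity>")
    case True
    then show ?thesis using b A by (simp add: L2_norm_eq top_unique flip: ennreal_mult)
  next
    case False
    then obtain a where a: "L2_norm_squared u = ennreal a" "a \<ge> 0" by (cases "L2_norm_squared u") auto
    have "sqrt a \<le> A * sqrt b \<longleftrightarrow> sqrt a \<le> sqrt (A\<^sup>2 * b)"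
      using A by (simp add: real_sqrt_mult)
    then show ?thesis
      using a b A by (simp add: L2_norm_eq flip: ennreal_mult)
  qed
qed

text \<open>
  The assumed norm inequality and the reverse estimate with its gain \<open>\<rho>\<close> combine
  to \<open>X \<le> X / \<rho>\<^sup>2\<close>.
\<close>

lemma no_finite_positive_contraction:
  fixes X Y :: ennreal
  assumes "X \<le> ennreal (A\<^sup>2) * Y" "Y \<le> ennreal ((1 / (\<rho> * A))\<^sup>2) * X" "0 < X" "X < \<infinity>" "\<rho> > 1" "A > 0"
  shows False
proof -
  obtain x where x: "X = ennreal x" "x > 0"
    using assms(3,4) by (cases X) (auto simp: zero_less_iff_neq_zero ennreal_eq_0_iff not_le)
  have "X \<le> ennreal (A\<^sup>2) * (ennreal ((1 / (\<rho> * A))\<^sup>2) * X)"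
    using assms(1) mult_left_mono[OF assms(2), of "ennreal (A\<^sup>2)"] by (rule order_trans) simp
  then have "x \<le> A\<^sup>2 * ((1 / (\<rho> * A))\<^sup>2 * x)"
    using x by (simp flip: ennreal_mult)
  also have "\<dots> = x / \<rho>\<^sup>2"
    using assms by (simp add: power_divide power_mult_distrib)
  finally have "x * \<rho>\<^sup>2 \<le> x" using assms by (simp add: field_simps)
  moreover have "1 < \<rho>\<^sup>2" using assms by (simp add: one_less_power)
  ultimately show False using x by (simp add: mult_le_cancel_left1)
qed

section \<open>The trace norm in the plane\<close>

text \<open>
  In the plane nothing remains besides the two distinguished frequencies. The one-point space
  carries counting measure, and the window is the constant 1.
\<close>

interpretation plane: frequency_splitting_window "count_space (UNIV :: unit set)" fst "\<lambda>\<xi> :: real \<times> real. \<xi>"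
  "\<lambda>_. ()" "\<lambda>_ _. 0" "\<lambda>_. 1" "\<lambda>_. 1"
proof -
  let ?U = "count_space (UNIV :: unit set)"
  have U: "sigma_finite_measure ?U" by (rule sigma_finite_measure_count_space_finite) simp
  interpret U: sigma_finite_measure ?U by (rule U)
  have distr: "distr (lborel \<Otimes>\<^sub>M ?U) borel fst = (lborel :: (real \<times> real) measure)"
  proof (rule measure_eqI)
    fix A :: "(real \<times> real) set" assume "A \<in> sets (distr (lborel \<Otimes>\<^sub>M ?U) borel fst)"
    then have A: "A \<in> sets borel" by simp
    have "fst -` A \<inter> space (lborel \<Otimes>\<^sub>M ?U) = A \<times> (UNIV :: unit set)"
      by (auto simp: space_pair_measure)
    then show "emeasure (distr (lborel \<Otimes>\<^sub>M ?U) borel fst) A = emeasure lborel A"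
      using A by (subst emeasure_distr) (auto simp: U.emeasure_pair_measure_Times)
  qed simp
  show "frequency_splitting_window ?U fst (\<lambda>\<xi> :: real \<times> real. \<xi>) (\<lambda>_. ()) (\<lambda>_ _. 0) (\<lambda>_. 1) (\<lambda>_. 1)"
    using distr by unfold_locales (auto simp: lebesgue_integral_count_space_finite integrable_count_space)
qed

lemma trace_norm_eq_fibre_energy:
  assumes f: "C1_on_plane f"
    and F0: "integrable lebesgue (\<lambda>\<xi>. chi \<xi> * \<sigma> \<xi> * fourier \<phi> \<xi>)"
  shows "L2_norm_squared (\<lambda>(t, y). propagator chi \<sigma> f (\<lambda>\<xi>. \<xi>) t \<phi> (x, y)) = plane.fibre_energy chi \<sigma> f \<phi> x ()"
proof -
  note [measurable (raw)] = plane.propagator_measurable[OF f F0]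
  show ?thesis
    unfolding L2_norm_squared_def plane.fibre_energy_def lborel_prod[symmetric]
    by (subst lborel.nn_integral_fst[symmetric]) (simp_all add: split_beta')
qed

lemma trace_norm_le:
  assumes f: "C1_on_plane f" and g: "C1_on_plane g"
    and mono_f: "monotone_fibres (supp chi) f"
    and mono_g: "monotone_fibres (supp chi) g"
    and A: "A > 0" and cmp: "symbol_comparison chi \<sigma> \<tau> f g A"
    and adm: "admissible_datum chi \<sigma> \<tau> f g (\<lambda>\<xi>. \<xi>) \<phi>"
  shows "trace_norm chi \<sigma> f \<phi> x \<le> ennreal A * trace_norm chi \<tau> g \<phi> x'"
proof -
  have F0: "integrable lebesgue (\<lambda>\<xi>. chi \<xi> * \<sigma> \<xi> * fourier \<phi> \<xi>)"
    and G0: "integrable lebesgue (\<lambda>\<xi>. chi \<xi> * \<tau> \<xi> * fourier \<phi> \<xi>)"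
    using adm by (auto simp: admissible_datum_def)
  show ?thesis
    unfolding trace_norm_def L2_norm_le_iff[OF A] trace_norm_eq_fibre_energy[OF f F0] trace_norm_eq_fibre_energy[OF g G0]
    using A by (intro plane.fibre_energy_le_if_symbol_comparison[OF f g mono_f mono_g adm cmp]) auto
qed

lemma symbol_comparison_if_trace_norm_le:
  assumes f: "C1_on_plane f" and g: "C1_on_plane g"
    and mono_f: "monotone_fibres (supp chi) f"
    and mono_g: "monotone_fibres (supp chi) g"
    and chi: "continuous_on UNIV chi" and \<sigma>: "continuous_on UNIV \<sigma>" and \<tau>: "continuous_on UNIV \<tau>"
    and A: "A > 0"
    and le: "\<And>\<phi>. admissible_datum chi \<sigma> \<tau> f g (\<lambda>\<xi>. \<xi>) \<phi> \<Longrightarrow>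
       trace_norm chi \<sigma> f \<phi> x < \<infinity> \<Longrightarrow> trace_norm chi \<tau> g \<phi> x' < \<infinity> \<Longrightarrow>
       trace_norm chi \<sigma> f \<phi> x \<le> ennreal A * trace_norm chi \<tau> g \<phi> x'"
  shows "symbol_comparison chi \<sigma> \<tau> f g A"
proof (rule ccontr)
  assume viol: "\<not> symbol_comparison chi \<sigma> \<tau> f g A"
  obtain \<phi> \<rho> where \<rho>: "\<rho> > 1" and adm: "admissible_datum chi \<sigma> \<tau> f g (\<lambda>\<xi>. \<xi>) \<phi>"
    and en: "0 < plane.fibre_energy chi \<sigma> f \<phi> x ()" "plane.fibre_energy chi \<sigma> f \<phi> x () < \<infinity>"
      "plane.fibre_energy chi \<tau> g \<phi> x' () \<le> ennreal ((1 / (\<rho> * A))\<^sup>2) * plane.fibre_energy chi \<sigma> f \<phi> x ()"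
    using plane.exists_violating_datum[OF f g mono_f mono_g chi \<sigma> \<tau> A viol] by fastforce
  have F0: "integrable lebesgue (\<lambda>\<xi>. chi \<xi> * \<sigma> \<xi> * fourier \<phi> \<xi>)"
    and G0: "integrable lebesgue (\<lambda>\<xi>. chi \<xi> * \<tau> \<xi> * fourier \<phi> \<xi>)"
    using adm by (auto simp: admissible_datum_def)
  have "plane.fibre_energy chi \<tau> g \<phi> x' () < \<infinity>"
    using en by (auto intro: le_less_trans simp: ennreal_mult_less_top)
  then have "trace_norm chi \<sigma> f \<phi> x \<le> ennreal A * trace_norm chi \<tau> g \<phi> x'"
    using en by (intro le[OF adm])
      (simp_all only: trace_norm_def L2_norm_finite_iff trace_norm_eq_fibre_energy[OF f F0] trace_norm_eq_fibre_energy[OF g G0])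
  then have "plane.fibre_energy chi \<sigma> f \<phi> x () \<le> ennreal (A\<^sup>2) * plane.fibre_energy chi \<tau> g \<phi> x' ()"
    unfolding trace_norm_def L2_norm_le_iff[OF A] trace_norm_eq_fibre_energy[OF f F0] trace_norm_eq_fibre_energy[OF g G0] .
  from no_finite_positive_contraction[OF this en(3,1,2) \<rho> A] show False .
qed

section \<open>The weighted norm\<close>

definition split_join :: "'n::finite \<Rightarrow> 'n \<Rightarrow> (real \<times> real) \<times> ('n \<Rightarrow> real) \<Rightarrow> real ^ 'n" where
  "split_join j k w = (\<chi> i. if i = j then fst (fst w) else if i = k then snd (fst w) else snd w i)"

abbreviation other_coords :: "'n::finite \<Rightarrow> 'n \<Rightarrow> ('n \<Rightarrow> real) measure" where
  "other_coords j k \<equiv> Pi\<^sub>M (- {j, k}) (\<lambda>_. lborel)"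

interpretation lborel_PiM: product_sigma_finite "\<lambda>_. lborel :: real measure"
  by unfold_locales

lemma prod_split_two:
  fixes F :: "'n::finite \<Rightarrow> 'b::comm_monoid_mult"
  assumes "j \<noteq> k"
  shows "(\<Prod>i\<in>UNIV. F i) = F j * (F k * (\<Prod>i\<in>- {j, k}. F i))"
proof -
  have "prod F UNIV = prod F (insert j (insert k (- {j, k})))"
    by (rule arg_cong[where f="prod F"]) auto
  also have "\<dots> = F j * prod F (insert k (- {j, k}))"
    using assms by (intro prod.insert) auto
  also have "prod F (insert k (- {j, k})) = F k * prod F (- {j, k})"
    by (intro prod.insert) auto
  finally show ?thesis .
qed

lemma sum_split_two:
  fixes F :: "'n::finite \<Rightarrow> 'b::comm_monoid_add"
  assumes "j \<noteq> k"
  shows "(\<Sum>i\<in>UNIV. F i) = F j + (F k + (\<Sum>i\<in>- {j, k}. F i))"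
proof -
  have "sum F UNIV = sum F (insert j (insert k (- {j, k})))"
    by (rule arg_cong[where f="sum F"]) auto
  also have "\<dots> = F j + sum F (insert k (- {j, k}))"
    using assms by (intro sum.insert) auto
  also have "sum F (insert k (- {j, k})) = F k + sum F (- {j, k})"
    by (intro sum.insert) auto
  finally show ?thesis .
qed

lemma vec_nth_borel_measurable: "(\<lambda>x :: real ^ 'n. x $ i) \<in> borel_measurable borel"
  by (intro borel_measurable_continuous_onI continuous_intros)

lemma split_join_measurable:
  fixes j k :: "'n::finite"
  shows "split_join j k \<in> borel_measurable (lborel \<Otimes>\<^sub>M other_coords j k)"
proof -
  have comp: "(\<lambda>w. split_join j k w \<bullet> axis i 1) \<in> borel_measurable (lborel \<Otimes>\<^sub>M other_coords j k)" for i
  proof -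
    have [measurable]: "(fst :: real \<times> real \<Rightarrow> real) \<in> borel_measurable lborel"
      "(snd :: real \<times> real \<Rightarrow> real) \<in> borel_measurable lborel"
      by (simp_all, (intro borel_measurable_continuous_onI continuous_intros)+)
    consider "i = j" | "i \<noteq> j" "i = k" | "i \<noteq> j" "i \<noteq> k" by blast
    then show ?thesis
    proof cases
      case 1
      then have "(\<lambda>w. split_join j k w \<bullet> axis i 1) = (\<lambda>w. fst (fst w))"
        by (intro ext) (simp add: split_join_def inner_axis)
      then show ?thesis by (simp only:) measurable
    next
      case 2
      then have "(\<lambda>w. split_join j k w \<bullet> axis i 1) = (\<lambda>w. snd (fst w))"
        by (intro ext) (simp add: split_join_def inner_axis)
      then show ?thesis by (simp only:) measurable
    next
      case 3
      then have "(\<lambda>w. split_join j k w \<bullet> axis i 1) = (\<lambda>w. snd w i)"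
        by (intro ext) (simp add: split_join_def inner_axis)
      moreover have "(\<lambda>m. m i) \<in> borel_measurable (other_coords j k)"
        using measurable_component_singleton[of i "- {j, k}" "\<lambda>_. lborel :: real measure"] 3 by simp
      then have "(\<lambda>w :: (real \<times> real) \<times> ('n \<Rightarrow> real). snd w i) \<in> borel_measurable (lborel \<Otimes>\<^sub>M other_coords j k)"
        by (rule measurable_compose[OF measurable_snd])
      ultimately show ?thesis by (simp only:)
    qed
  qed
  show ?thesis
    by (subst borel_measurable_euclidean_space) (auto simp: Basis_vec_def comp)
qed

text \<open>
  Lebesgue measure is determined by the volumes of boxes, and the preimage of a box is a product
  of intervals.
\<close>

lemma distr_split_join:
  assumes jk: "j \<noteq> k"
  shows "distr (lborel \<Otimes>\<^sub>M other_coords j k) borel (split_join j k) = (lborel :: (real ^ 'n::finite) measure)"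
proof (rule sym, rule lborel_eqI)
  let ?O = "other_coords j k"
  interpret O: finite_product_sigma_finite "\<lambda>_. lborel :: real measure" "- {j, k}" by unfold_locales simp
  fix l u :: "real ^ 'n"
  assume basis: "\<And>b. b \<in> Basis \<Longrightarrow> l \<bullet> b \<le> u \<bullet> b"
  have le: "l $ i \<le> u $ i" for i
    using basis[of "axis i 1"] by (simp add: axis_in_Basis_iff inner_axis)
  let ?B = "{l $ j<..<u $ j} \<times> {l $ k<..<u $ k}" and ?P = "\<Pi>\<^sub>E i\<in>- {j, k}. {l $ i<..<u $ i}"
  have P: "?P \<in> sets ?O" by (intro sets_PiM_I_finite) auto
  have all: "(\<forall>i. P i) \<longleftrightarrow> P j \<and> P k \<and> (\<forall>i\<in>- {j, k}. P i)" for P :: "'n \<Rightarrow> bool"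
    by blast
  have mem: "split_join j k ((a, y), m) \<in> box l u \<longleftrightarrow>
      (l $ j < a \<and> a < u $ j) \<and> (l $ k < y \<and> y < u $ k) \<and> (\<forall>i\<in>- {j, k}. l $ i < m i \<and> m i < u $ i)" for a y m
    unfolding mem_box_cart by (subst all) (use jk in \<open>simp add: split_join_def\<close>)
  have "split_join j k -` box l u \<inter> space (lborel \<Otimes>\<^sub>M ?O) = ?B \<times> ?P"
  proof (rule set_eqI)
    fix w :: "(real \<times> real) \<times> ('n \<Rightarrow> real)"
    show "w \<in> split_join j k -` box l u \<inter> space (lborel \<Otimes>\<^sub>M ?O) \<longleftrightarrow> w \<in> ?B \<times> ?P"
      by (cases w; cases "fst w") (simp add: mem space_pair_measure space_PiM PiE_iff conj_ac)
  qed
  then have "emeasure (distr (lborel \<Otimes>\<^sub>M ?O) borel (split_join j k)) (box l u) = emeasure lborel ?B * emeasure ?O ?P"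
    by (subst emeasure_distr[OF split_join_measurable])
       (use P in \<open>simp_all add: O.emeasure_pair_measure_Times borel_open open_Times\<close>)
  also have "emeasure lborel ?B = ennreal ((u $ j - l $ j) * (u $ k - l $ k))"
    using le unfolding lborel_prod[symmetric]
    by (subst lborel.emeasure_pair_measure_Times) (simp_all add: ennreal_mult)
  also have "emeasure ?O ?P = (\<Prod>i\<in>- {j, k}. ennreal (u $ i - l $ i))"
    using le by (subst O.measure_times) auto
  also have "\<dots> = ennreal (\<Prod>i\<in>- {j, k}. u $ i - l $ i)"
    using le by (intro prod_ennreal) simp
  also have "ennreal ((u $ j - l $ j) * (u $ k - l $ k)) * \<dots> = ennreal (\<Prod>i\<in>UNIV. u $ i - l $ i)"
    using le by (subst prod_split_two[OF jk]) (simp add: mult.assoc prod_nonneg flip: ennreal_mult)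
  also have "(\<Prod>i\<in>UNIV. u $ i - l $ i) = (\<Prod>b\<in>Basis. (u - l) \<bullet> b)"
  proof -
    have inj: "inj (\<lambda>i::'n. axis i (1::real))" by (auto simp: inj_on_def axis_eq_axis)
    have B: "(Basis :: (real ^ 'n) set) = range (\<lambda>i. axis i 1)" by (auto simp: Basis_vec_def)
    show ?thesis unfolding B prod.reindex[OF inj] by (simp add: inner_axis)
  qed
  finally show "emeasure (distr (lborel \<Otimes>\<^sub>M ?O) borel (split_join j k)) (box l u) = ennreal (\<Prod>b\<in>Basis. (u - l) \<bullet> b)" .
qed simp

definition gauss_window :: "'n set \<Rightarrow> ('n \<Rightarrow> real) \<Rightarrow> complex" where
  "gauss_window I m = (\<Prod>i\<in>I. of_real (std_normal_density (m i)))"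

definition gauss_window_transform :: "'n set \<Rightarrow> ('n \<Rightarrow> real) \<Rightarrow> complex" where
  "gauss_window_transform I m = (\<Prod>i\<in>I. of_real (exp (- (m i)\<^sup>2 / 2)))"

text \<open>
  The window is the standard Gaussian in every remaining variable. It is a product, so its
  transform and the transform of that are products of the one-dimensional ones, which are again
  Gaussians and vanish nowhere.
\<close>

lemma splitting_vec:
  assumes jk: "j \<noteq> k"
  shows "frequency_splitting_window (other_coords j k) (split_join j k) (freq_pair j k)
    (\<lambda>x :: real ^ 'n::finite. restrict (\<lambda>i. x $ i) (- {j, k})) (\<lambda>m m'. \<Sum>i\<in>- {j, k}. m i * m' i)
    (gauss_window (- {j, k})) (gauss_window_transform (- {j, k}))"
proof -
  let ?O = "other_coords j k" and ?I = "- {j, k}"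
  interpret O: finite_product_sigma_finite "\<lambda>_. lborel :: real measure" "- {j, k}" by unfold_locales simp
  have n_int: "integrable lborel (\<lambda>x. complex_of_real (std_normal_density x))"
    using integrable_normal_density[of 1 0] by (simp only: complex_of_real_integrable_eq zero_less_one)
  have n_int_iexp: "integrable lborel (\<lambda>x. iexp (s * x) * complex_of_real (std_normal_density x))" for s
    by (rule Bochner_Integration.integrable_bound[OF n_int]) (auto simp: norm_mult)
  have n2_int: "integrable lborel (\<lambda>x. (std_normal_density x)\<^sup>2)"
  proof (rule Bochner_Integration.integrable_bound[of _ std_normal_density])
    show "AE x in lborel. norm ((std_normal_density x)\<^sup>2) \<le> norm (std_normal_density x)"
      using mult_left_mono[OF std_normal_density_le_1 normal_density_nonneg] by (auto simp: power2_eq_square)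
  qed (auto intro: integrable_normal_density)
  have gauss_eq: "exp (- x\<^sup>2 / 2) = sqrt (2 * pi) * std_normal_density x" for x
    by (simp add: std_normal_density_def)
  have e_int: "integrable lborel (\<lambda>x. complex_of_real (exp (- x\<^sup>2 / 2)))"
    unfolding gauss_eq of_real_mult by (intro integrable_mult_right n_int)
  have e_int_iexp: "integrable lborel (\<lambda>x. iexp (s * x) * complex_of_real (exp (- x\<^sup>2 / 2)))" for s
    by (rule Bochner_Integration.integrable_bound[OF e_int]) (auto simp: norm_mult)
  have e_fourier: "(LINT x|lborel. iexp (s * x) * complex_of_real (exp (- x\<^sup>2 / 2))) \<noteq> 0" for s
  proof -
    have "(LINT x|lborel. iexp (s * x) * complex_of_real (exp (- x\<^sup>2 / 2))) =
       (LINT x|lborel. of_real (sqrt (2 * pi)) * (iexp (s * x) * complex_of_real (std_normal_density x)))"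
      unfolding gauss_eq of_real_mult by (simp only: mult_ac)
    also have "\<dots> = of_real (sqrt (2 * pi)) * of_real (exp (- s\<^sup>2 / 2))"
      unfolding integral_mult_right_zero fourier_std_normal ..
    finally show ?thesis by simp
  qed
  have iexp_sum: "iexp (\<Sum>i\<in>?I. a i) = (\<Prod>i\<in>?I. iexp (a i))" for a :: "'n \<Rightarrow> real"
    by (simp add: sum_distrib_left exp_sum)
  show ?thesis
  proof unfold_locales
    show "split_join j k \<in> borel_measurable (lborel \<Otimes>\<^sub>M ?O)" by (rule split_join_measurable)
    show "distr (lborel \<Otimes>\<^sub>M ?O) borel (split_join j k) = lborel" by (rule distr_split_join[OF jk])
    show "freq_pair j k \<in> borel_measurable borel"
      unfolding freq_pair_def[abs_def] by (intro borel_measurable_continuous_onI continuous_intros)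
    show "(\<lambda>x :: real ^ 'n. restrict (\<lambda>i. x $ i) ?I) \<in> measurable borel ?O"
      by (intro measurable_restrict) (simp add: vec_nth_borel_measurable)
    show "freq_pair j k (split_join j k (z, m)) = z" for z m
      using jk by (simp add: freq_pair_def split_join_def)
    show "restrict (\<lambda>i. split_join j k (z, m) $ i) ?I = m" if "m \<in> space ?O" for z m
      using that by (auto simp: split_join_def space_PiM PiE_def extensional_def restrict_def fun_eq_iff)
    show "split_join j k (freq_pair j k x, restrict (\<lambda>i. x $ i) ?I) = x" for x
      by (simp add: split_join_def freq_pair_def vec_eq_iff)
    show "x \<bullet> \<xi> = freq_pair j k x \<bullet> freq_pair j k \<xi> + (\<Sum>i\<in>?I. restrict (\<lambda>i. x $ i) ?I i * restrict (\<lambda>i. \<xi> $ i) ?I i)" for x \<xi>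
      unfolding inner_vec_def sum_split_two[OF jk] by (simp add: freq_pair_def)
    show "(\<lambda>(m, m'). \<Sum>i\<in>?I. m i * m' i) \<in> borel_measurable (?O \<Otimes>\<^sub>M ?O)"
      by measurable
    show "integrable ?O (gauss_window ?I)"
      unfolding gauss_window_def[abs_def] by (intro lborel_PiM.product_integrable_prod n_int) simp
    have "(\<lambda>m. (norm (gauss_window ?I m))\<^sup>2) = (\<lambda>m. \<Prod>i\<in>?I. (std_normal_density (m i))\<^sup>2)"
      by (simp add: gauss_window_def fun_eq_iff prod_power_distrib flip: prod_norm)
    then show "integrable ?O (\<lambda>m. (norm (gauss_window ?I m))\<^sup>2)"
      by (simp only:) (intro lborel_PiM.product_integrable_prod[where f="\<lambda>_ x. (std_normal_density x)\<^sup>2"] n2_int, simp)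
    show "integrable ?O (gauss_window_transform ?I)"
      unfolding gauss_window_transform_def[abs_def]
      by (intro lborel_PiM.product_integrable_prod[where f="\<lambda>_ x. complex_of_real (exp (- x\<^sup>2 / 2))"] e_int) simp
    fix m assume m: "m \<in> space ?O"
    show "(LINT m'|(?O). iexp (- (\<Sum>i\<in>?I. m' i * m i)) * gauss_window ?I m') = gauss_window_transform ?I m"
    proof -
      have "(LINT m'|(?O). iexp (- (\<Sum>i\<in>?I. m' i * m i)) * gauss_window ?I m') =
        (LINT m'|(?O). (\<Prod>i\<in>?I. iexp (- m i * m' i) * of_real (std_normal_density (m' i))))"
        unfolding sum_negf[symmetric] iexp_sum gauss_window_def prod.distrib[symmetric]
        by (simp add: mult.commute)
      also have "\<dots> = (\<Prod>i\<in>?I. LINT x|lborel. iexp (- m i * x) * of_real (std_normal_density x))"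
        by (rule lborel_PiM.product_integral_prod[where f="\<lambda>i x. iexp (- m i * x) * of_real (std_normal_density x)"])
          (simp, rule n_int_iexp)
      finally show ?thesis unfolding fourier_std_normal by (simp add: gauss_window_transform_def)
    qed
    show "(LINT m'|(?O). iexp (\<Sum>i\<in>?I. m i * m' i) * gauss_window_transform ?I m') \<noteq> 0"
    proof -
      have "(LINT m'|(?O). iexp (\<Sum>i\<in>?I. m i * m' i) * gauss_window_transform ?I m') =
        (LINT m'|(?O). (\<Prod>i\<in>?I. iexp (m i * m' i) * of_real (exp (- (m' i)\<^sup>2 / 2))))"
        unfolding iexp_sum gauss_window_transform_def prod.distrib[symmetric] ..
      also have "\<dots> = (\<Prod>i\<in>?I. LINT x|lborel. iexp (m i * x) * of_real (exp (- x\<^sup>2 / 2)))"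
        by (rule lborel_PiM.product_integral_prod[where f="\<lambda>i x. iexp (m i * x) * of_real (exp (- x\<^sup>2 / 2))"])
          (simp, rule e_int_iexp)
      finally show ?thesis using e_fourier by simp
    qed
  qed
qed

lemma omit_coord_split_join:
  assumes "j \<noteq> k" "m \<in> space (other_coords j k)"
  shows "omit_coord k (split_join j k (z, m)) = m(j := fst z)"
  using assms by (auto simp: omit_coord_def split_join_def space_PiM PiE_def extensional_def restrict_def fun_eq_iff)

lemma omit_coord_measurable:
  "omit_coord k \<in> measurable borel (Pi\<^sub>M (- {k :: 'n::finite}) (\<lambda>_. lborel))"
  unfolding omit_coord_def[abs_def]
  by (intro measurable_restrict) (simp add: vec_nth_borel_measurable)

lemma insert_other_coords: "j \<noteq> k \<Longrightarrow> insert j (- {j, k}) = - {k}"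
  by auto

lemma nn_integral_omit:
  assumes jk: "j \<noteq> k" and F: "F \<in> borel_measurable (Pi\<^sub>M (- {k}) (\<lambda>_. lborel))"
  shows "(\<integral>\<^sup>+v. F v \<partial>Pi\<^sub>M (- {k :: 'n::finite}) (\<lambda>_. lborel)) =
     (\<integral>\<^sup>+m. \<integral>\<^sup>+a. F (m(j := a)) \<partial>lborel \<partial>other_coords j k)"
  using lborel_PiM.product_nn_integral_insert[of "- {j, k}" j F] F
  unfolding insert_other_coords[OF jk] by simp

lemma fun_upd_measurable [measurable]:
  assumes "j \<noteq> k"
  shows "(\<lambda>w. (snd w)(j := fst w)) \<in> measurable (lborel \<Otimes>\<^sub>M other_coords j k) (Pi\<^sub>M (- {k :: 'n::finite}) (\<lambda>_. lborel))"
  using measurable_add_dim[of j "- {j, k}" "\<lambda>_. lborel :: real measure"]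
    measurable_compose[OF measurable_pair_swap' measurable_add_dim[of j "- {j, k}" "\<lambda>_. lborel :: real measure"]]
  unfolding insert_other_coords[OF assms] by (simp add: split_beta')

text \<open>
  The weight is determined up to null sets of \<open>\<real>\<^sup>n\<^sup>-\<^sup>1\<close>.
  Their preimages in \<open>\<real>\<^sup>n\<close> are null, so a Borel version of the weight may
  be used in the norm.
\<close>

lemma AE_omit_coord:
  assumes jk: "j \<noteq> k" and ae: "AE v in Pi\<^sub>M (- {k :: 'n::finite}) (\<lambda>_. lborel). P v"
  shows "AE x in lborel. P (omit_coord k x)"
proof -
  interpret S: frequency_splitting_window "other_coords j k" "split_join j k" "freq_pair j k"
    "\<lambda>x :: real ^ 'n. restrict (\<lambda>i. x $ i) (- {j, k})" "\<lambda>m m'. \<Sum>i\<in>- {j, k}. m i * m' i"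
    "gauss_window (- {j, k})" "gauss_window_transform (- {j, k})"
    by (rule splitting_vec[OF jk])
  let ?V = "Pi\<^sub>M (- {k}) (\<lambda>_. lborel :: real measure)"
  obtain N where N: "{v \<in> space ?V. \<not> P v} \<subseteq> N" "emeasure ?V N = 0" "N \<in> sets ?V"
    using ae by (rule AE_E)
  note N(3) [measurable]
  note [measurable] = omit_coord_measurable[of k]
  have upd: "(\<lambda>a. m(j := a)) \<in> measurable lborel ?V" if "m \<in> space (other_coords j k)" for m
    using measurable_compose[OF measurable_Pair2'[OF that] fun_upd_measurable[OF jk]] by simp
  note [measurable] = fun_upd_measurable[OF jk]
  have "(\<integral>\<^sup>+m. \<integral>\<^sup>+a. indicator N (m(j := a)) \<partial>lborel \<partial>other_coords j k) = (0::ennreal)"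
    using nn_integral_omit[OF jk, of "indicator N"] N(2) by simp
  then have "AE m in other_coords j k. (\<integral>\<^sup>+a. indicator N (m(j := a)) \<partial>lborel) = (0::ennreal)"
  proof (subst (asm) nn_integral_0_iff_AE)
    have "(\<lambda>(m, a). indicator N (m(j := a)) :: ennreal) \<in> borel_measurable (other_coords j k \<Otimes>\<^sub>M lborel)"
      unfolding split_beta' using measurable_compose[OF measurable_pair_swap' fun_upd_measurable[OF jk]]
      by (simp add: split_beta')
    then show "(\<lambda>m. \<integral>\<^sup>+a. indicator N (m(j := a)) \<partial>lborel) \<in> borel_measurable (other_coords j k)"
      by measurable
  qed
  then have zero: "AE m in other_coords j k. (\<integral>\<^sup>+z. indicator N (m(j := fst z)) \<partial>(lborel :: (real \<times> real) measure)) = (0::ennreal)"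
    using AE_space
  proof eventually_elim
    case (elim m)
    note [measurable] = upd[OF elim(2)]
    have "(\<integral>\<^sup>+z. indicator N (m(j := fst z)) \<partial>(lborel :: (real \<times> real) measure)) =
       (\<integral>\<^sup>+y. \<integral>\<^sup>+a. indicator N (m(j := a)) \<partial>lborel \<partial>(lborel :: real measure))"
      unfolding lborel_prod[symmetric] by (subst lborel_pair.nn_integral_snd[symmetric]) simp_all
    then show ?case using elim(1) by simp
  qed
  have "(\<integral>\<^sup>+x. indicator N (omit_coord k x) \<partial>lborel) =
      (\<integral>\<^sup>+m. \<integral>\<^sup>+z. indicator N (omit_coord k (split_join j k (z, m))) \<partial>lborel \<partial>other_coords j k)"
    by (rule S.nn_integral_split) measurable
  also have "\<dots> = (\<integral>\<^sup>+m. \<integral>\<^sup>+z. indicator N (m(j := fst z)) \<partial>(lborel :: (real \<times> real) measure) \<partial>other_coords j k)"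
    by (intro nn_integral_cong) (simp add: omit_coord_split_join[OF jk])
  also have "\<dots> = (\<integral>\<^sup>+m. 0 \<partial>other_coords j k)"
    by (rule nn_integral_cong_AE[OF zero])
  also have "\<dots> = 0" by simp
  finally have "AE x in lborel. indicator N (omit_coord k x) = (0::ennreal)"
    by (subst (asm) nn_integral_0_iff_AE) auto
  then show ?thesis
    by eventually_elim (use N(1) measurable_space[of "omit_coord k" borel ?V] in \<open>auto simp: indicator_eq_0_iff\<close>)
qed

abbreviation vec_energy ::
    "'n::finite \<Rightarrow> 'n \<Rightarrow> (real \<times> real \<Rightarrow> complex) \<Rightarrow> (real \<times> real \<Rightarrow> complex) \<Rightarrow> (real \<times> real \<Rightarrow> real) \<Rightarrow>
     (real ^ 'n \<Rightarrow> complex) \<Rightarrow> real \<Rightarrow> ('n \<Rightarrow> real) \<Rightarrow> ennreal" where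
  "vec_energy j k \<equiv> frequency_splitting.fibre_energy (split_join j k) (freq_pair j k)"

lemma AE_lborel_snd:
  assumes "AE x in (lborel :: 'b::euclidean_space measure). P x"
  shows "AE z in (lborel :: ('a::euclidean_space \<times> 'b) measure). P (snd z)"
proof -
  obtain N where N: "N \<in> null_sets (lborel :: 'b measure)" "{x \<in> space (lborel :: 'b measure). \<not> P x} \<subseteq> N"
    using assms unfolding eventually_ae_filter by auto
  have "UNIV \<times> N \<in> null_sets ((lborel :: 'a measure) \<Otimes>\<^sub>M (lborel :: 'b measure))"
    using N by (intro lborel.times_in_null_sets2) auto
  then have "AE z in (lborel :: ('a \<times> 'b) measure). z \<notin> UNIV \<times> N"
    unfolding lborel_prod by (rule AE_not_in)
  then show ?thesis
    by (rule AE_mp) (use N(2) in \<open>auto intro!: AE_I2\<close>)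
qed

text \<open>
  The weight depends neither on \<open>t\<close> nor on the coordinate \<open>k\<close>, so it can
  be taken out of the integral over these two variables, which is the fibre energy.
\<close>

lemma weighted_norm_squared_eq:
  fixes j k :: "'n::finite" and w w' :: "('n \<Rightarrow> real) \<Rightarrow> complex"
  assumes jk: "j \<noteq> k" and f: "C1_on_plane f"
    and F0: "integrable lebesgue (\<lambda>\<xi>. chi (freq_pair j k \<xi>) * \<sigma> (freq_pair j k \<xi>) * fourier \<phi> \<xi>)"
    and w': "w' \<in> borel_measurable (Pi\<^sub>M (- {k}) (\<lambda>_. lborel))"
    and ae: "AE v in Pi\<^sub>M (- {k}) (\<lambda>_. lborel). w v = w' v"
  shows "L2_norm_squared (\<lambda>(t :: real, x). w (omit_coord k x) * propagator chi \<sigma> f (freq_pair j k) t \<phi> x) =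
    (\<integral>\<^sup>+v. ennreal ((norm (w' ((snd v)(j := fst v))))\<^sup>2) * vec_energy j k chi \<sigma> f \<phi> (fst v) (snd v)
      \<partial>(lborel \<Otimes>\<^sub>M other_coords j k))"
proof -
  interpret S: frequency_splitting_window "other_coords j k" "split_join j k" "freq_pair j k"
    "\<lambda>x :: real ^ 'n. restrict (\<lambda>i. x $ i) (- {j, k})" "\<lambda>m m'. \<Sum>i\<in>- {j, k}. m i * m' i"
    "gauss_window (- {j, k})" "gauss_window_transform (- {j, k})"
    by (rule splitting_vec[OF jk])
  interpret Q: pair_sigma_finite "lborel :: real measure" "other_coords j k"
    by unfold_locales
  have energy: "(\<lambda>v. vec_energy j k chi \<sigma> f \<phi> (fst v) (snd v)) \<in> borel_measurable (lborel \<Otimes>\<^sub>M other_coords j k)"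
    using S.fibre_energy_measurable[OF f F0] by (simp cong: measurable_cong_sets)
  note [measurable] = energy fun_upd_measurable[OF jk]
  let ?P = "\<lambda>t x. propagator chi \<sigma> f (freq_pair j k) t \<phi> x"
  define c where "c v = ennreal ((norm (w' v))\<^sup>2)" for v
  define D where "D x = (\<integral>\<^sup>+t. ennreal ((norm (?P t x))\<^sup>2) \<partial>lborel)" for x
  note [measurable (raw)] = S.propagator_measurable[OF f F0]
  note [measurable] = w' omit_coord_measurable
  have c [measurable]: "c \<in> borel_measurable (Pi\<^sub>M (- {k}) (\<lambda>_. lborel))"
    unfolding c_def[abs_def] by measurable
  have D [measurable]: "D \<in> borel_measurable borel"
    unfolding D_def[abs_def] by measurable
  have "L2_norm_squared (\<lambda>(t :: real, x). w (omit_coord k x) * ?P t x) =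
     (\<integral>\<^sup>+z. c (omit_coord k (snd z)) * ennreal ((norm (?P (fst z) (snd z)))\<^sup>2) \<partial>(lborel \<Otimes>\<^sub>M lborel))"
    unfolding L2_norm_squared_def lborel_prod
  proof (rule nn_integral_cong_AE)
    show "AE z in lborel. ennreal ((norm (case z of (t :: real, x) \<Rightarrow> w (omit_coord k x) * ?P t x))\<^sup>2) =
       c (omit_coord k (snd z)) * ennreal ((norm (?P (fst z) (snd z)))\<^sup>2)"
      using AE_lborel_snd[OF AE_omit_coord[OF jk ae]]
      by eventually_elim (simp add: split_beta' norm_mult power_mult_distrib ennreal_mult c_def)
  qed
  also have "\<dots> = (\<integral>\<^sup>+x. \<integral>\<^sup>+t. c (omit_coord k x) * ennreal ((norm (?P t x))\<^sup>2) \<partial>lborel \<partial>lborel)"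
    by (subst lborel_pair.nn_integral_snd[symmetric]) simp_all
  also have "\<dots> = (\<integral>\<^sup>+x. c (omit_coord k x) * D x \<partial>lborel)"
    unfolding D_def by (intro nn_integral_cong nn_integral_cmult) measurable
  also have "\<dots> = (\<integral>\<^sup>+m. \<integral>\<^sup>+z. c (omit_coord k (split_join j k (z, m))) * D (split_join j k (z, m)) \<partial>lborel \<partial>other_coords j k)"
    by (rule S.nn_integral_split) measurable
  also have "\<dots> = (\<integral>\<^sup>+m. \<integral>\<^sup>+a. c (m(j := a)) * vec_energy j k chi \<sigma> f \<phi> a m \<partial>lborel \<partial>other_coords j k)"
  proof (rule nn_integral_cong)
    fix m assume m: "m \<in> space (other_coords j k)"
    have cm: "(\<lambda>a. c (m(j := a))) \<in> borel_measurable lborel"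
      using measurable_compose[OF measurable_compose[OF measurable_Pair2'[OF m] fun_upd_measurable[OF jk]] c] by simp
    have Tm: "(\<lambda>z. split_join j k (z, m)) \<in> borel_measurable borel"
      by (rule measurable_compose[OF measurable_Pair2'[OF m] S.T_measurable'])
    have eq: "borel_measurable (lborel \<Otimes>\<^sub>M lborel) = (borel_measurable borel :: (real \<times> real \<Rightarrow> real ^ 'n) set)"
      by (rule measurable_cong_sets) (simp_all only: lborel_prod sets_lborel)
    have Tm': "(\<lambda>z. split_join j k (z, m)) \<in> borel_measurable (lborel \<Otimes>\<^sub>M lborel)"
      unfolding eq by (rule Tm)
    have Tma: "(\<lambda>y. split_join j k ((a, y), m)) \<in> borel_measurable lborel" for a
    proof -
      have "(\<lambda>y :: real. (a, y)) \<in> borel_measurable borel"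
        by (intro borel_measurable_continuous_onI continuous_intros)
      then have "(\<lambda>y :: real. (a, y)) \<in> borel_measurable lborel" by simp
      then show ?thesis by (rule measurable_compose[OF _ Tm])
    qed
    have meas: "(\<lambda>z. c (m(j := fst z)) * D (split_join j k (z, m))) \<in> borel_measurable (lborel \<Otimes>\<^sub>M lborel)"
      by (intro borel_measurable_times_ennreal measurable_compose[OF measurable_fst cm] measurable_compose[OF Tm' D])
    have "(\<integral>\<^sup>+z. c (omit_coord k (split_join j k (z, m))) * D (split_join j k (z, m)) \<partial>lborel) =
      (\<integral>\<^sup>+z. c (m(j := fst z)) * D (split_join j k (z, m)) \<partial>(lborel \<Otimes>\<^sub>M lborel))"
      by (simp only: lborel_prod omit_coord_split_join[OF jk m])
    also have "\<dots> = (\<integral>\<^sup>+a. \<integral>\<^sup>+y. c (m(j := a)) * D (split_join j k ((a, y), m)) \<partial>lborel \<partial>lborel)"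
      using lborel.nn_integral_fst[OF meas] by (simp only: fst_conv)
    also have "\<dots> = (\<integral>\<^sup>+a. c (m(j := a)) * vec_energy j k chi \<sigma> f \<phi> a m \<partial>lborel)"
    proof (rule nn_integral_cong)
      fix a :: real
      have P: "(\<lambda>u. ?P (fst u) (split_join j k ((a, snd u), m))) \<in> borel_measurable (lborel \<Otimes>\<^sub>M lborel)"
        by (rule S.propagator_measurable[OF f F0 measurable_fst[THEN measurable_compose, of _ lborel] measurable_compose[OF measurable_snd Tma]])
          simp
      have square: "(\<lambda>z :: complex. ennreal ((norm z)\<^sup>2)) \<in> borel_measurable borel" by measurable
      have P2: "(\<lambda>(t, y). ennreal ((norm (?P t (split_join j k ((a, y), m))))\<^sup>2)) \<in> borel_measurable (lborel \<Otimes>\<^sub>M lborel)"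
        unfolding split_beta' by (rule measurable_compose[OF P square])
      have "(\<integral>\<^sup>+y. c (m(j := a)) * D (split_join j k ((a, y), m)) \<partial>lborel) =
          c (m(j := a)) * (\<integral>\<^sup>+y. D (split_join j k ((a, y), m)) \<partial>lborel)"
        by (rule nn_integral_cmult[OF measurable_compose[OF Tma D]])
      also have "(\<integral>\<^sup>+y. D (split_join j k ((a, y), m)) \<partial>lborel) = vec_energy j k chi \<sigma> f \<phi> a m"
        unfolding D_def S.fibre_energy_def by (rule lborel_pair.Fubini'[OF P2])
      finally show "(\<integral>\<^sup>+y. c (m(j := a)) * D (split_join j k ((a, y), m)) \<partial>lborel) =
          c (m(j := a)) * vec_energy j k chi \<sigma> f \<phi> a m" .
    qed
    finally show "(\<integral>\<^sup>+z. c (omit_coord k (split_join j k (z, m))) * D (split_join j k (z, m)) \<partial>lborel) =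
      (\<integral>\<^sup>+a. c (m(j := a)) * vec_energy j k chi \<sigma> f \<phi> a m \<partial>lborel)" .
  qed
  also have "\<dots> = (\<integral>\<^sup>+v. ennreal ((norm (w' ((snd v)(j := fst v))))\<^sup>2) * vec_energy j k chi \<sigma> f \<phi> (fst v) (snd v)
      \<partial>(lborel \<Otimes>\<^sub>M other_coords j k))"
    unfolding c_def by (subst Q.nn_integral_snd[symmetric]) simp_all
  finally show ?thesis .
qed

text \<open>
  The energy is positive on all fibres, so a vanishing norm forces the weight to vanish almost
  everywhere as a function of the split coordinates. This carries the statement back to
  \<open>\<real>\<^sup>n\<^sup>-\<^sup>1\<close>.
\<close>

lemma AE_fun_upd_eq_0:
  fixes w' :: "('n::finite \<Rightarrow> real) \<Rightarrow> complex"
  assumes jk: "j \<noteq> k" and [measurable]: "w' \<in> borel_measurable (Pi\<^sub>M (- {k}) (\<lambda>_. lborel))"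
    and ae: "AE v in (lborel :: real measure) \<Otimes>\<^sub>M other_coords j k. w' ((snd v)(j := fst v)) = 0"
  shows "AE v in Pi\<^sub>M (- {k}) (\<lambda>_. lborel). w' v = 0"
proof -
  interpret O: finite_product_sigma_finite "\<lambda>_. lborel :: real measure" "- {j, k}" by unfold_locales simp
  interpret Q: pair_sigma_finite "lborel :: real measure" "other_coords j k"
    by unfold_locales
  note [measurable] = fun_upd_measurable[OF jk]
  have "(\<integral>\<^sup>+v. ennreal (norm (w' v)) \<partial>Pi\<^sub>M (- {k}) (\<lambda>_. lborel)) =
      (\<integral>\<^sup>+m. \<integral>\<^sup>+a. ennreal (norm (w' (m(j := a)))) \<partial>lborel \<partial>other_coords j k)"
    by (rule nn_integral_omit[OF jk]) measurable
  also have "\<dots> = (\<integral>\<^sup>+v. ennreal (norm (w' ((snd v)(j := fst v)))) \<partial>(lborel \<Otimes>\<^sub>M other_coords j k))"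
    by (subst Q.nn_integral_snd[symmetric]) simp_all
  also have "\<dots> = (\<integral>\<^sup>+v. 0 \<partial>((lborel :: real measure) \<Otimes>\<^sub>M other_coords j k))"
    using ae by (intro nn_integral_cong_AE) auto
  finally have "(\<integral>\<^sup>+v. ennreal (norm (w' v)) \<partial>Pi\<^sub>M (- {k}) (\<lambda>_. lborel)) = 0" by simp
  then have "AE v in Pi\<^sub>M (- {k}) (\<lambda>_. lborel). ennreal (norm (w' v)) = 0"
    by (subst (asm) nn_integral_0_iff_AE) auto
  then show ?thesis by eventually_elim (simp add: ennreal_eq_0_iff)
qed

lemma weighted_norm_le:
  fixes j k :: "'n::finite" and w :: "('n \<Rightarrow> real) \<Rightarrow> complex"
  assumes f: "C1_on_plane f" and g: "C1_on_plane g"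
    and mono_f: "monotone_fibres (supp chi) f"
    and mono_g: "monotone_fibres (supp chi) g"
    and A: "A > 0" and cmp: "symbol_comparison chi \<sigma> \<tau> f g A"
    and jk: "j \<noteq> k" and w: "w \<in> borel_measurable (lebesgue_omit k)"
    and adm: "admissible_datum chi \<sigma> \<tau> f g (freq_pair j k) \<phi>"
  shows "weighted_norm j k w chi \<sigma> f \<phi> \<le> ennreal A * weighted_norm j k w chi \<tau> g \<phi>"
proof -
  interpret S: frequency_splitting_window "other_coords j k" "split_join j k" "freq_pair j k"
    "\<lambda>x :: real ^ 'n. restrict (\<lambda>i. x $ i) (- {j, k})" "\<lambda>m m'. \<Sum>i\<in>- {j, k}. m i * m' i"
    "gauss_window (- {j, k})" "gauss_window_transform (- {j, k})"
    by (rule splitting_vec[OF jk])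
  let ?L = "(lborel :: real measure) \<Otimes>\<^sub>M other_coords j k"
  obtain w' where w': "w' \<in> borel_measurable (Pi\<^sub>M (- {k}) (\<lambda>_. lborel))"
    and ae: "AE v in Pi\<^sub>M (- {k}) (\<lambda>_. lborel). w v = w' v"
    using borel_version_complex w unfolding lebesgue_omit_def by blast
  have F0: "integrable lebesgue (\<lambda>\<xi>. chi (freq_pair j k \<xi>) * \<sigma> (freq_pair j k \<xi>) * fourier \<phi> \<xi>)"
    and G0: "integrable lebesgue (\<lambda>\<xi>. chi (freq_pair j k \<xi>) * \<tau> (freq_pair j k \<xi>) * fourier \<phi> \<xi>)"
    using adm by (auto simp: admissible_datum_def)
  have "(\<lambda>v. vec_energy j k chi \<tau> g \<phi> (fst v) (snd v)) \<in> borel_measurable ?L"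
    using S.fibre_energy_measurable[OF g G0] by (simp cong: measurable_cong_sets)
  note [measurable] = this fun_upd_measurable[OF jk] w'
  have "(\<integral>\<^sup>+v. ennreal ((norm (w' ((snd v)(j := fst v))))\<^sup>2) * vec_energy j k chi \<sigma> f \<phi> (fst v) (snd v) \<partial>?L) \<le>
     (\<integral>\<^sup>+v. ennreal (A\<^sup>2) * (ennreal ((norm (w' ((snd v)(j := fst v))))\<^sup>2) * vec_energy j k chi \<tau> g \<phi> (fst v) (snd v)) \<partial>?L)"
  proof (rule nn_integral_mono)
    fix v assume "v \<in> space ?L"
    then have "snd v \<in> space (other_coords j k)" by (auto simp: space_pair_measure)
    from S.fibre_energy_le_if_symbol_comparison[OF f g mono_f mono_g adm cmp less_imp_le[OF A] this]
    show "ennreal ((norm (w' ((snd v)(j := fst v))))\<^sup>2) * vec_energy j k chi \<sigma> f \<phi> (fst v) (snd v) \<le>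
       ennreal (A\<^sup>2) * (ennreal ((norm (w' ((snd v)(j := fst v))))\<^sup>2) * vec_energy j k chi \<tau> g \<phi> (fst v) (snd v))"
      unfolding mult.left_commute[of "ennreal (A\<^sup>2)"] by (rule mult_left_mono) simp
  qed
  also have "\<dots> = ennreal (A\<^sup>2) * (\<integral>\<^sup>+v. ennreal ((norm (w' ((snd v)(j := fst v))))\<^sup>2) * vec_energy j k chi \<tau> g \<phi> (fst v) (snd v) \<partial>?L)"
    by (rule nn_integral_cmult) measurable
  finally show ?thesis
    unfolding weighted_norm_def L2_norm_le_iff[OF A]
      weighted_norm_squared_eq[OF jk f F0 w' ae] weighted_norm_squared_eq[OF jk g G0 w' ae] .
qed

text \<open>
  With the datum violating the symbol comparison, both squared norms are integrals of the fibre
  energies against the same weight. Positivity of the first one is where the weight must be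
  nonzero on a set of positive measure.
\<close>

lemma symbol_comparison_if_weighted_norm_le:
  fixes j k :: "'n::finite" and w :: "('n \<Rightarrow> real) \<Rightarrow> complex"
  assumes f: "C1_on_plane f" and g: "C1_on_plane g"
    and mono_f: "monotone_fibres (supp chi) f"
    and mono_g: "monotone_fibres (supp chi) g"
    and chi: "continuous_on UNIV chi" and \<sigma>: "continuous_on UNIV \<sigma>" and \<tau>: "continuous_on UNIV \<tau>"
    and A: "A > 0"
    and jk: "j \<noteq> k" and w: "w \<in> borel_measurable (lebesgue_omit k)"
    and w_nz: "emeasure (lebesgue_omit k) {v \<in> space (lebesgue_omit k). w v \<noteq> 0} > 0"
    and le: "\<And>\<phi>. admissible_datum chi \<sigma> \<tau> f g (freq_pair j k) \<phi> \<Longrightarrow>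
       weighted_norm j k w chi \<sigma> f \<phi> < \<infinity> \<and>
       weighted_norm j k w chi \<sigma> f \<phi> \<le> ennreal A * weighted_norm j k w chi \<tau> g \<phi>"
  shows "symbol_comparison chi \<sigma> \<tau> f g A"
proof (rule ccontr)
  assume viol: "\<not> symbol_comparison chi \<sigma> \<tau> f g A"
  interpret S: frequency_splitting_window "other_coords j k" "split_join j k" "freq_pair j k"
    "\<lambda>x :: real ^ 'n. restrict (\<lambda>i. x $ i) (- {j, k})" "\<lambda>m m'. \<Sum>i\<in>- {j, k}. m i * m' i"
    "gauss_window (- {j, k})" "gauss_window_transform (- {j, k})"
    by (rule splitting_vec[OF jk])
  let ?L = "(lborel :: real measure) \<Otimes>\<^sub>M other_coords j k" and ?V = "Pi\<^sub>M (- {k}) (\<lambda>_. lborel :: real measure)"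
  obtain w' where w': "w' \<in> borel_measurable ?V" and ae: "AE v in ?V. w v = w' v"
    using borel_version_complex w unfolding lebesgue_omit_def by blast
  obtain \<phi> \<rho> where \<rho>: "\<rho> > 1" and adm: "admissible_datum chi \<sigma> \<tau> f g (freq_pair j k) \<phi>"
    and pos: "\<And>m a. m \<in> space (other_coords j k) \<Longrightarrow> 0 < vec_energy j k chi \<sigma> f \<phi> a m"
    and shrink: "\<And>m a. m \<in> space (other_coords j k) \<Longrightarrow>
        vec_energy j k chi \<tau> g \<phi> a m \<le> ennreal ((1 / (\<rho> * A))\<^sup>2) * vec_energy j k chi \<sigma> f \<phi> a m"
    using S.exists_violating_datum[OF f g mono_f mono_g chi \<sigma> \<tau> A viol] by blast
  have F0: "integrable lebesgue (\<lambda>\<xi>. chi (freq_pair j k \<xi>) * \<sigma> (freq_pair j k \<xi>) * fourier \<phi> \<xi>)"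
    and G0: "integrable lebesgue (\<lambda>\<xi>. chi (freq_pair j k \<xi>) * \<tau> (freq_pair j k \<xi>) * fourier \<phi> \<xi>)"
    using adm by (auto simp: admissible_datum_def)
  have "(\<lambda>v. vec_energy j k chi \<sigma> f \<phi> (fst v) (snd v)) \<in> borel_measurable ?L"
    using S.fibre_energy_measurable[OF f F0] by (simp cong: measurable_cong_sets)
  note [measurable] = this fun_upd_measurable[OF jk] w'
  define X where "X = (\<integral>\<^sup>+v. ennreal ((norm (w' ((snd v)(j := fst v))))\<^sup>2) * vec_energy j k chi \<sigma> f \<phi> (fst v) (snd v) \<partial>?L)"
  define Y where "Y = (\<integral>\<^sup>+v. ennreal ((norm (w' ((snd v)(j := fst v))))\<^sup>2) * vec_energy j k chi \<tau> g \<phi> (fst v) (snd v) \<partial>?L)"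
  have "X \<le> ennreal (A\<^sup>2) * Y" and fin: "X < \<infinity>"
    using le[OF adm]
    unfolding weighted_norm_def L2_norm_le_iff[OF A] L2_norm_finite_iff X_def Y_def
      weighted_norm_squared_eq[OF jk f F0 w' ae] weighted_norm_squared_eq[OF jk g G0 w' ae] by auto
  moreover have "Y \<le> ennreal ((1 / (\<rho> * A))\<^sup>2) * X"
  proof -
    have "Y \<le> (\<integral>\<^sup>+v. ennreal ((1 / (\<rho> * A))\<^sup>2) *
        (ennreal ((norm (w' ((snd v)(j := fst v))))\<^sup>2) * vec_energy j k chi \<sigma> f \<phi> (fst v) (snd v)) \<partial>?L)"
      unfolding Y_def
    proof (rule nn_integral_mono)
      fix v assume "v \<in> space ?L"
      then have "snd v \<in> space (other_coords j k)" by (auto simp: space_pair_measure)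
      from shrink[OF this]
      show "ennreal ((norm (w' ((snd v)(j := fst v))))\<^sup>2) * vec_energy j k chi \<tau> g \<phi> (fst v) (snd v) \<le>
         ennreal ((1 / (\<rho> * A))\<^sup>2) * (ennreal ((norm (w' ((snd v)(j := fst v))))\<^sup>2) * vec_energy j k chi \<sigma> f \<phi> (fst v) (snd v))"
        unfolding mult.left_commute[of "ennreal ((1 / (\<rho> * A))\<^sup>2)"] by (rule mult_left_mono) simp
    qed
    also have "\<dots> = ennreal ((1 / (\<rho> * A))\<^sup>2) * X"
      unfolding X_def by (rule nn_integral_cmult) measurable
    finally show ?thesis .
  qed
  moreover have "X \<noteq> 0"
  proof
    assume "X = 0"
    then have "AE v in ?L. ennreal ((norm (w' ((snd v)(j := fst v))))\<^sup>2) * vec_energy j k chi \<sigma> f \<phi> (fst v) (snd v) = 0"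
      unfolding X_def by (subst (asm) nn_integral_0_iff_AE) measurable
    then have "AE v in ?L. w' ((snd v)(j := fst v)) = 0"
      using AE_space
    proof eventually_elim
      case (elim v)
      then have "snd v \<in> space (other_coords j k)" by (auto simp: space_pair_measure)
      from pos[OF this, of "fst v"] elim(1) show ?case by (auto simp: ennreal_eq_0_iff)
    qed
    then have "AE v in ?V. w' v = 0" by (rule AE_fun_upd_eq_0[OF jk w'])
    with ae have "AE v in ?V. w v = 0" by eventually_elim simp
    then have "AE v in lebesgue_omit k. v \<notin> {v \<in> space (lebesgue_omit k). w v \<noteq> 0}"
      unfolding lebesgue_omit_def by (intro AE_completion) (auto elim!: eventually_mono)
    moreover have "{v \<in> space (lebesgue_omit k). w v \<noteq> 0} \<in> sets (lebesgue_omit k)"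
      using w by measurable
    ultimately have "{v \<in> space (lebesgue_omit k). w v \<noteq> 0} \<in> null_sets (lebesgue_omit k)"
      by (subst AE_iff_null_sets)
    then show False using w_nz by auto
  qed
  ultimately show False
    using no_finite_positive_contraction[of X A Y \<rho>] \<rho> A by (auto simp: zero_less_iff_neq_zero)
qed

section \<open>The equivalence\<close>

theorem corollary2p4:
  fixes f g :: "real \<times> real \<Rightarrow> real"
    and chi \<sigma> \<tau> :: "real \<times> real \<Rightarrow> complex"
    and A :: real
  assumes "C1_on_plane f" and "C1_on_plane g"
    and "chi \<in> borel_measurable lebesgue"
    and "AE \<eta> in lebesgue.
           strictly_monotone_on {\<xi>. (\<xi>, \<eta>) \<in> supp chi} (\<lambda>\<xi>. f (\<xi>, \<eta>)) \<and>
           strictly_monotone_on {\<xi>. (\<xi>, \<eta>) \<in> supp chi} (\<lambda>\<xi>. g (\<xi>, \<eta>))"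
    and "continuous_on UNIV \<sigma>" and "continuous_on UNIV \<tau>"
    and "A > 0"
  shows
    "(symbol_comparison chi \<sigma> \<tau> f g A \<longrightarrow>
        (\<forall>\<phi>. admissible_datum chi \<sigma> \<tau> f g (\<lambda>\<xi>. \<xi>) \<phi> \<longrightarrow>
           (\<forall>x x'. trace_norm chi \<sigma> f \<phi> x \<le> ennreal A * trace_norm chi \<tau> g \<phi> x'))) \<and>
     (symbol_comparison chi \<sigma> \<tau> f g A \<longrightarrow>
        (\<forall>(j :: 'n::finite) k w. j \<noteq> k \<and> w \<in> borel_measurable (lebesgue_omit k) \<longrightarrow>
           (\<forall>\<phi>. admissible_datum chi \<sigma> \<tau> f g (freq_pair j k) \<phi> \<longrightarrow>
              weighted_norm j k w chi \<sigma> f \<phi> \<le> ennreal A * weighted_norm j k w chi \<tau> g \<phi>))) \<and>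
     (continuous_on UNIV chi \<longrightarrow>
        (\<exists>x x'. \<forall>\<phi>. admissible_datum chi \<sigma> \<tau> f g (\<lambda>\<xi>. \<xi>) \<phi> \<and>
              trace_norm chi \<sigma> f \<phi> x < \<infinity> \<and> trace_norm chi \<tau> g \<phi> x' < \<infinity> \<longrightarrow>
              trace_norm chi \<sigma> f \<phi> x \<le> ennreal A * trace_norm chi \<tau> g \<phi> x') \<longrightarrow>
        symbol_comparison chi \<sigma> \<tau> f g A) \<and>
     (continuous_on UNIV chi \<longrightarrow>
        (\<forall>(j :: 'n) k w. j \<noteq> k \<and> w \<in> borel_measurable (lebesgue_omit k) \<and>
           emeasure (lebesgue_omit k) {v \<in> space (lebesgue_omit k). w v \<noteq> 0} > 0 \<and>
           (\<forall>\<phi>. admissible_datum chi \<sigma> \<tau> f g (freq_pair j k) \<phi> \<longrightarrow>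
              weighted_norm j k w chi \<sigma> f \<phi> < \<infinity> \<and> weighted_norm j k w chi \<tau> g \<phi> < \<infinity> \<and>
              weighted_norm j k w chi \<sigma> f \<phi> \<le> ennreal A * weighted_norm j k w chi \<tau> g \<phi>) \<longrightarrow>
           symbol_comparison chi \<sigma> \<tau> f g A))"
proof -
  have mono: "monotone_fibres (supp chi) f"
    "monotone_fibres (supp chi) g"
    using assms(4) by (simp_all add: AE_completion_iff)
  show ?thesis
  proof (intro conjI impI allI)
    fix \<phi> x x'
    assume "symbol_comparison chi \<sigma> \<tau> f g A" "admissible_datum chi \<sigma> \<tau> f g (\<lambda>\<xi>. \<xi>) \<phi>"
    then show "trace_norm chi \<sigma> f \<phi> x \<le> ennreal A * trace_norm chi \<tau> g \<phi> x'"
      by (rule trace_norm_le[OF assms(1,2) mono assms(7)])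
  next
    fix j k :: 'n and w :: "('n \<Rightarrow> real) \<Rightarrow> complex" and \<phi>
    assume "symbol_comparison chi \<sigma> \<tau> f g A" "j \<noteq> k \<and> w \<in> borel_measurable (lebesgue_omit k)"
      "admissible_datum chi \<sigma> \<tau> f g (freq_pair j k) \<phi>"
    then show "weighted_norm j k w chi \<sigma> f \<phi> \<le> ennreal A * weighted_norm j k w chi \<tau> g \<phi>"
      using weighted_norm_le[OF assms(1,2) mono assms(7)] by blast
  next
    assume chi: "continuous_on UNIV chi"
      and "\<exists>x x'. \<forall>\<phi>. admissible_datum chi \<sigma> \<tau> f g (\<lambda>\<xi>. \<xi>) \<phi> \<and>
              trace_norm chi \<sigma> f \<phi> x < \<infinity> \<and> trace_norm chi \<tau> g \<phi> x' < \<infinity> \<longrightarrow>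
              trace_norm chi \<sigma> f \<phi> x \<le> ennreal A * trace_norm chi \<tau> g \<phi> x'"
    then show "symbol_comparison chi \<sigma> \<tau> f g A"
      using symbol_comparison_if_trace_norm_le[OF assms(1,2) mono chi assms(5-7)] by blast
  next
    fix j k :: 'n and w :: "('n \<Rightarrow> real) \<Rightarrow> complex"
    assume chi: "continuous_on UNIV chi"
      and "j \<noteq> k \<and> w \<in> borel_measurable (lebesgue_omit k) \<and>
           emeasure (lebesgue_omit k) {v \<in> space (lebesgue_omit k). w v \<noteq> 0} > 0 \<and>
           (\<forall>\<phi>. admissible_datum chi \<sigma> \<tau> f g (freq_pair j k) \<phi> \<longrightarrow>
              weighted_norm j k w chi \<sigma> f \<phi> < \<infinity> \<and> weighted_norm j k w chi \<tau> g \<phi> < \<infinity> \<and>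
              weighted_norm j k w chi \<sigma> f \<phi> \<le> ennreal A * weighted_norm j k w chi \<tau> g \<phi>)"
    then show "symbol_comparison chi \<sigma> \<tau> f g A"
      using symbol_comparison_if_weighted_norm_le[OF assms(1,2) mono chi assms(5-7), of j k w] by blast
  qed
qed

end
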